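(* Let $B:[0,T]\times H\to U$ be Borel measurable and bounded, and suppose there are $C_0>0$ and $\alpha\in(2/3,1)$ such that $|B(t,x+h)-B(t,x)|_U\le C_0|h|_H^{\alpha}$ for all $x,h\in H$, $t\in[0,T]$. Let $u\in E_0$ be the unique solution in $E_0$ of the integral equation $$u(t,x)=\int_t^TR_{s-t}\big[e^{-(s-t)A}GB(s,\cdot)\big](x)\,ds+\int_t^TR_{s-t}\big[e^{-(s-t)A}\nabla^Gu(s,\cdot)B(s,\cdot)\big](x)\,ds,\qquad (t,x)\in[0,T]\times H.$$ For a basis $(f_m)_{m\ge1}$ of $K$ put $u_m=\langle u,f_m\rangle_K$. Then $$\Big(\sum_{m\ge1}\ \sup_{|a|_U=1}|\nabla_k\nabla^G_au_m(t,x)|^2\Big)^{1/2}\le C\,|k|_K\,\sup_{t\in[0,T]}\|B(t,\cdot)\|_{C^\alpha_b(H,U)},\qquad k\in K,\ (t,x)\in[0,T]\times H,$$ where $C>0$ is independent of $x\in H$, $k\in K$, $t\in[0,T]$, $u$ and the basis $(f_m)$ of $K$.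
   Context: Setting. $T>0$. $U$ is a real separable Hilbert space and $\Lambda:\mathcal D(\Lambda)\subset U\to U$ is a positive self-adjoint operator ($\langle \Lambda u,u\rangle_U\ge m|u|_U^2$ for some $m>0$) whose inverse $\Lambda^{-1}$ is a trace class operator on $U$. $V=\mathcal D(\Lambda^{1/2})$ with $\langle h,k\rangle_V=\langle\Lambda^{1/2}h,\Lambda^{1/2}k\rangle_U$; $V'$ is its dual, identified with the completion of $U$ in the norm $|\Lambda^{-1/2}\cdot|_U$, with inner product $\langle\Lambda^{-1/2}\cdot,\Lambda^{-1/2}\cdot\rangle_U$; $\Lambda$ extends to an operator $V\to V'$. Put $H=U\times V'$ and $K=V\times U\subset H$ with the product Hilbert structures. $A$ is the operator on $H$ with $\mathcal D(A)=V\times U$, $A(y,z)=(z,-\Lambda y)$; it generates a unitary group $(e^{tA})_{t\in\mathbb R}$ on $H$, with $e^{tA}(K)=K$. $G:U\to H$, $Ga=(0,a)\in K$. Function spaces. For a Banach space $E$, $B_b$ denotes bounded Borel functions and $C_b(H,E)$ bounded uniformly continuous functions, with sup norm; $C^\alpha_b(H,E)$ is the space of $f\in C_b(H,E)$ with $[f]_\alpha=\sup_{x\ne x'}|f(x)-f(x')|_E|x-x'|_H^{-\alpha}<\infty$, with norm $\|f\|_{C_b^\alpha}=\|f\|_\infty+[f]_\alpha$. Semigroup. $Q_t=\int_0^te^{sA}GG^*e^{sA^*}ds$ (adjoints in $H$), a trace class operator on $H$, and $R_t[\Phi](x)=\int_H\Phi(e^{tA}x+y)\,\mathcal N(0,Q_t)(dy)$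 for $\Phi\in B_b(H,K)$, where $\mathcal N(0,Q_t)$ is the centered Gaussian measure on $H$ with covariance $Q_t$. Differentiability. For $F$ on $H$ and $k\in K$, $\nabla_kF(x)=\lim_{s\to0}\frac{F(x+sk)-F(x)}s$. $F$ is $K$-differentiable on $H$ if $\nabla_kF(x)$ exists for all $x\in H,k\in K$ and $\nabla^KF(x):k\mapsto\nabla_kF(x)$ is linear and bounded on $K$ for each $x$. $\nabla^G_aF(x)=\nabla_{Ga}F(x)$, $a\in U$, and $\nabla^GF(x)$ is the operator $a\mapsto\nabla^G_aF(x)$. Derivatives of functions of $(t,x)$ are in $x$. $\nabla^Gu(s,x)B(s,x)=\nabla_{GB(s,x)}u(s,x)\in K$. Space $E_0$: all $u\in B_b([0,T]\times H,K)$ such that $u(t,\cdot)$ is $K$-differentiable on $H$ with $\nabla^Ku\in B_b([0,T]\times H,L(K,K))$; there is $C_T>0$ with $\sup_{s\in[0,T]}\|\nabla^Gu(s,x)-\nabla^Gu(s,y)\|_{L(U,K)}\le C_T|x-y|_H^\alpha$ for all $x,y\in H$; and for each $\xi\in U$, $t\in[0,T]$ the map $x\mapsto\nabla^G_\xi u(t,x)$ is $K$-differentiable on $H$ with $\sup_{(t,x)\in[0,T]\times H}\sup_{|\xi|_U=1}\|\nabla^K\nabla^G_\xi u(t,x)\|_{L(K,K)}<\infty$. The integral equation has exactly one solution in $E_0$. "Basis" means orthonormal basis. *)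

theory Defs
  imports "HOL-Probability.Probability"
begin

section \<open>Operators on Hilbert spaces\<close>

text \<open>
  An unbounded operator is given by its domain \<open>D\<close> and a function \<open>L\<close>; values of \<open>L\<close>
  outside \<open>D\<close> are irrelevant. In \<open>selfadjoint\<close>, the pairs \<open>(y, z)\<close> on the left of the
  equivalence form the graph of the adjoint operator.
\<close>

definition selfadjoint :: "'u::real_inner set \<Rightarrow> ('u \<Rightarrow> 'u) \<Rightarrow> bool" where
  "selfadjoint D L \<longleftrightarrow>
     subspace D \<and> closure D = UNIV \<and>
     (\<forall>x\<in>D. \<forall>y\<in>D. L (x + y) = L x + L y) \<and>
     (\<forall>c. \<forall>x\<in>D. L (c *\<^sub>R x) = c *\<^sub>R L x) \<and>
     (\<forall>y z. (\<forall>x\<in>D. L x \<bullet> y = x \<bullet> z) \<longleftrightarrow> y \<in> D \<and> z = L y)"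

definition positive_selfadjoint :: "'u::real_inner set \<Rightarrow> ('u \<Rightarrow> 'u) \<Rightarrow> bool" where
  "positive_selfadjoint D L \<longleftrightarrow>
     selfadjoint D L \<and> (\<exists>m>0. \<forall>x\<in>D. m * (norm x)\<^sup>2 \<le> L x \<bullet> x)"

text \<open>
  \<open>(DS, S)\<close> is the nonnegative self-adjoint square root of \<open>(D, L)\<close>; the domain of the
  square of \<open>S\<close> has to be the whole of \<open>D\<close>.
\<close>

definition is_sqrt_op ::
  "'u::real_inner set \<Rightarrow> ('u \<Rightarrow> 'u) \<Rightarrow> 'u set \<Rightarrow> ('u \<Rightarrow> 'u) \<Rightarrow> bool" where
  "is_sqrt_op D L DS S \<longleftrightarrow>
     selfadjoint DS S \<and> (\<forall>x\<in>DS. 0 \<le> S x \<bullet> x) \<and>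
     D = {x \<in> DS. S x \<in> DS} \<and> (\<forall>x\<in>D. L x = S (S x))"

text \<open>Trace class (nuclear) operators in the sense of Da Prato and Zabczyk.\<close>

definition trace_class :: "('u::real_inner \<Rightarrow> 'u) \<Rightarrow> bool" where
  "trace_class P \<longleftrightarrow>
     (\<exists>a b :: nat \<Rightarrow> 'u. summable (\<lambda>n. norm (a n) * norm (b n)) \<and>
        (\<forall>x. (\<lambda>n. (x \<bullet> a n) *\<^sub>R b n) sums P x))"

definition strongly_continuous_group :: "(real \<Rightarrow> 'h::real_normed_vector \<Rightarrow> 'h) \<Rightarrow> bool" where
  "strongly_continuous_group E \<longleftrightarrow>
     (\<forall>t. bounded_linear (E t)) \<and> E 0 = id \<and> (\<forall>s t. E (s + t) = E s \<circ> E t) \<and>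
     (\<forall>x. continuous_on UNIV (\<lambda>t. E t x))"

definition generator_graph :: "(real \<Rightarrow> 'h::real_normed_vector \<Rightarrow> 'h) \<Rightarrow> ('h \<times> 'h) set" where
  "generator_graph E = {(x, y). ((\<lambda>h. (E h x - x) /\<^sub>R h) \<longlongrightarrow> y) (at 0)}"

text \<open>
  Orthonormal bases are countable families \<open>(f m)\<close>, \<open>m \<in> I\<close>; the index set \<open>I\<close> is all of
  \<open>nat\<close> (up to reindexing) unless the space is finite-dimensional.
\<close>

definition orthonormal_basis :: "nat set \<Rightarrow> (nat \<Rightarrow> 'k::real_inner) \<Rightarrow> bool" where
  "orthonormal_basis I f \<longleftrightarrow>
     (\<forall>m\<in>I. norm (f m) = 1) \<and> (\<forall>m\<in>I. \<forall>n\<in>I. m \<noteq> n \<longrightarrow> f m \<bullet> f n = 0) \<and>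
     closure (span (f ` I)) = UNIV"

section \<open>The abstract wave equation setting\<close>

text \<open>
  \<open>U\<close>, \<open>V\<close> and \<open>V'\<close> are the types \<open>'u\<close>, \<open>'v\<close> and \<open>'w\<close>, related by explicit embeddings
  \<open>i : V \<rightarrow> U\<close> and \<open>j : U \<rightarrow> V'\<close>. The assumptions below determine \<open>('v, i)\<close> and
  \<open>('w, j)\<close> up to isometric isomorphism: \<open>i\<close> identifies \<open>'v\<close> with the domain \<open>DS\<close> of
  the square root \<open>S\<close> of \<open>L\<close>, carrying the inner product
  \<open>\<langle>S h, S k\<rangle>\<close>, and the complete space \<open>'w\<close> is the completion of \<open>U\<close>
  in the norm \<open>a \<mapsto> norm (inv_into DS S a)\<close>. \<open>Lext : V \<rightarrow> V'\<close> is the continuous extension of \<open>L\<close>.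
  Then \<open>H\<close> is \<open>'u \<times> 'w\<close> and \<open>K\<close> is \<open>'v \<times> 'u\<close> with their product Hilbert structures, and
  \<open>K\<close> sits inside \<open>H\<close> through \<open>map_prod i j\<close>. \<open>E t\<close> is the operator \<open>exp (t A)\<close> on \<open>H\<close>, where
  \<open>A (v, z) = (z, - Lext v)\<close> has domain \<open>K\<close>.
\<close>

locale wave_setting =
  fixes D :: "'u::{real_inner,banach,second_countable_topology} set"
    and L :: "'u \<Rightarrow> 'u"
    and DS :: "'u set"
    and S :: "'u \<Rightarrow> 'u"
    and i :: "'v::{real_inner,banach,second_countable_topology} \<Rightarrow> 'u"
    and j :: "'u \<Rightarrow> 'w::{real_inner,banach,second_countable_topology}"
    and Lext :: "'v \<Rightarrow> 'w"
    and E :: "real \<Rightarrow> 'u \<times> 'w \<Rightarrow> 'u \<times> 'w"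
  assumes L_positive: "positive_selfadjoint D L"
    and L_inverse_trace_class: "trace_class (inv_into D L)"
    and S_sqrt: "is_sqrt_op D L DS S"
    and i_linear: "linear i"
    and i_range: "range i = DS"
    and i_inner: "\<And>h k. h \<bullet> k = S (i h) \<bullet> S (i k)"
    and j_linear: "linear j"
    and j_inner: "\<And>a b. j a \<bullet> j b = inv_into DS S a \<bullet> inv_into DS S b"
    and j_dense: "closure (range j) = UNIV"
    and Lext_bounded: "bounded_linear Lext"
    and Lext_extends: "\<And>v. i v \<in> D \<Longrightarrow> Lext v = j (L (i v))"
    and E_group: "strongly_continuous_group E"
    and E_generator:
      "generator_graph E = range (\<lambda>(v, z). (map_prod i j (v, z), (z, - Lext v)))"

text \<open>The operator \<open>G\<close> as a map into \<open>K\<close> and as a map into \<open>H\<close>.\<close>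

definition GK :: "'u \<Rightarrow> 'v::zero \<times> 'u" where
  "GK a = (0, a)"

definition GH :: "('u \<Rightarrow> 'w) \<Rightarrow> 'u \<Rightarrow> 'u::zero \<times> 'w" where
  "GH j a = (0, j a)"

text \<open>The restriction to \<open>K\<close> of an operator on \<open>H\<close> leaving \<open>K\<close> invariant (\<open>\<iota> : K \<rightarrow> H\<close> injective).\<close>

definition restrict_op :: "('k \<Rightarrow> 'h) \<Rightarrow> ('h \<Rightarrow> 'h) \<Rightarrow> 'k \<Rightarrow> 'k" where
  "restrict_op \<iota> P k = inv \<iota> (P (\<iota> k))"

section \<open>Gaussian measures and the transition semigroup\<close>

definition is_centered_gaussian ::
  "('h::real_inner \<Rightarrow> 'h) \<Rightarrow> 'h measure \<Rightarrow> bool" where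
  "is_centered_gaussian Q \<mu> \<longleftrightarrow>
     sets \<mu> = sets borel \<and> prob_space \<mu> \<and>
     (\<forall>h. (CLINT y|\<mu>. iexp (h \<bullet> y)) = complex_of_real (exp (- (Q h \<bullet> h) / 2)))"

definition centered_gaussian :: "('h::real_inner \<Rightarrow> 'h) \<Rightarrow> 'h measure" where
  "centered_gaussian Q = (THE \<mu>. is_centered_gaussian Q \<mu>)"

definition Qop ::
  "('u \<Rightarrow> 'w) \<Rightarrow> (real \<Rightarrow> 'u \<times> 'w \<Rightarrow> 'u \<times> 'w) \<Rightarrow> real \<Rightarrow>
   'u::{real_inner,banach,second_countable_topology} \<times>
     'w::{real_inner,banach,second_countable_topology} \<Rightarrow> 'u \<times> 'w" where
  "Qop j E t x =
     (LINT s:{0..t}|lborel. E s (GH j (adjoint (GH j) (adjoint (E s) x))))"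

definition Rsg ::
  "('u \<Rightarrow> 'w) \<Rightarrow> (real \<Rightarrow> 'u \<times> 'w \<Rightarrow> 'u \<times> 'w) \<Rightarrow> real \<Rightarrow>
   ('u \<times> 'w \<Rightarrow> 'k::{banach,second_countable_topology}) \<Rightarrow>
   'u::{real_inner,banach,second_countable_topology} \<times>
     'w::{real_inner,banach,second_countable_topology} \<Rightarrow> 'k" where
  "Rsg j E t \<Phi> x = (LINT y|centered_gaussian (Qop j E t). \<Phi> (E t x + y))"

section \<open>Differentiability along \<open>K\<close> and function spaces\<close>

text \<open>Here \<open>\<iota> : K \<rightarrow> H\<close> is the embedding, and \<open>dir_deriv \<iota> F k x\<close> is the derivative of \<open>F\<close> at \<open>x\<close> along \<open>\<iota> k\<close>.\<close>

definition has_dir_deriv ::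
  "('k \<Rightarrow> 'h::real_normed_vector) \<Rightarrow> ('h \<Rightarrow> 'f::real_normed_vector) \<Rightarrow> 'k \<Rightarrow> 'h \<Rightarrow> 'f \<Rightarrow> bool" where
  "has_dir_deriv \<iota> F k x d \<longleftrightarrow> ((\<lambda>s. (F (x + s *\<^sub>R \<iota> k) - F x) /\<^sub>R s) \<longlongrightarrow> d) (at 0)"

definition dir_deriv ::
  "('k \<Rightarrow> 'h::real_normed_vector) \<Rightarrow> ('h \<Rightarrow> 'f::real_normed_vector) \<Rightarrow> 'k \<Rightarrow> 'h \<Rightarrow> 'f" where
  "dir_deriv \<iota> F k x = (THE d. has_dir_deriv \<iota> F k x d)"

definition K_differentiable ::
  "('k::real_normed_vector \<Rightarrow> 'h::real_normed_vector) \<Rightarrow> ('h \<Rightarrow> 'f::real_normed_vector) \<Rightarrow> bool" where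
  "K_differentiable \<iota> F \<longleftrightarrow>
     (\<forall>x. (\<forall>k. \<exists>d. has_dir_deriv \<iota> F k x d) \<and> bounded_linear (\<lambda>k. dir_deriv \<iota> F k x))"

definition nablaK ::
  "('k::real_normed_vector \<Rightarrow> 'h::real_normed_vector) \<Rightarrow> ('h \<Rightarrow> 'f::real_normed_vector) \<Rightarrow>
   'h \<Rightarrow> 'k \<Rightarrow>\<^sub>L 'f" where
  "nablaK \<iota> F x = Blinfun (\<lambda>k. dir_deriv \<iota> F k x)"

definition nablaG ::
  "('v::real_normed_vector \<times> 'u::real_normed_vector \<Rightarrow> 'h::real_normed_vector) \<Rightarrow>
   ('h \<Rightarrow> 'f::real_normed_vector) \<Rightarrow> 'h \<Rightarrow> 'u \<Rightarrow>\<^sub>L 'f" where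
  "nablaG \<iota> F x = Blinfun (\<lambda>a. dir_deriv \<iota> F (GK a) x)"

text \<open>Bounded Borel functions of \<open>(t, x) \<in> [0, T] \<times> H\<close>; values for other \<open>t\<close> are irrelevant.\<close>

definition bounded_borel ::
  "real \<Rightarrow> (real \<Rightarrow> 'h::topological_space \<Rightarrow> 'f::real_normed_vector) \<Rightarrow> bool" where
  "bounded_borel T F \<longleftrightarrow>
     (\<lambda>(t, x). F t x) \<in> borel_measurable (restrict_space borel ({0..T} \<times> UNIV)) \<and>
     (\<exists>M. \<forall>t\<in>{0..T}. \<forall>x. norm (F t x) \<le> M)"

text \<open>
  The norm of \<open>C\<^sub>b\<^sup>\<alpha>\<close>. The pairs \<open>x = x'\<close> contribute \<open>0 / 0 = 0\<close> to the second supremum.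
\<close>

definition holder_norm :: "real \<Rightarrow> ('h::real_normed_vector \<Rightarrow> 'f::real_normed_vector) \<Rightarrow> real" where
  "holder_norm \<alpha> f =
     (SUP x. norm (f x)) + (SUP (x, x'). norm (f x - f x') / norm (x - x') powr \<alpha>)"

definition E0 ::
  "real \<Rightarrow> real \<Rightarrow>
   ('v::real_normed_vector \<times> 'u::real_normed_vector \<Rightarrow> 'h::real_normed_vector) \<Rightarrow>
   (real \<Rightarrow> 'h \<Rightarrow> 'v \<times> 'u) set" where
  "E0 T \<alpha> \<iota> = {u.
     bounded_borel T u \<and>
     (\<forall>t\<in>{0..T}. K_differentiable \<iota> (u t)) \<and>
     bounded_borel T (\<lambda>t. nablaK \<iota> (u t)) \<and>
     (\<exists>C>0. \<forall>s\<in>{0..T}. \<forall>x y.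
        norm (nablaG \<iota> (u s) x - nablaG \<iota> (u s) y) \<le> C * norm (x - y) powr \<alpha>) \<and>
     (\<forall>\<xi>. \<forall>t\<in>{0..T}. K_differentiable \<iota> (dir_deriv \<iota> (u t) (GK \<xi>))) \<and>
     (\<exists>M. \<forall>t\<in>{0..T}. \<forall>x \<xi>. norm \<xi> = 1 \<longrightarrow>
        norm (nablaK \<iota> (dir_deriv \<iota> (u t) (GK \<xi>)) x) \<le> M)}"

text \<open>The integral equation; \<open>GK (B s y)\<close> and the derivative of \<open>u s\<close> along it are \<open>K\<close>-valued.\<close>

definition solves_integral_equation ::
  "real \<Rightarrow> ('v \<Rightarrow> 'u) \<Rightarrow> ('u \<Rightarrow> 'w) \<Rightarrow> (real \<Rightarrow> 'u \<times> 'w \<Rightarrow> 'u \<times> 'w) \<Rightarrow>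
   (real \<Rightarrow> 'u \<times> 'w \<Rightarrow> 'u) \<Rightarrow>
   (real \<Rightarrow> 'u::{real_inner,banach,second_countable_topology} \<times>
       'w::{real_inner,banach,second_countable_topology} \<Rightarrow>
     'v::{real_inner,banach,second_countable_topology} \<times> 'u) \<Rightarrow> bool" where
  "solves_integral_equation T i j E B u \<longleftrightarrow>
     (let \<iota> = map_prod i j in
      \<forall>t\<in>{0..T}. \<forall>x.
        u t x =
          (LINT s:{t..T}|lborel.
             Rsg j E (s - t) (\<lambda>y. restrict_op \<iota> (E (- (s - t))) (GK (B s y))) x) +
          (LINT s:{t..T}|lborel.
             Rsg j E (s - t)
               (\<lambda>y. restrict_op \<iota> (E (- (s - t))) (dir_deriv \<iota> (u s) (GK (B s y)) y)) x))"

end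

theory Submission
  imports Defs
begin

text \<open>
  The derivatives of \<open>u\<close> exist because \<open>u\<close> lies in \<open>E\<^sub>0\<close>, so it suffices to estimate difference
  quotients uniformly and pass to the limit; no differentiation under the integral is needed.

  Null controllability gives \<open>\<langle>exp(rA) G a, x\<rangle>\<^sup>2 \<le> c r\<^sup>-\<^sup>1 \<bar>a\<bar>\<^sup>2 \<langle>Q x, x\<rangle>\<close>
  with \<open>Q\<close> the covariance accumulated on \<open>[0, r/2]\<close>, and the analogous bound with \<open>r\<^sup>-\<^sup>3\<close> for
  \<open>exp(rA) k\<close>, \<open>k \<in> K\<close>, on \<open>[r/2, r]\<close>. Hence \<open>N(0, Q\<^sub>r)\<close> is the law of
  \<open>\<xi>\<^sub>1 b\<^sub>1 + \<xi>\<^sub>2 b\<^sub>2 + Y\<close> with independent standard normal \<open>\<xi>\<^sub>1, \<xi>\<^sub>2\<close>, where \<open>b\<^sub>1\<close> and \<open>b\<^sub>2\<close> are multiples of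
  \<open>exp(rA) G a\<close> and \<open>exp(rA) k\<close>, and translations along these directions reduce to the
  one-dimensional Cameron-Martin formula. Cauchy-Schwarz in each component, summed over the basis
  with Bessel's inequality, controls the square sum with the supremum over \<open>a\<close> inside.
  Interpolating between bounded and Hoelder functions turns the weight \<open>r\<^sup>-\<^sup>3\<^sup>/\<^sup>2\<close> of \<open>\<nabla>\<^sub>k\<close> into
  \<open>r\<^sup>-\<^sup>3\<^sup>(\<^sup>1\<^sup>-\<^sup>\<alpha>\<^sup>)\<^sup>/\<^sup>2\<close>; together with \<open>r\<^sup>-\<^sup>1\<^sup>/\<^sup>2\<close> from \<open>\<nabla>\<^sup>G\<close> this is integrable exactly when
  \<open>\<alpha> > 2/3\<close>. A Gronwall argument in weighted sup norms bounds \<open>\<nabla>\<^sup>G u\<close> and its Hoelder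
  seminorm independently of \<open>u\<close>.
\<close>

section \<open>Projections and adjoints in Hilbert space\<close>

text \<open>The supremum over a stands inside the sum over m, so every component may choose its own
  direction, and a bound for the norm of the second derivative in K is not enough. Therefore the
  estimates use a selection \<open>a m\<close>, and component m is bounded by the integral of the
  square of that same component of the source; only then is the sum taken. The time interval is cut
  in two because (b1 . x)^2 + (b2 . x)^2 <= Q x . x is needed for the remaining covariance to be
  nonnegative: on disjoint halves the two control bounds simply add. The power r^(-3) for general k,
  against r^(-1) for G a, comes from the position component of the orbit, which is of size r |a| if
  it starts at 0 and of order 1 otherwise. The a priori bounds use u only through the finiteness of
  its norms in E_0, so the constants depend on T, \<alpha>, the operators and the size of B, but not
  on u.\<close>

lemma closed_subspace_projection:
  fixes M :: "'a::{real_inner,banach} set"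
  assumes M: "subspace M" "closed M"
  shows "\<exists>p\<in>M. \<forall>y\<in>M. (x - p) \<bullet> y = 0"
proof -
  define q where "q = (\<lambda>y. (norm (x - y))\<^sup>2)"
  define d where "d = Inf (q ` M)"
  have M0: "0 \<in> M" using M(1) by (rule subspace_0)
  have bdd: "bdd_below (q ` M)" by (rule bdd_belowI[of _ 0]) (auto simp: q_def)
  have d_le: "d \<le> q y" if "y \<in> M" for y
    unfolding d_def using that bdd by (intro cInf_lower) auto
  have "\<exists>y\<in>M. q y < d + inverse (real (Suc n))" for n
  proof -
    have "Inf (q ` M) < d + inverse (real (Suc n))" by (simp add: d_def)
    then show ?thesis using cInf_lessD[of "q ` M"] M0 by blast
  qed
  then obtain y where yM: "\<And>n. y n \<in> M" and yq: "\<And>n. q (y n) < d + inverse (real (Suc n))"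
    by metis
  \<comment> \<open>Parallelogram law: the midpoint of y n and y m lies in M, so its squared
    distance from x is at least d.\<close>
  have par: "(norm (y n - y m))\<^sup>2 \<le> 2 * inverse (real (Suc n)) + 2 * inverse (real (Suc m))" for n m
  proof -
    have "(1/2) *\<^sub>R (y n + y m) \<in> M" using M(1) yM by (simp add: subspace_add subspace_scale)
    then have "d \<le> q ((1/2) *\<^sub>R (y n + y m))" by (rule d_le)
    moreover have "(norm (y n - y m))\<^sup>2 = 2 * q (y n) + 2 * q (y m) - 4 * q ((1/2) *\<^sub>R (y n + y m))"
      unfolding q_def power2_norm_eq_inner
      by (simp add: inner_diff_left inner_diff_right inner_add_left inner_add_right inner_commute algebra_simps)
    ultimately show ?thesis using yq[of n] yq[of m] by linarith
  qed
  have "Cauchy y"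
  proof (rule metric_CauchyI)
    fix e :: real assume e: "e > 0"
    obtain N where N: "inverse (real (Suc N)) < e\<^sup>2 / 4"
      using reals_Archimedean[of "e\<^sup>2/4"] e by auto
    have "dist (y m) (y n) < e" if "m \<ge> N" "n \<ge> N" for m n
    proof -
      have "inverse (real (Suc m)) \<le> inverse (real (Suc N))" "inverse (real (Suc n)) \<le> inverse (real (Suc N))"
        using that by (auto simp: field_simps)
      then have "(norm (y m - y n))\<^sup>2 < e\<^sup>2" using par[of m n] N by linarith
      then show ?thesis using e by (simp add: dist_norm power2_less_imp_less)
    qed
    then show "\<exists>N. \<forall>m\<ge>N. \<forall>n\<ge>N. dist (y m) (y n) < e" by blast
  qed
  then obtain p where p: "y \<longlonglongrightarrow> p" using Cauchy_convergent_iff convergentD by blast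
  have pM: "p \<in> M" using M(2) yM p closed_sequentially by blast
  have "(\<lambda>n. q (y n)) \<longlonglongrightarrow> q p" unfolding q_def by (intro tendsto_intros p)
  moreover have "(\<lambda>n. d + inverse (real (Suc n))) \<longlonglongrightarrow> d + 0"
    by (intro tendsto_intros LIMSEQ_inverse_real_of_nat)
  ultimately have qp: "q p \<le> d" using yq by (intro LIMSEQ_le[of _ "q p" _ d]) (auto intro: less_imp_le)
  have "(x - p) \<bullet> z = 0" if z: "z \<in> M" for z
  proof (rule ccontr)
    assume ne: "(x - p) \<bullet> z \<noteq> 0"
    then have zz: "z \<bullet> z > 0" by auto
    \<comment> \<open>The vertex of the parabola t -> q (p + t z), where the decrease is ((x - p) .
      z)^2 / (z . z).\<close>
    define t where "t = ((x - p) \<bullet> z) / (z \<bullet> z)"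
    have "p + t *\<^sub>R z \<in> M" using M(1) pM z by (simp add: subspace_add subspace_scale)
    then have "q p \<le> q (p + t *\<^sub>R z)" using d_le qp by force
    also have "q (p + t *\<^sub>R z) = q p - 2 * t * ((x - p) \<bullet> z) + t * t * (z \<bullet> z)"
      unfolding q_def power2_norm_eq_inner
      by (simp add: inner_diff_left inner_diff_right inner_add_left inner_add_right inner_commute algebra_simps)
    also have "\<dots> = q p - ((x - p) \<bullet> z)\<^sup>2 / (z \<bullet> z)"
      unfolding t_def using zz by (simp add: field_simps power2_eq_square)
    finally have "((x - p) \<bullet> z)\<^sup>2 / (z \<bullet> z) \<le> 0" by simp
    moreover have "((x - p) \<bullet> z)\<^sup>2 / (z \<bullet> z) > 0" using ne zz by simp
    ultimately show False by simp
  qed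
  with pM show ?thesis by blast
qed

lemma riesz_representation:
  fixes f :: "'a::{real_inner,banach} \<Rightarrow> real"
  assumes "bounded_linear f"
  shows "\<exists>z. \<forall>x. f x = x \<bullet> z"
proof (cases "\<forall>x. f x = 0")
  case True
  then show ?thesis by (intro exI[of _ 0]) auto
next
  case False
  then obtain x0 where x0: "f x0 \<noteq> 0" by auto
  interpret f: bounded_linear f by fact
  let ?M = "{x. f x = 0}"
  have "subspace ?M" by (auto simp: subspace_def f.add f.scaleR f.zero)
  moreover have "closed ?M"
    by (intro closed_Collect_eq continuous_intros f.continuous_on)
  ultimately obtain p where p: "f p = 0" "\<And>y. f y = 0 \<Longrightarrow> (x0 - p) \<bullet> y = 0"
    using closed_subspace_projection[of ?M x0] by auto
  define w where "w = x0 - p"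
  have fw: "f w = f x0" by (simp add: w_def f.diff p)
  then have w0: "w \<bullet> w > 0" using x0 f.zero by auto
  have "f x = x \<bullet> ((f w / (w \<bullet> w)) *\<^sub>R w)" for x
  proof -
    have "f (x - (f x / f w) *\<^sub>R w) = 0" using fw x0 by (simp add: f.diff f.scaleR)
    then have "w \<bullet> (x - (f x / f w) *\<^sub>R w) = 0" using p(2) by (simp add: w_def)
    then have "x \<bullet> w = (f x / f w) * (w \<bullet> w)" by (simp add: inner_diff_right inner_commute)
    then show ?thesis using w0 fw x0 by (simp add: field_simps)
  qed
  then show ?thesis by blast
qed

text \<open>\<open>adjoint\<close> is defined by choice, so the pairing identity holds once some
  adjoint is known to exist; the Riesz representation of x -> f x . y supplies one.\<close>

lemma adjoint_works_hilbert:
  fixes f :: "'a::{real_inner,banach} \<Rightarrow> 'b::real_inner"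
  assumes "bounded_linear f"
  shows "f x \<bullet> y = x \<bullet> adjoint f y"
proof -
  interpret f: bounded_linear f by fact
  have "\<forall>y. \<exists>z. \<forall>x. f x \<bullet> y = x \<bullet> z"
  proof
    fix y
    have "bounded_linear (\<lambda>x. f x \<bullet> y)"
      using bounded_linear_compose[OF bounded_linear_inner_left assms] by simp
    then show "\<exists>z. \<forall>x. f x \<bullet> y = x \<bullet> z" by (rule riesz_representation)
  qed
  then obtain g where "\<forall>x y. f x \<bullet> y = x \<bullet> g y" by metis
  then have "adjoint f = g" by (rule adjoint_unique)
  with \<open>\<forall>x y. f x \<bullet> y = x \<bullet> g y\<close> show ?thesis by simp
qed

lemma bounded_linear_adjoint:
  fixes f :: "'a::{real_inner,banach} \<Rightarrow> 'b::real_inner"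
  assumes "bounded_linear f"
  shows "bounded_linear (adjoint f)"
proof -
  interpret f: bounded_linear f by fact
  have a: "\<And>x y. adjoint f y \<bullet> x = f x \<bullet> y" 
    by (metis adjoint_works_hilbert[OF assms] inner_commute)
  obtain K where K: "K > 0" "\<And>x. norm (f x) \<le> norm x * K" using f.pos_bounded by blast
  show ?thesis
  proof (rule bounded_linear_intro)
    fix x y show "adjoint f (x + y) = adjoint f x + adjoint f y"
      by (rule vector_eq_rdot[THEN iffD1], rule allI) (simp add: inner_add_left inner_add_right a)
  next
    fix r x show "adjoint f (r *\<^sub>R x) = r *\<^sub>R adjoint f x"
      by (rule vector_eq_rdot[THEN iffD1], rule allI) (simp add: a)
  next
    fix y
    have "(norm (adjoint f y))\<^sup>2 = f (adjoint f y) \<bullet> y" by (simp add: power2_norm_eq_inner a)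
    also have "\<dots> \<le> norm (f (adjoint f y)) * norm y" by (rule norm_cauchy_schwarz)
    also have "\<dots> \<le> norm (adjoint f y) * K * norm y" by (intro mult_right_mono K) auto
    finally show "norm (adjoint f y) \<le> norm y * K"
      using K(1) by (cases "adjoint f y = 0") (auto simp: power2_eq_square mult.commute mult.left_commute)
  qed
qed

lemma closed_subspace_eq_UNIV:
  fixes M :: "'a::{real_inner,banach} set"
  assumes "subspace M" "closed M" "\<And>y. (\<And>x. x \<in> M \<Longrightarrow> x \<bullet> y = 0) \<Longrightarrow> y = 0"
  shows "M = UNIV"
proof -
  have "x \<in> M" for x
  proof -
    obtain p where p: "p \<in> M" "\<And>y. y \<in> M \<Longrightarrow> (x - p) \<bullet> y = 0"
      using closed_subspace_projection[OF assms(1,2), of x] by blast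
    have "x - p = 0" by (rule assms(3)) (metis p(2) inner_commute)
    with p(1) show ?thesis by simp
  qed
  then show ?thesis by blast
qed

section \<open>Measures are determined by their characteristic functional\<close>

text \<open>A closed ball is the intersection of the half-spaces d . x <= d . c + r |d| over a
  countable dense set of d, and by separability every open set is a countable union of closed balls.
  Cylinders over finitely many functionals therefore suffice.\<close>

lemma sigma_sets_inner_cylinders:
  "sets (borel :: 'a::{real_inner,second_countable_topology} measure) =
     sigma_sets UNIV {{x. \<forall>p\<in>F. fst p \<bullet> x \<in> snd p} | F. finite F \<and> (\<forall>p\<in>F. snd p \<in> sets borel)}"
  (is "_ = sigma_sets UNIV ?G")
proof (rule antisym)
  interpret S: sigma_algebra UNIV "sigma_sets UNIV ?G"
    by (rule sigma_algebra_sigma_sets) auto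
  obtain D :: "'a set" where D: "countable D" "\<And>X. open X \<Longrightarrow> X \<noteq> {} \<Longrightarrow> \<exists>d\<in>D. d \<in> X"
    using countable_dense_exists by blast
  have half: "{x. d \<bullet> x \<in> A} \<in> sigma_sets UNIV ?G" if "A \<in> sets borel" for d :: 'a and A
    by (rule sigma_sets.Basic) (use that in \<open>auto intro!: exI[of _ "{(d, A)}"]\<close>)
  have cb: "cball c r \<in> sigma_sets UNIV ?G" if r: "r \<ge> 0" for c :: 'a and r
  proof -
    have "cball c r = (\<Inter>d\<in>D. {x. d \<bullet> x \<in> {..d \<bullet> c + r * norm d}})" (is "_ = ?R")
    proof (intro set_eqI iffI)
      fix x assume "x \<in> cball c r"
      then have x: "norm (x - c) \<le> r" by (simp add: dist_norm norm_minus_commute)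
      have "d \<bullet> (x - c) \<le> r * norm d" for d
        using norm_cauchy_schwarz[of d "x - c"] mult_left_mono[OF x, of "norm d"] by (simp add: mult.commute)
      then show "x \<in> ?R" by (auto simp: inner_diff_right algebra_simps)
    next
      fix x assume x: "x \<in> ?R"
      have "closed {d. d \<bullet> (x - c) \<le> r * norm d}"
        by (intro closed_Collect_le continuous_intros)
      moreover have "D \<subseteq> {d. d \<bullet> (x - c) \<le> r * norm d}"
        using x by (auto simp: inner_diff_right algebra_simps)
      ultimately have "d \<bullet> (x - c) \<le> r * norm d" for d
        using D(2)[of "- {d. d \<bullet> (x - c) \<le> r * norm d}"] by (auto simp: closed_def)
      \<comment> \<open>Closedness has carried the inequality from the dense set to all d; with d =
        x - c it becomes a bound for the norm.\<close>
      from this[of "x - c"] have *: "norm (x - c) * norm (x - c) \<le> r * norm (x - c)"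
        by (simp add: dot_square_norm power2_eq_square)
      then show "x \<in> cball c r"
        using r by (cases "x = c") (auto simp: dist_norm norm_minus_commute)
    qed
    moreover have "?R \<in> sigma_sets UNIV ?G"
    proof (rule S.countable_INT')
      show "D \<noteq> {}" using D(2)[of UNIV] by auto
      show "(\<lambda>d. {x. d \<bullet> x \<in> {..d \<bullet> c + r * norm d}}) ` D \<subseteq> sigma_sets UNIV ?G"
        by (intro image_subsetI half) simp
    qed (rule D)
    ultimately show ?thesis by simp
  qed
  have "U \<in> sigma_sets UNIV ?G" if U: "open U" for U :: "'a set"
  proof -
    define I where "I = {(c, n::nat). c \<in> D \<and> cball c (inverse (real (Suc n))) \<subseteq> U}"
    have "countable I"
      by (rule countable_subset[of _ "D \<times> UNIV"]) (auto simp: I_def D(1))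
    moreover have "U = (\<Union>(c, n)\<in>I. cball c (inverse (real (Suc n))))"
    proof (intro set_eqI iffI)
      fix x assume "x \<in> U"
      then obtain e where e: "e > 0" "ball x e \<subseteq> U" using U openE by blast
      then obtain n where n: "inverse (real (Suc n)) < e / 2"
        using reals_Archimedean[of "e/2"] by auto
      obtain c where c: "c \<in> D" "c \<in> ball x (inverse (real (Suc n)))"
        using D(2)[of "ball x (inverse (real (Suc n)))"] by auto
      have "cball c (inverse (real (Suc n))) \<subseteq> ball x e"
      proof
        fix y assume "y \<in> cball c (inverse (real (Suc n)))"
        then show "y \<in> ball x e" using c n dist_triangle[of x y c] by auto
      qed
      then have "(c, n) \<in> I" using c e by (auto simp: I_def)
      moreover have "x \<in> cball c (inverse (real (Suc n)))" using c by (auto simp: dist_commute)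
      ultimately show "x \<in> (\<Union>(c, n)\<in>I. cball c (inverse (real (Suc n))))" by blast
    qed (auto simp: I_def)
    moreover have "(\<Union>(c, n)\<in>I. cball c (inverse (real (Suc n)))) \<in> sigma_sets UNIV ?G"
      by (rule S.countable_UN') (use \<open>countable I\<close> cb in auto)
    ultimately show ?thesis by simp
  qed
  then have "{S. open S} \<subseteq> sigma_sets UNIV ?G" by blast
  then have "sigma_sets UNIV {S. open S} \<subseteq> sigma_sets UNIV ?G" by (rule S.sigma_sets_subset)
  moreover have "sets (borel :: 'a measure) = sigma_sets UNIV {S. open S}" by (simp add: borel_def)
  ultimately show "sets (borel :: 'a measure) \<subseteq> sigma_sets UNIV ?G" by simp
next
  show "sigma_sets UNIV ?G \<subseteq> sets (borel :: 'a measure)"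
  proof (rule sets.sigma_sets_subset')
    show "?G \<subseteq> sets (borel :: 'a measure)"
    proof safe
      fix F :: "('a \<times> real set) set" assume F: "finite F" "\<forall>p\<in>F. snd p \<in> sets borel"
      have "{x. fst p \<bullet> x \<in> snd p} \<in> sets borel" if "p \<in> F" for p
      proof -
        have [measurable]: "snd p \<in> sets borel" using F that by auto
        have "(\<lambda>x. fst p \<bullet> x) -` snd p \<inter> space borel \<in> sets borel"
          by (rule measurable_sets[of _ borel borel]) auto
        then show ?thesis by (simp add: vimage_def)
      qed
      then show "{x. \<forall>p\<in>F. fst p \<bullet> x \<in> snd p} \<in> sets borel"
        using sets.sets_Collect_finite_All[of F borel "\<lambda>p x. fst p \<bullet> x \<in> snd p"] F by (simp add: Ball_def)
    qed
  qed simp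
qed

text \<open>The measures with density F against \<mu> and \<nu> have the same characteristic
  functional, written in real form. A general weight F is what makes an induction over cylinder
  constraints possible.\<close>

definition same_weighted_char ::
  "'a::{real_inner,second_countable_topology} measure \<Rightarrow> 'a measure \<Rightarrow> ('a \<Rightarrow> real) \<Rightarrow> bool" where
  "same_weighted_char \<mu> \<nu> F \<longleftrightarrow> (\<forall>h.
     (\<integral>x. F x * cos (h \<bullet> x) \<partial>\<mu>) = (\<integral>x. F x * cos (h \<bullet> x) \<partial>\<nu>) \<and>
     (\<integral>x. F x * sin (h \<bullet> x) \<partial>\<mu>) = (\<integral>x. F x * sin (h \<bullet> x) \<partial>\<nu>))"

context
  fixes \<mu> \<nu> :: "'a::{real_inner,second_countable_topology} measure"
  assumes \<mu>: "prob_space \<mu>" "sets \<mu> = sets borel" and \<nu>: "prob_space \<nu>" "sets \<nu> = sets borel"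
begin

text \<open>If the common total mass c is positive, division by c gives probability measures whose
  images under x -> h0 . x have equal characteristic functions, and the one-dimensional uniqueness
  theorem applies. If c = 0, both sides are 0.\<close>

lemma same_weighted_char_half_space:
  fixes F :: "'a \<Rightarrow> real"
  assumes F[measurable]: "F \<in> borel_measurable borel" and Fb: "\<And>x. 0 \<le> F x" "\<And>x. F x \<le> b"
    and FF: "same_weighted_char \<mu> \<nu> F" and A[measurable]: "A \<in> sets borel"
  shows "(\<integral>x. F x * indicator A (h0 \<bullet> x) \<partial>\<mu>) = (\<integral>x. F x * indicator A (h0 \<bullet> x) \<partial>\<nu>)"
proof -
  note [measurable_cong] = \<mu>(2) \<nu>(2)
  define c where "c = (\<integral>x. F x \<partial>\<mu>)"
  have FF': "(\<integral>x. F x * cos (h \<bullet> x) \<partial>\<mu>) = (\<integral>x. F x * cos (h \<bullet> x) \<partial>\<nu>)"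
    "(\<integral>x. F x * sin (h \<bullet> x) \<partial>\<mu>) = (\<integral>x. F x * sin (h \<bullet> x) \<partial>\<nu>)" for h
    using FF by (auto simp: same_weighted_char_def)
  have c\<nu>: "c = (\<integral>x. F x \<partial>\<nu>)" using FF'(1)[of 0] by (simp add: c_def)
  have intF: "integrable M (\<lambda>x. F x * g x)"
    if "prob_space M" "sets M = sets borel" and [measurable]: "g \<in> borel_measurable borel"
      and g: "\<And>x. \<bar>g x\<bar> \<le> 1" for M and g :: "'a \<Rightarrow> real"
  proof -
    interpret prob_space M by fact
    note [measurable_cong] = that(2)
    have "\<bar>F x * g x\<bar> \<le> b" for x
      using mult_mono[OF Fb(2)[of x] g[of x]] Fb(1)[of x] order_trans[OF Fb(1)[of x] Fb(2)[of x]]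
      by (simp add: abs_mult)
    then show ?thesis by (intro integrable_const_bound[of _ b]) auto
  qed
  have c0: "c \<ge> 0" unfolding c_def using Fb by simp
  show ?thesis
  proof (cases "c = 0")
    case True
    have *: "(\<integral>x. F x * indicator A (h0 \<bullet> x) \<partial>M) = 0"
      if M: "prob_space M" "sets M = sets borel" and z: "(\<integral>x. F x \<partial>M) = 0" for M
    proof -
      note [measurable_cong] = that(2)
      have "(\<integral>x. F x * indicator A (h0 \<bullet> x) \<partial>M) \<le> (\<integral>x. F x \<partial>M)"
        using intF[OF M, of "\<lambda>x. 1"] intF[OF M, of "\<lambda>x. indicator A (h0 \<bullet> x)"] Fb
        by (intro integral_mono) (auto simp: indicator_def)
      moreover have "0 \<le> (\<integral>x. F x * indicator A (h0 \<bullet> x) \<partial>M)"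
        using Fb by (intro integral_nonneg_AE) auto
      ultimately show ?thesis using z by simp
    qed
    show ?thesis using *[OF \<mu>] *[OF \<nu>] True c\<nu> c_def by simp
  next
    case False
    then have cpos: "c > 0" using c0 by simp
    define D where "D M = distr (density M (\<lambda>x. ennreal (F x / c))) borel (\<lambda>x. h0 \<bullet> x)" for M
    have D: "real_distribution (D M)" 
      and Dc: "char (D M) t = complex_of_real ((\<integral>x. F x * cos ((t *\<^sub>R h0) \<bullet> x) \<partial>M) / c) + 
          \<i> * complex_of_real ((\<integral>x. F x * sin ((t *\<^sub>R h0) \<bullet> x) \<partial>M) / c)"
      and Dm: "measure (D M) A = (\<integral>x. F x * indicator A (h0 \<bullet> x) \<partial>M) / c"
      if M: "prob_space M" "sets M = sets borel" and z: "(\<integral>x. F x \<partial>M) = c" for M t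
    proof -
      note [measurable_cong] = that(2)
      interpret prob_space M by fact
      have "(\<integral>\<^sup>+x. ennreal (F x / c) \<partial>M) = ennreal (\<integral>x. F x / c \<partial>M)"
        using intF[OF M, of "\<lambda>x. 1"] Fb cpos by (intro nn_integral_eq_integral) auto
      also have "(\<integral>x. F x / c \<partial>M) = 1" using z cpos by simp
      finally have "prob_space (density M (\<lambda>x. ennreal (F x / c)))"
        by (intro prob_spaceI) (simp add: emeasure_density)
      then have "prob_space (D M)" unfolding D_def
        by (intro prob_space.prob_space_distr) auto
      then show rd: "real_distribution (D M)"
        by (simp add: real_distribution_def real_distribution_axioms_def D_def)
      have fin: "finite_measure (D M)" using rd by (simp add: real_distribution_def prob_space.finite_measure)
      have i1: "integrable M (\<lambda>x. (F x / c) *\<^sub>R iexp (t * (h0 \<bullet> x)))"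
      proof (rule integrable_const_bound[of _ "b / c"])
        show "AE x in M. cmod ((F x / c) *\<^sub>R iexp (t * (h0 \<bullet> x))) \<le> b / c"
          using Fb cpos by (auto simp: divide_right_mono)
      qed auto
      have ch: "char (D M) t = (CLINT x|M. (F x / c) *\<^sub>R iexp (t * (h0 \<bullet> x)))"
        unfolding char_def D_def using cpos Fb
        by (subst integral_distr) (auto simp: integral_density)
      have "Re (char (D M) t) = (\<integral>x. Re ((F x / c) *\<^sub>R iexp (t * (h0 \<bullet> x))) \<partial>M)"
        unfolding ch by (rule integral_Re[OF i1, symmetric])
      moreover have "Im (char (D M) t) = (\<integral>x. Im ((F x / c) *\<^sub>R iexp (t * (h0 \<bullet> x))) \<partial>M)"
        unfolding ch by (rule integral_Im[OF i1, symmetric])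
      ultimately show "char (D M) t = complex_of_real ((\<integral>x. F x * cos ((t *\<^sub>R h0) \<bullet> x) \<partial>M) / c) + 
          \<i> * complex_of_real ((\<integral>x. F x * sin ((t *\<^sub>R h0) \<bullet> x) \<partial>M) / c)"
        by (simp add: complex_eq_iff Re_exp Im_exp)
      have "measure (D M) A = (\<integral>x. indicator A x \<partial>D M)"
        by (simp add: D_def)
      also have "\<dots> = (\<integral>x. (F x / c) *\<^sub>R indicator A (h0 \<bullet> x) \<partial>M)"
        unfolding D_def using cpos Fb
        by (subst integral_distr) (auto simp: integral_density)
      finally show "measure (D M) A = (\<integral>x. F x * indicator A (h0 \<bullet> x) \<partial>M) / c"
        by simp
    qed
    have "D \<mu> = D \<nu>"
      by (rule Levy_uniqueness[OF D D])
        (use \<mu> \<nu> c_def c\<nu> in \<open>simp_all add: fun_eq_iff Dc FF' del: inner_scaleR_left\<close>)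
    then have "measure (D \<mu>) A = measure (D \<nu>) A" by simp
    then show ?thesis using Dm[OF \<mu>] Dm[OF \<nu>] c_def c\<nu> cpos by simp
  qed
qed

text \<open>
  The weights \<open>F (1 + cos \<langle>h, x\<rangle>)\<close> and \<open>F (1 + sin \<langle>h, x\<rangle>)\<close> are nonnegative, so the one-dimensional
  uniqueness theorem applies to them as well; hence indicators of half-spaces can be absorbed into
  the weight one at a time.
\<close>

lemma same_weighted_char_mult_indicator:
  fixes F :: "'a \<Rightarrow> real"
  assumes F[measurable]: "F \<in> borel_measurable borel" and Fb: "\<And>x. 0 \<le> F x" "\<And>x. F x \<le> b"
    and FF: "same_weighted_char \<mu> \<nu> F" and A[measurable]: "A \<in> sets borel"
  shows "same_weighted_char \<mu> \<nu> (\<lambda>x. F x * indicator A (h0 \<bullet> x))"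
proof -
  have FF': "(\<integral>x. F x * cos (h \<bullet> x) \<partial>\<mu>) = (\<integral>x. F x * cos (h \<bullet> x) \<partial>\<nu>)"
    "(\<integral>x. F x * sin (h \<bullet> x) \<partial>\<mu>) = (\<integral>x. F x * sin (h \<bullet> x) \<partial>\<nu>)" for h
    using FF by (auto simp: same_weighted_char_def)
  have b0: "b \<ge> 0" using Fb order_trans by blast
  have int: "integrable M (\<lambda>x. F x * g x)"
    if "M = \<mu> \<or> M = \<nu>" and [measurable]: "g \<in> borel_measurable borel"
      and g: "\<And>x. \<bar>g x\<bar> \<le> 1" for M and g :: "'a \<Rightarrow> real"
  proof -
    have M: "prob_space M" "sets M = sets borel" using that \<mu> \<nu> by auto
    interpret prob_space M by fact
    note [measurable_cong] = M(2)
    have "\<bar>F x * g x\<bar> \<le> b" for x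
      using mult_mono[OF Fb(2)[of x] g[of x]] Fb(1)[of x] order_trans[OF Fb(1)[of x] Fb(2)[of x]]
      by (simp add: abs_mult)
    then show ?thesis by (intro integrable_const_bound[of _ b]) auto
  qed
  have key: "(\<integral>x. F x * (1 + w x) * indicator A (h0 \<bullet> x) \<partial>\<mu>) = (\<integral>x. F x * (1 + w x) * indicator A (h0 \<bullet> x) \<partial>\<nu>)"
    if w: "w = (\<lambda>x. cos (h \<bullet> x)) \<or> w = (\<lambda>x. sin (h \<bullet> x))" for w and h
  proof (rule same_weighted_char_half_space[where b = "b * 2"])
    have wb: "-1 \<le> w x" "w x \<le> 1" for x using w by auto
    show "(\<lambda>x. F x * (1 + w x)) \<in> borel_measurable borel" using w by auto
    show "0 \<le> F x * (1 + w x)" for x using wb[of x] Fb[of x] by simp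
    show "F x * (1 + w x) \<le> b * 2" for x using wb[of x] Fb[of x] b0 by (intro mult_mono) auto
    have m: "(\<lambda>x. w x) \<in> borel_measurable borel" using w by auto
    have split: "(\<integral>x. F x * (1 + w x) * g x \<partial>M) = (\<integral>x. F x * g x \<partial>M) + (\<integral>x. F x * (w x * g x) \<partial>M)"
      if M: "M = \<mu> \<or> M = \<nu>" and g[measurable]: "g \<in> borel_measurable borel" and gb: "\<And>x. \<bar>g x\<bar> \<le> 1" for g M
    proof -
      have "\<bar>w x * g x\<bar> \<le> 1" for x
        using mult_mono[of "\<bar>w x\<bar>" 1 "\<bar>g x\<bar>" 1] wb[of x] gb[of x] by (auto simp: abs_mult)
      then have "integrable M (\<lambda>x. F x * (w x * g x))" using m by (intro int M) auto
      moreover have "integrable M (\<lambda>x. F x * g x)" using gb by (intro int M) auto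
      ultimately show ?thesis by (subst Bochner_Integration.integral_add[symmetric]) (auto simp: algebra_simps)
    qed
    have prod: "(\<integral>x. F x * (w x * g x) \<partial>\<mu>) = (\<integral>x. F x * (w x * g x) \<partial>\<nu>)"
      if g: "g = (\<lambda>x. cos (k \<bullet> x)) \<or> g = (\<lambda>x. sin (k \<bullet> x))" for g k
    proof -
      \<comment> \<open>Product-to-sum formulas: w g is a combination of cosines, or of sines, of (h
        - k) . x and (h + k) . x, and for these the weighted integrals agree by
        \<open>FF'\<close>.\<close>
      have "\<exists>s1 s2 v. (v = (\<lambda>h. \<lambda>x. cos (h \<bullet> x)) \<or> v = (\<lambda>h. \<lambda>x. sin (h \<bullet> x))) \<and>
         (\<forall>x. w x * g x = s1 * v (h - k) x + s2 * v (h + k) x)"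
        using w g
      proof (elim disjE)
      assume wg: "w = (\<lambda>x. cos (h \<bullet> x))" "g = (\<lambda>x. cos (k \<bullet> x))"
        have "w x * g x = 1/2 * cos ((h - k) \<bullet> x) + 1/2 * cos ((h + k) \<bullet> x)" for x
          unfolding wg inner_diff_left inner_add_left sin_add sin_diff cos_add cos_diff by argo
        then show ?thesis
          by (intro exI[of _ "1/2"] exI[of _ "1/2"] exI[of _ "(\<lambda>h. \<lambda>x. cos (h \<bullet> x))"]) auto
      next
        assume wg: "w = (\<lambda>x. sin (h \<bullet> x))" "g = (\<lambda>x. cos (k \<bullet> x))"
        have "w x * g x = 1/2 * sin ((h - k) \<bullet> x) + 1/2 * sin ((h + k) \<bullet> x)" for x
          unfolding wg inner_diff_left inner_add_left sin_add sin_diff cos_add cos_diff by argo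
        then show ?thesis
          by (intro exI[of _ "1/2"] exI[of _ "1/2"] exI[of _ "(\<lambda>h. \<lambda>x. sin (h \<bullet> x))"]) auto
      next
        assume wg: "w = (\<lambda>x. cos (h \<bullet> x))" "g = (\<lambda>x. sin (k \<bullet> x))"
        have "w x * g x = -1/2 * sin ((h - k) \<bullet> x) + 1/2 * sin ((h + k) \<bullet> x)" for x
          unfolding wg inner_diff_left inner_add_left sin_add sin_diff cos_add cos_diff by argo
        then show ?thesis
          by (intro exI[of _ "-1/2"] exI[of _ "1/2"] exI[of _ "(\<lambda>h. \<lambda>x. sin (h \<bullet> x))"]) auto
      next
        assume wg: "w = (\<lambda>x. sin (h \<bullet> x))" "g = (\<lambda>x. sin (k \<bullet> x))"
        have "w x * g x = 1/2 * cos ((h - k) \<bullet> x) + -1/2 * cos ((h + k) \<bullet> x)" for x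
          unfolding wg inner_diff_left inner_add_left sin_add sin_diff cos_add cos_diff by argo
        then show ?thesis
          by (intro exI[of _ "1/2"] exI[of _ "-1/2"] exI[of _ "(\<lambda>h. \<lambda>x. cos (h \<bullet> x))"]) auto
      qed
      then obtain s1 s2 v where v: "v = (\<lambda>h. \<lambda>x. cos (h \<bullet> x)) \<or> v = (\<lambda>h. \<lambda>x. sin (h \<bullet> x))" and
        wg: "\<And>x. w x * g x = s1 * v (h - k) x + s2 * v (h + k) x" by blast
      have "(\<integral>x. F x * (w x * g x) \<partial>M) = s1 * (\<integral>x. F x * v (h - k) x \<partial>M) + s2 * (\<integral>x. F x * v (h + k) x \<partial>M)"
        if M: "M = \<mu> \<or> M = \<nu>" for M
      proof -
        have i: "integrable M (\<lambda>x. F x * v k x)" for k using v M by (intro int) auto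
        have "(\<integral>x. F x * (w x * g x) \<partial>M) = (\<integral>x. s1 * (F x * v (h - k) x) + s2 * (F x * v (h + k) x) \<partial>M)"
          by (intro Bochner_Integration.integral_cong refl) (simp only: wg distrib_left mult.left_commute)
        also have "\<dots> = s1 * (\<integral>x. F x * v (h - k) x \<partial>M) + s2 * (\<integral>x. F x * v (h + k) x \<partial>M)"
          using i[of "h - k"] i[of "h + k"] by simp
        finally show ?thesis .
      qed
      then show ?thesis using v FF' by auto
    qed
    show "same_weighted_char \<mu> \<nu> (\<lambda>x. F x * (1 + w x))"
      unfolding same_weighted_char_def
    proof (intro allI conjI)
      fix k
      show "(\<integral>x. F x * (1 + w x) * cos (k \<bullet> x) \<partial>\<mu>) = (\<integral>x. F x * (1 + w x) * cos (k \<bullet> x) \<partial>\<nu>)"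
        using split[of \<mu> "\<lambda>x. cos (k \<bullet> x)"] split[of \<nu> "\<lambda>x. cos (k \<bullet> x)"] prod[of "\<lambda>x. cos (k \<bullet> x)" k] FF'(1)[of k] by simp
      show "(\<integral>x. F x * (1 + w x) * sin (k \<bullet> x) \<partial>\<mu>) = (\<integral>x. F x * (1 + w x) * sin (k \<bullet> x) \<partial>\<nu>)"
        using split[of \<mu> "\<lambda>x. sin (k \<bullet> x)"] split[of \<nu> "\<lambda>x. sin (k \<bullet> x)"] prod[of "\<lambda>x. sin (k \<bullet> x)" k] FF'(2)[of k] by simp
    qed
  qed fact
  have key0: "(\<integral>x. F x * indicator A (h0 \<bullet> x) \<partial>\<mu>) = (\<integral>x. F x * indicator A (h0 \<bullet> x) \<partial>\<nu>)"
    by (rule same_weighted_char_half_space) fact+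
  \<comment> \<open>Subtracting the identity for the weight F from the one for F (1 + w) isolates
    the trigonometric moment of the truncated weight.\<close>
  have "(\<integral>x. F x * indicator A (h0 \<bullet> x) * w x \<partial>\<mu>) = (\<integral>x. F x * indicator A (h0 \<bullet> x) * w x \<partial>\<nu>)"
    if w: "w = (\<lambda>x. cos (h \<bullet> x)) \<or> w = (\<lambda>x. sin (h \<bullet> x))" for w h
  proof -
    have wb: "\<bar>w x\<bar> \<le> 1" for x using w by auto
    have "(\<integral>x. F x * (1 + w x) * indicator A (h0 \<bullet> x) \<partial>M) = 
       (\<integral>x. F x * indicator A (h0 \<bullet> x) \<partial>M) + (\<integral>x. F x * indicator A (h0 \<bullet> x) * w x \<partial>M)"
      if M: "M = \<mu> \<or> M = \<nu>" for M
    proof -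
      have "integrable M (\<lambda>x. F x * (indicator A (h0 \<bullet> x) * w x))"
        using w wb by (intro int M) (auto simp: indicator_def)
      moreover have "integrable M (\<lambda>x. F x * indicator A (h0 \<bullet> x))"
        by (intro int M) (auto simp: indicator_def)
      ultimately show ?thesis
        by (subst Bochner_Integration.integral_add[symmetric]) (auto simp: algebra_simps)
    qed
    then show ?thesis using key[OF w] key0 by simp
  qed
  then show ?thesis by (auto simp: same_weighted_char_def)
qed

text \<open>Starting from the weight 1, the constraints of a cylinder are absorbed one after
  another; at h = 0 the result compares the measures of the cylinder. Cylinders are stable under
  intersection, since constraint sets can be united.\<close>

lemma measure_eqI_char_functional:
  assumes eq: "\<And>h. (CLINT y|\<mu>. iexp (h \<bullet> y)) = (CLINT y|\<nu>. iexp (h \<bullet> y))"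
  shows "\<mu> = \<nu>"
proof (rule measure_eqI_generator_eq[where \<Omega> = UNIV and A = "\<lambda>_. UNIV"])
  let ?G = "{{x::'a. \<forall>p\<in>F. fst p \<bullet> x \<in> snd p} | F. finite F \<and> (\<forall>p\<in>F. snd p \<in> sets borel)}"
  interpret \<mu>: prob_space \<mu> by (rule \<mu>)
  interpret \<nu>: prob_space \<nu> by (rule \<nu>)
  note [measurable_cong] = \<mu>(2) \<nu>(2)
  have i: "integrable M (\<lambda>y. iexp (h \<bullet> y))" if M: "M = \<mu> \<or> M = \<nu>" for M h
  proof -
    have "integrable \<mu> (\<lambda>y. iexp (h \<bullet> y))" by (rule \<mu>.integrable_const_bound[of _ 1]) auto
    moreover have "integrable \<nu> (\<lambda>y. iexp (h \<bullet> y))" by (rule \<nu>.integrable_const_bound[of _ 1]) auto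
    ultimately show ?thesis using M by auto
  qed
  have cs: "(\<integral>x. cos (h \<bullet> x) \<partial>M) = Re (CLINT y|M. iexp (h \<bullet> y))" 
     "(\<integral>x. sin (h \<bullet> x) \<partial>M) = Im (CLINT y|M. iexp (h \<bullet> y))" if M: "M = \<mu> \<or> M = \<nu>" for M h
    using integral_Re[OF i[OF M, of h]] integral_Im[OF i[OF M, of h]] by (simp_all add: Re_exp Im_exp)
  have base: "same_weighted_char \<mu> \<nu> (\<lambda>x. 1)"
    by (simp add: same_weighted_char_def cs eq)
  have cyl: "same_weighted_char \<mu> \<nu> (\<lambda>x. indicator {x. \<forall>p\<in>F. fst p \<bullet> x \<in> snd p} x) \<and>
      {x. \<forall>p\<in>F. fst p \<bullet> x \<in> snd p} \<in> sets borel"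
    if "finite F" "\<forall>p\<in>F. snd p \<in> sets borel" for F :: "('a \<times> real set) set"
    using that
  proof (induction F rule: finite_induct)
    case empty
    then show ?case using base by simp
  next
    case (insert q F)
    have IH: "same_weighted_char \<mu> \<nu> (\<lambda>x. indicator {x. \<forall>p\<in>F. fst p \<bullet> x \<in> snd p} x)"
      and [measurable]: "{x. \<forall>p\<in>F. fst p \<bullet> x \<in> snd p} \<in> sets borel" "snd q \<in> sets borel" using insert by auto
    have m: "(\<lambda>x. indicator {x. \<forall>p\<in>F. fst p \<bullet> x \<in> snd p} x :: real) \<in> borel_measurable borel"
      by (intro borel_measurable_indicator) fact
    have *: "{x. \<forall>p\<in>insert q F. fst p \<bullet> x \<in> snd p} = {x. \<forall>p\<in>F. fst p \<bullet> x \<in> snd p} \<inter> {x \<in> space borel. fst q \<bullet> x \<in> snd q}"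
      by auto
    have "{x. \<forall>p\<in>insert q F. fst p \<bullet> x \<in> snd p} \<in> sets borel"
      unfolding * by measurable
    moreover have "same_weighted_char \<mu> \<nu> (\<lambda>x. indicator {x. \<forall>p\<in>F. fst p \<bullet> x \<in> snd p} x * indicator (snd q) (fst q \<bullet> x))"
      by (rule same_weighted_char_mult_indicator[where b = 1, OF m _ _ IH])
        (auto simp: m intro: indicator_le_1)
    moreover have "(\<lambda>x. indicator {x. \<forall>p\<in>F. fst p \<bullet> x \<in> snd p} x * indicator (snd q) (fst q \<bullet> x) :: real) =
      (\<lambda>x. indicator {x. \<forall>p\<in>insert q F. fst p \<bullet> x \<in> snd p} x)"
      by (auto simp: indicator_def fun_eq_iff)
    ultimately show ?case by simp
  qed
  show "Int_stable ?G"
  proof (rule Int_stableI)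
    fix a b assume "a \<in> ?G" "b \<in> ?G"
    then obtain F1 F2 where "finite F1" "\<forall>p\<in>F1. snd p \<in> sets borel" "a = {x. \<forall>p\<in>F1. fst p \<bullet> x \<in> snd p}"
      "finite F2" "\<forall>p\<in>F2. snd p \<in> sets borel" "b = {x. \<forall>p\<in>F2. fst p \<bullet> x \<in> snd p}" by auto
    then have "a \<inter> b = {x. \<forall>p\<in>F1 \<union> F2. fst p \<bullet> x \<in> snd p} \<and> finite (F1 \<union> F2) \<and> (\<forall>p\<in>F1 \<union> F2. snd p \<in> sets borel)"
      by blast
    then show "a \<inter> b \<in> ?G" by (intro CollectI) (rule exI)
  qed
  show "?G \<subseteq> Pow UNIV" by simp
  show "emeasure \<mu> X = emeasure \<nu> X" if "X \<in> ?G" for X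
  proof -
    from that obtain F where F: "finite F" "\<forall>p\<in>F. snd p \<in> sets borel" "X = {x. \<forall>p\<in>F. fst p \<bullet> x \<in> snd p}" by auto
    have X: "same_weighted_char \<mu> \<nu> (indicator X)" "X \<in> sets borel" using cyl[OF F(1,2)] F(3) by auto
    then have "measure \<mu> X = measure \<nu> X"
      using \<mu> \<nu> unfolding same_weighted_char_def by (auto dest!: spec[of _ 0] simp: sets_eq_imp_space_eq[OF \<mu>(2)] sets_eq_imp_space_eq[OF \<nu>(2)])
    then show ?thesis by (simp add: \<mu>.emeasure_eq_measure \<nu>.emeasure_eq_measure)
  qed
  show "sets \<mu> = sigma_sets UNIV ?G" "sets \<nu> = sigma_sets UNIV ?G"
    using \<mu>(2) \<nu>(2) sigma_sets_inner_cylinders by auto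
  show "range (\<lambda>_. UNIV) \<subseteq> ?G" by (auto intro!: exI[of _ "{}"])
qed (simp_all add: finite_measure.emeasure_finite[OF prob_space.finite_measure[OF \<mu>(1)]])

end

section \<open>Existence of Gaussian measures\<close>

definition pos_op :: "('a::real_inner \<Rightarrow> 'a) \<Rightarrow> bool" where
  "pos_op Q \<longleftrightarrow> bounded_linear Q \<and> (\<forall>x y. Q x \<bullet> y = x \<bullet> Q y) \<and> (\<forall>x. 0 \<le> Q x \<bullet> x)"

definition orthonormal :: "'a::real_inner set \<Rightarrow> bool" where
  "orthonormal F \<longleftrightarrow> finite F \<and> (\<forall>e\<in>F. norm e = 1) \<and> (\<forall>e\<in>F. \<forall>e'\<in>F. e \<noteq> e' \<longrightarrow> e \<bullet> e' = 0)"

text \<open>A trace bound without reference to a basis; it passes to every smaller quadratic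
  form.\<close>

definition trace_le :: "('a::real_inner \<Rightarrow> 'a) \<Rightarrow> real \<Rightarrow> bool" where
  "trace_le Q \<tau> \<longleftrightarrow> (\<forall>F. orthonormal F \<longrightarrow> (\<Sum>e\<in>F. Q e \<bullet> e) \<le> \<tau>)"

lemma pos_op_Cauchy_Schwarz:
  assumes "pos_op Q"
  shows "(Q x \<bullet> y)\<^sup>2 \<le> (Q x \<bullet> x) * (Q y \<bullet> y)"
proof -
  from assms interpret Q: bounded_linear Q by (simp add: pos_op_def)
  have sym: "Q x \<bullet> y = x \<bullet> Q y" and nn: "0 \<le> Q x \<bullet> x" for x y using assms by (auto simp: pos_op_def)
  have sym': "Q y \<bullet> x = Q x \<bullet> y" by (metis sym inner_commute)
  have q: "0 \<le> (Q x \<bullet> x) + 2 * t * (Q x \<bullet> y) + t\<^sup>2 * (Q y \<bullet> y)" for t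
  proof -
    have "0 \<le> Q (x + t *\<^sub>R y) \<bullet> (x + t *\<^sub>R y)" by (rule nn)
    also have "\<dots> = (Q x \<bullet> x) + 2 * t * (Q x \<bullet> y) + t\<^sup>2 * (Q y \<bullet> y)"
      using sym' by (simp add: Q.add Q.scaleR inner_add_left inner_add_right power2_eq_square algebra_simps)
    finally show ?thesis .
  qed
  show ?thesis
  proof (cases "Q y \<bullet> y = 0")
    case True
    have "Q x \<bullet> y = 0"
    proof (rule ccontr)
      assume ne: "Q x \<bullet> y \<noteq> 0"
      \<comment> \<open>For Q y . y = 0 the expression in \<open>q\<close> is affine in t, and this
        t gives it the value -1.\<close>
      show False using q[of "- (Q x \<bullet> x + 1) / (2 * (Q x \<bullet> y))"] ne True by (simp add: field_simps)
    qed
    then show ?thesis using True by simp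
  next
    case False
    then have "Q y \<bullet> y > 0" using nn[of y] by simp
    then show ?thesis using q[of "- (Q x \<bullet> y) / (Q y \<bullet> y)"]
      by (simp add: field_simps power2_eq_square)
  qed
qed

text \<open>Gram-Schmidt: a finite orthonormal basis of the span of B computes the norms of all
  members of B. This is how norms of finitely many vectors are compared with
  \<open>trace_le\<close>.\<close>

lemma orthonormal_parseval:
  fixes B :: "'a::real_inner set"
  assumes "finite B"
  shows "\<exists>F. orthonormal F \<and> (\<forall>b\<in>B. (norm b)\<^sup>2 = (\<Sum>e\<in>F. (b \<bullet> e)\<^sup>2))"
proof -
  obtain C where C: "finite C" "span C = span B" "pairwise orthogonal C"
    using basis_orthogonal[OF assms] by blast
  define F where "F = (\<lambda>c. c /\<^sub>R norm c) ` (C - {0})"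
  have F: "orthonormal F"
    using C by (auto simp: orthonormal_def F_def pairwise_def orthogonal_def)
  have CF: "C \<subseteq> span F"
  proof
    fix c assume "c \<in> C"
    show "c \<in> span F"
    proof (cases "c = 0")
      case False
      then have "c = norm c *\<^sub>R (c /\<^sub>R norm c)" by simp
      also have "\<dots> \<in> span F"
        using \<open>c \<in> C\<close> False unfolding F_def by (intro span_scale span_base) auto
      finally show ?thesis .
    qed (simp add: span_zero)
  qed
  have "b = (\<Sum>e\<in>F. (b \<bullet> e) *\<^sub>R e)" if "b \<in> span F" for b
    using that
  proof (induction rule: span_induct_alt)
    case base
    then show ?case by simp
  next
    case (step c x y)
    have "(\<Sum>e\<in>F. (x \<bullet> e) *\<^sub>R e) = (\<Sum>e\<in>F. if e = x then x else 0)"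
      using F step(1) by (intro sum.cong refl) (auto simp: orthonormal_def dot_square_norm)
    also have "\<dots> = x" using F step(1) by (simp add: orthonormal_def sum.delta)
    finally have "x = (\<Sum>e\<in>F. (x \<bullet> e) *\<^sub>R e)" by simp
    then show ?case using step(2)
      by (simp add: inner_add_left scaleR_add_left sum.distrib scaleR_sum_right[symmetric] flip: scaleR_scaleR)
  qed
  moreover have "b \<in> span F" if "b \<in> B" for b
    using that CF C(2) by (metis span_base span_mono span_span subsetD)
  moreover have "(norm b)\<^sup>2 = (\<Sum>e\<in>F. (b \<bullet> e)\<^sup>2)" if "b = (\<Sum>e\<in>F. (b \<bullet> e) *\<^sub>R e)" for b
  proof -
    have "(norm b)\<^sup>2 = b \<bullet> (\<Sum>e\<in>F. (b \<bullet> e) *\<^sub>R e)" using that by (simp add: power2_norm_eq_inner)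
    then show ?thesis by (simp add: inner_sum_right power2_eq_square)
  qed
  ultimately show ?thesis using F by blast
qed

text \<open>
  Cholesky factorisation along a sequence \<open>d\<close>: each step subtracts the rank-one form that makes
  \<open>d n\<close> isotropic. For dense \<open>d\<close> this exhausts \<open>Q\<close>, without any spectral theorem.
\<close>

definition chol_vec :: "('a::real_inner \<Rightarrow> 'a) \<Rightarrow> 'a \<Rightarrow> 'a" where
  "chol_vec R d = (if R d \<bullet> d = 0 then 0 else R d /\<^sub>R sqrt (R d \<bullet> d))"

primrec chol_op :: "('a::real_inner \<Rightarrow> 'a) \<Rightarrow> (nat \<Rightarrow> 'a) \<Rightarrow> nat \<Rightarrow> 'a \<Rightarrow> 'a" where
  "chol_op Q d 0 = Q"
| "chol_op Q d (Suc n) = (\<lambda>x. chol_op Q d n x - (chol_vec (chol_op Q d n) (d n) \<bullet> x) *\<^sub>R chol_vec (chol_op Q d n) (d n))"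

text \<open>The inequality keeps the form of R nonnegative after the rank-one subtraction; the
  equation makes the remainder vanish at d.\<close>

lemma chol_vec_sq:
  assumes "pos_op R"
  shows "(chol_vec R d \<bullet> x)\<^sup>2 \<le> R x \<bullet> x" "(chol_vec R d \<bullet> d)\<^sup>2 = R d \<bullet> d"
proof -
  have nn: "0 \<le> R x \<bullet> x" for x using assms by (auto simp: pos_op_def)
  have "(R d \<bullet> x)\<^sup>2 / (R d \<bullet> d) \<le> R x \<bullet> x" if "R d \<bullet> d \<noteq> 0"
    using pos_op_Cauchy_Schwarz[OF assms, of d x] nn[of d] that by (simp add: divide_le_eq mult.commute)
  then show "(chol_vec R d \<bullet> x)\<^sup>2 \<le> R x \<bullet> x"
    using nn by (simp add: chol_vec_def power_mult_distrib power_divide divide_inverse power_inverse mult.commute)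
  show "(chol_vec R d \<bullet> d)\<^sup>2 = R d \<bullet> d"
    using nn[of d] by (simp add: chol_vec_def power2_eq_square field_simps)
qed

lemma pos_op_chol_op:
  assumes "pos_op Q"
  shows "pos_op (chol_op Q d n)"
proof (induction n)
  case 0
  then show ?case using assms by simp
next
  case (Suc n)
  let ?R = "chol_op Q d n" and ?b = "chol_vec (chol_op Q d n) (d n)"
  from Suc have bl: "bounded_linear ?R" by (simp add: pos_op_def)
  have "bounded_linear (\<lambda>x. ?R x - (?b \<bullet> x) *\<^sub>R ?b)"
    by (intro bounded_linear_sub bl bounded_linear_compose[OF bounded_linear_scaleR_left bounded_linear_inner_right])
  moreover have "(?R x - (?b \<bullet> x) *\<^sub>R ?b) \<bullet> y = x \<bullet> (?R y - (?b \<bullet> y) *\<^sub>R ?b)" for x y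
    using Suc by (simp add: pos_op_def inner_diff_left inner_diff_right inner_commute)
  moreover have "0 \<le> (?R x - (?b \<bullet> x) *\<^sub>R ?b) \<bullet> x" for x
    using chol_vec_sq(1)[OF Suc, of "d n" x] by (simp add: inner_diff_left power2_eq_square)
  ultimately show ?case by (simp add: pos_op_def)
qed

lemma chol_op_telescope:
  "chol_op Q d n x \<bullet> x = Q x \<bullet> x - (\<Sum>l<n. (chol_vec (chol_op Q d l) (d l) \<bullet> x)\<^sup>2)"
  by (induction n) (auto simp: inner_diff_left power2_eq_square algebra_simps)

text \<open>The forms of the remainders decrease, vanish at the points of the sequence already
  treated, and are bounded by K |x|^2 uniformly in n; density then forces them to 0 at every x. For
  the norms, finitely many b l are expanded in one orthonormal set and the sums are
  exchanged.\<close>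

lemma rank_one_decomposition:
  fixes Q :: "'a::{real_inner,second_countable_topology} \<Rightarrow> 'a"
  assumes Q: "pos_op Q" and tr: "trace_le Q \<tau>"
  shows "\<exists>b :: nat \<Rightarrow> 'a. (\<forall>x. (\<lambda>n. (b n \<bullet> x)\<^sup>2) sums (Q x \<bullet> x)) \<and> (\<forall>n. (\<Sum>l<n. (norm (b l))\<^sup>2) \<le> \<tau>)"
proof -
  obtain D :: "'a set" where D: "countable D" "\<And>X. open X \<Longrightarrow> X \<noteq> {} \<Longrightarrow> \<exists>d\<in>D. d \<in> X"
    using countable_dense_exists by blast
  have Dne: "D \<noteq> {}" using D(2)[of UNIV] by auto
  define d where "d = from_nat_into D"
  define R where "R = chol_op Q d"
  define b where "b n = chol_vec (R n) (d n)" for n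
  have Rpos: "pos_op (R n)" for n unfolding R_def by (rule pos_op_chol_op[OF Q])
  have Rnn: "0 \<le> R n x \<bullet> x" for n x using Rpos unfolding pos_op_def by blast
  have RQ: "R n x \<bullet> x = Q x \<bullet> x - (\<Sum>l<n. (b l \<bullet> x)\<^sup>2)" for n x
    unfolding R_def b_def by (rule chol_op_telescope)
  have dec: "R m x \<bullet> x \<le> R n x \<bullet> x" if "n \<le> m" for n m x
    unfolding RQ using sum_mono2[of "{..<m}" "{..<n}" "\<lambda>l. (b l \<bullet> x)\<^sup>2"] that by auto
  have kill: "R m (d n) \<bullet> d n = 0" if "n < m" for n m
  proof -
    have "R (Suc n) (d n) \<bullet> d n = 0"
      using chol_vec_sq(2)[OF Rpos[of n], of "d n"]
      by (simp add: R_def inner_diff_left power2_eq_square)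
    then show ?thesis using dec[of "Suc n" m "d n"] Rnn[of m "d n"] that by simp
  qed
  from Q have "bounded_linear Q" by (simp add: pos_op_def)
  then obtain K where K: "K > 0" "\<And>x. norm (Q x) \<le> norm x * K" using bounded_linear.pos_bounded by blast
  have Rb: "R n x \<bullet> x \<le> K * (norm x)\<^sup>2" for n x
  proof -
    have "R n x \<bullet> x \<le> Q x \<bullet> x" using dec[of 0 n x] by (simp add: R_def)
    also have "\<dots> \<le> norm (Q x) * norm x" by (rule norm_cauchy_schwarz)
    also have "\<dots> \<le> (norm x * K) * norm x" by (intro mult_right_mono K) auto
    finally show ?thesis by (simp add: power2_eq_square mult_ac)
  qed
  have lim: "(\<lambda>n. R n x \<bullet> x) \<longlonglongrightarrow> 0" for x
  proof (rule LIMSEQ_I)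
    fix e :: real assume e: "e > 0"
    \<comment> \<open>With this radius 2 K r^2 = e / 2.\<close>
    define r where "r = sqrt (e / (4 * K))"
    have r: "r > 0" using e K by (simp add: r_def)
    obtain y where y: "y \<in> D" "y \<in> ball x r" using D(2)[of "ball x r"] r by auto
    then obtain k where k: "y = d k" unfolding d_def
      using D(1) from_nat_into_surj by metis
    have "norm (R n x \<bullet> x - 0) < e" if "n \<ge> Suc k" for n
    proof -
      from Rpos interpret R: bounded_linear "R n" by (simp add: pos_op_def)
      \<comment> \<open>Nonnegativity at y - (x - y) gives R x . x <= 2 (R y . y) + 2 (R (x - y) .
        (x - y)), and the first term vanishes by \<open>kill\<close>.\<close>
      have "0 \<le> R n (y - (x - y)) \<bullet> (y - (x - y))" by (rule Rnn)
      then have "R n x \<bullet> x \<le> 2 * (R n y \<bullet> y) + 2 * (R n (x - y) \<bullet> (x - y))"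
        by (simp add: R.diff inner_diff_left inner_diff_right)
      also have "\<dots> \<le> 0 + 2 * (K * (norm (x - y))\<^sup>2)"
        using kill[of k n] that k Rb[of n "x - y"] by simp
      also have "\<dots> < 2 * (K * r\<^sup>2)"
        using y(2) K by (auto simp: dist_norm intro!: power_strict_mono)
      also have "\<dots> = e / 2" using K e by (simp add: r_def)
      also have "\<dots> < e" using e by simp
      finally show ?thesis using Rnn[of n x] by simp
    qed
    then show "\<exists>n0. \<forall>n\<ge>n0. norm (R n x \<bullet> x - 0) < e" by blast
  qed
  have "(\<lambda>n. (b n \<bullet> x)\<^sup>2) sums (Q x \<bullet> x)" for x
  proof -
    have "(\<lambda>n. Q x \<bullet> x - R n x \<bullet> x) \<longlonglongrightarrow> Q x \<bullet> x - 0" by (intro tendsto_intros lim)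
    then show ?thesis unfolding sums_def RQ by simp
  qed
  moreover have "(\<Sum>l<n. (norm (b l))\<^sup>2) \<le> \<tau>" for n
  proof -
    obtain F where F: "orthonormal F" "\<And>l. l < n \<Longrightarrow> (norm (b l))\<^sup>2 = (\<Sum>e\<in>F. (b l \<bullet> e)\<^sup>2)"
      using orthonormal_parseval[of "b ` {..<n}"] by auto
    have "(\<Sum>l<n. (norm (b l))\<^sup>2) = (\<Sum>l<n. \<Sum>e\<in>F. (b l \<bullet> e)\<^sup>2)" using F by simp
    also have "\<dots> = (\<Sum>e\<in>F. \<Sum>l<n. (b l \<bullet> e)\<^sup>2)" by (rule sum.swap)
    also have "\<dots> \<le> (\<Sum>e\<in>F. Q e \<bullet> e)"
    proof (rule sum_mono)
      fix e show "(\<Sum>l<n. (b l \<bullet> e)\<^sup>2) \<le> Q e \<bullet> e" using RQ[of n e] Rnn[of n e] by simp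
    qed
    also have "\<dots> \<le> \<tau>" using tr F by (simp add: trace_le_def)
    finally show ?thesis .
  qed
  ultimately show ?thesis by blast
qed

section \<open>Random series with independent standard normal coefficients\<close>

definition normal_seq :: "(nat \<Rightarrow> real) measure" where
  "normal_seq = PiM UNIV (\<lambda>_. std_normal_distribution)"

lemma prob_space_std_normal [simp]: "prob_space std_normal_distribution"
  by (rule prob_space_normal_density) simp

lemma prob_space_normal_seq: "prob_space normal_seq"
  unfolding normal_seq_def by (rule prob_space_PiM) simp

lemma sets_normal_seq [measurable_cong]: "sets normal_seq = sets (PiM UNIV (\<lambda>_. borel))"
  unfolding normal_seq_def by (intro sets_PiM_cong) auto

lemma measurable_normal_seq_component [measurable]: "(\<lambda>\<omega>. \<omega> n) \<in> borel_measurable normal_seq"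
  by measurable

lemma distr_normal_seq: "distr normal_seq borel (\<lambda>\<omega>. \<omega> n) = std_normal_distribution"
proof -
  have "distr normal_seq std_normal_distribution (\<lambda>\<omega>. \<omega> n) = std_normal_distribution"
    unfolding normal_seq_def by (rule distr_PiM_component) auto
  moreover have "distr normal_seq std_normal_distribution (\<lambda>\<omega>. \<omega> n) = distr normal_seq borel (\<lambda>\<omega>. \<omega> n)"
    by (rule distr_cong) auto
  ultimately show ?thesis by simp
qed

lemma indep_vars_normal_seq: "prob_space.indep_vars normal_seq (\<lambda>_. borel) (\<lambda>n \<omega>. \<omega> n) UNIV"
proof -
  interpret prob_space normal_seq by (rule prob_space_normal_seq)
  have "distr normal_seq (PiM UNIV (\<lambda>_. borel)) (\<lambda>x. x) = distr normal_seq normal_seq (\<lambda>x. x)"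
    by (rule distr_cong) (auto simp: sets_normal_seq)
  also have "\<dots> = normal_seq" by (rule distr_id2) simp
  finally show ?thesis
    by (subst indep_vars_iff_distr_eq_PiM) (simp_all add: distr_normal_seq restrict_UNIV normal_seq_def[symmetric])
qed

lemma normal_seq_moments:
  shows "integrable normal_seq (\<lambda>\<omega>. \<omega> n * \<omega> m)"
    and "(\<integral>\<omega>. \<omega> n * \<omega> m \<partial>normal_seq) = (if n = m then 1 else 0)"
proof -
  interpret prob_space normal_seq by (rule prob_space_normal_seq)
  have i1: "integrable normal_seq (\<lambda>\<omega>. (\<omega> n) ^ k)" for n k
  proof -
    have "integrable std_normal_distribution (\<lambda>x. x ^ k)"
      using integrable_std_normal_moment[of k] by (subst integrable_density) auto
    then show ?thesis
      using integrable_distr_eq[of "\<lambda>\<omega>. \<omega> n" normal_seq borel "\<lambda>x. x ^ k"] by (simp add: distr_normal_seq)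
  qed
  have e1: "(\<integral>\<omega>. (\<omega> n) ^ k \<partial>normal_seq) = (\<integral>x. x ^ k \<partial>std_normal_distribution)" for n k
    using integral_distr[of "\<lambda>\<omega>. \<omega> n" normal_seq borel "\<lambda>x. x ^ k"] by (simp add: distr_normal_seq)
  have m1: "(\<integral>\<omega>. \<omega> n \<partial>normal_seq) = 0" for n
    using e1[of n 1] integral_std_normal_distribution_moment_odd[of 1] by simp
  have m2: "(\<integral>\<omega>. (\<omega> n)^2 \<partial>normal_seq) = 1" for n
    using e1[of n 2] std_normal_distribution_even_moments(1)[of 1] by (simp add: fact_2)
  show "integrable normal_seq (\<lambda>\<omega>. \<omega> n * \<omega> m)"
    and "(\<integral>\<omega>. \<omega> n * \<omega> m \<partial>normal_seq) = (if n = m then 1 else 0)"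
  proof (atomize (full), cases "n = m")
    case True
    then show "integrable normal_seq (\<lambda>\<omega>. \<omega> n * \<omega> m) \<and> (\<integral>\<omega>. \<omega> n * \<omega> m \<partial>normal_seq) = (if n = m then 1 else 0)"
      using i1[of n 2] m2[of n] by (simp add: power2_eq_square)
  next
    case False
    have "indep_vars (\<lambda>_. borel) (\<lambda>n \<omega>. \<omega> n) {n, m}"
      by (rule indep_vars_subset[OF indep_vars_normal_seq]) auto
    then show "integrable normal_seq (\<lambda>\<omega>. \<omega> n * \<omega> m) \<and> (\<integral>\<omega>. \<omega> n * \<omega> m \<partial>normal_seq) = (if n = m then 1 else 0)"
      using indep_vars_lebesgue_integral[of "{n,m}" "\<lambda>n \<omega>. \<omega> n"] indep_vars_integrable[of "{n,m}" "\<lambda>n \<omega>. \<omega> n"]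
        i1[of n 1] i1[of m 1] m1 False by auto
  qed
qed

text \<open>The coordinates are orthonormal in L^2, so mixed terms drop out. The nonnegative
  integral is the form in which Fatou's lemma can be applied.\<close>

lemma normal_seq_sum_sq:
  fixes b :: "nat \<Rightarrow> 'a::{real_inner,second_countable_topology}"
  assumes "finite I"
  shows "(\<integral>\<^sup>+\<omega>. ennreal ((norm (\<Sum>n\<in>I. \<omega> n *\<^sub>R b n))\<^sup>2) \<partial>normal_seq) = ennreal (\<Sum>n\<in>I. (norm (b n))\<^sup>2)"
proof -
  have *: "(norm (\<Sum>n\<in>I. \<omega> n *\<^sub>R b n))\<^sup>2 = (\<Sum>n\<in>I. \<Sum>m\<in>I. (\<omega> n * \<omega> m) * (b n \<bullet> b m))" for \<omega>
    by (simp only: power2_norm_eq_inner inner_sum_left)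
      (simp only: inner_sum_right inner_scaleR_left inner_scaleR_right mult_ac)
  have i: "integrable normal_seq (\<lambda>\<omega>. (norm (\<Sum>n\<in>I. \<omega> n *\<^sub>R b n))\<^sup>2)"
    unfolding * by (intro Bochner_Integration.integrable_sum integrable_mult_left normal_seq_moments)
  have "(\<integral>\<omega>. (norm (\<Sum>n\<in>I. \<omega> n *\<^sub>R b n))\<^sup>2 \<partial>normal_seq) = (\<Sum>n\<in>I. \<Sum>m\<in>I. (if n = m then 1 else 0) * (b n \<bullet> b m))"
    unfolding * by (simp add: Bochner_Integration.integral_sum normal_seq_moments)
  also have "\<dots> = (\<Sum>n\<in>I. (norm (b n))\<^sup>2)"
    using assms by (intro sum.cong refl) (simp add: if_distrib[of "\<lambda>c. c * _"] power2_norm_eq_inner sum.delta' cong: if_cong)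
  finally show ?thesis using nn_integral_eq_integral[OF i] by simp
qed

lemma normal_seq_sum_char:
  fixes b :: "nat \<Rightarrow> 'a::{real_inner,second_countable_topology}"
  shows "(CLINT \<omega>|normal_seq. iexp (h \<bullet> (\<Sum>n<N. \<omega> n *\<^sub>R b n))) = complex_of_real (exp (- (\<Sum>n<N. (b n \<bullet> h)\<^sup>2) / 2))"
proof -
  interpret prob_space normal_seq by (rule prob_space_normal_seq)
  have 1: "iexp (h \<bullet> (\<Sum>n<N. \<omega> n *\<^sub>R b n)) = (\<Prod>n<N. iexp ((b n \<bullet> h) * \<omega> n))" for \<omega>
    by (simp add: inner_sum_right sum_distrib_left exp_sum inner_commute mult_ac)
  have ind: "indep_vars (\<lambda>_. borel) (\<lambda>n \<omega>. iexp ((b n \<bullet> h) * \<omega> n)) {..<N}"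
    by (rule indep_vars_compose2[OF indep_vars_subset[OF indep_vars_normal_seq]]) auto
  have "(CLINT \<omega>|normal_seq. (\<Prod>n<N. iexp ((b n \<bullet> h) * \<omega> n))) = (\<Prod>n<N. CLINT \<omega>|normal_seq. iexp ((b n \<bullet> h) * \<omega> n))"
    by (rule indep_vars_lebesgue_integral[OF _ ind]) (auto intro!: integrable_const_bound[of _ 1])
  also have "\<dots> = (\<Prod>n<N. char std_normal_distribution (b n \<bullet> h))"
  proof (intro prod.cong refl)
    fix n
    show "(CLINT \<omega>|normal_seq. iexp ((b n \<bullet> h) * \<omega> n)) = char std_normal_distribution (b n \<bullet> h)"
      unfolding char_def distr_normal_seq[symmetric, of n] by (subst integral_distr) auto
  qed
  also have "\<dots> = complex_of_real (exp (- (\<Sum>n<N. (b n \<bullet> h)\<^sup>2) / 2))"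
    by (simp add: char_std_normal_distribution exp_sum[symmetric] sum_negf[symmetric] sum_divide_distrib flip: of_real_prod)
  finally show ?thesis unfolding 1 .
qed

text \<open>The measure is the law of the random series with terms \<omega> n b n. The trace bound
  makes it Cauchy in L^2, the sparse subsequence \<open>K\<close> converges almost surely, and
  dominated convergence identifies the characteristic functional. The second moment, bounded by
  Fatou's lemma, later gives continuity in time.\<close>

theorem centered_gaussian_exists:
  fixes Q :: "'a::{real_inner,banach,second_countable_topology} \<Rightarrow> 'a"
  assumes Q: "pos_op Q" and tr: "trace_le Q \<tau>"
  shows "\<exists>\<mu>. is_centered_gaussian Q \<mu> \<and> (\<integral>\<^sup>+y. ennreal ((norm y)\<^sup>2) \<partial>\<mu>) \<le> ennreal \<tau>"
proof -
  obtain b :: "nat \<Rightarrow> 'a" where b: "\<And>x. (\<lambda>n. (b n \<bullet> x)\<^sup>2) sums (Q x \<bullet> x)"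
      "\<And>n. (\<Sum>l<n. (norm (b l))\<^sup>2) \<le> \<tau>"
    using rank_one_decomposition[OF assms] by blast
  interpret prob_space normal_seq by (rule prob_space_normal_seq)
  define S where "S N \<omega> = (\<Sum>n<N. \<omega> n *\<^sub>R b n)" for N and \<omega> :: "nat \<Rightarrow> real"
  have Sm[measurable]: "S N \<in> borel_measurable normal_seq" for N unfolding S_def by measurable
  define \<sigma> where "\<sigma> N = (\<Sum>n<N. (norm (b n))\<^sup>2)" for N
  have \<sigma>_mono: "\<sigma> M \<le> \<sigma> N" if "M \<le> N" for M N
    unfolding \<sigma>_def using that by (intro sum_mono2) auto
  have "convergent \<sigma>"
    by (rule Bseq_mono_convergent[OF BseqI'[of _ \<tau>]])
      (use b(2) \<sigma>_mono in \<open>auto simp: \<sigma>_def sum_nonneg\<close>)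
  then have "Cauchy \<sigma>" by (rule convergent_Cauchy)
  then have "\<exists>N. \<forall>M\<ge>N. \<forall>n\<ge>N. dist (\<sigma> M) (\<sigma> n) < (1/4)^k" for k by (auto simp: Cauchy_def)
  then obtain g where g: "\<And>k M n. M \<ge> g k \<Longrightarrow> n \<ge> g k \<Longrightarrow> dist (\<sigma> M) (\<sigma> n) < (1/4)^k" by metis
  \<comment> \<open>Summing \<open>Suc (g i)\<close> makes \<open>K\<close> increasing with K k >= g
    k and K k >= k.\<close>
  define K where "K k = (\<Sum>i\<le>k. Suc (g i))" for k :: nat
  have Kg: "K k \<ge> g k" for k
    using member_le_sum[of k "{..k}" "\<lambda>i. Suc (g i)"] by (simp add: K_def)
  have Kmono: "K k \<le> K (Suc k)" for k by (simp add: K_def)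
  have diff: "(\<integral>\<^sup>+\<omega>. ennreal (norm (S (K (Suc k)) \<omega> - S (K k) \<omega>)) \<partial>normal_seq) \<le> ennreal ((1/2)^k)" for k
  proof -
    have eq: "S (K (Suc k)) \<omega> - S (K k) \<omega> = (\<Sum>n\<in>{K k..<K (Suc k)}. \<omega> n *\<^sub>R b n)" for \<omega>
      unfolding S_def using Kmono[of k]
      by (simp add: lessThan_atLeast0 sum_diff_nat_ivl)
    have "(\<integral>\<^sup>+\<omega>. ennreal ((norm (S (K (Suc k)) \<omega> - S (K k) \<omega>))\<^sup>2) \<partial>normal_seq) = ennreal (\<Sum>n\<in>{K k..<K (Suc k)}. (norm (b n))\<^sup>2)"
      unfolding eq by (rule normal_seq_sum_sq) simp
    also have "(\<Sum>n\<in>{K k..<K (Suc k)}. (norm (b n))\<^sup>2) = \<sigma> (K (Suc k)) - \<sigma> (K k)"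
      unfolding \<sigma>_def using Kmono[of k] by (simp add: lessThan_atLeast0 sum_diff_nat_ivl)
    also have "\<dots> \<le> (1/4)^k"
      using g[of k "K (Suc k)" "K k"] Kg[of k] Kmono[of k] by (auto simp: dist_real_def)
    finally have sq: "(\<integral>\<^sup>+\<omega>. ennreal ((norm (S (K (Suc k)) \<omega> - S (K k) \<omega>))\<^sup>2) \<partial>normal_seq) \<le> ennreal ((1/4)^k)"
      by (simp add: ennreal_leI)
    \<comment> \<open>Weighted arithmetic-geometric mean: it turns the squared L^2 bound (1/4)^k
      into the summable L^1 bound (1/2)^k.\<close>
    have pt: "t \<le> (1/2)^k / 2 + 2^k * t\<^sup>2 / 2" for t :: real
    proof -
      have "0 \<le> (1 - 2^k * t)\<^sup>2" by simp
      then have "2 * 2^k * t \<le> 1 + (2^k)\<^sup>2 * t\<^sup>2" by (simp add: power2_diff power_mult_distrib)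
      then have "(2 * 2^k * t) / (2 * 2^k) \<le> (1 + (2^k)\<^sup>2 * t\<^sup>2) / (2 * 2^k)" by (rule divide_right_mono) simp
      then show ?thesis by (simp add: field_simps power2_eq_square power_divide)
    qed
    have "(\<integral>\<^sup>+\<omega>. ennreal (norm (S (K (Suc k)) \<omega> - S (K k) \<omega>)) \<partial>normal_seq)
      \<le> (\<integral>\<^sup>+\<omega>. ennreal ((1/2)^k / 2) + ennreal (2^k / 2) * ennreal ((norm (S (K (Suc k)) \<omega> - S (K k) \<omega>))\<^sup>2) \<partial>normal_seq)"
      by (intro nn_integral_mono) (simp add: ennreal_mult[symmetric] ennreal_plus[symmetric] ennreal_leI pt del: ennreal_plus)
    also have "\<dots> = ennreal ((1/2)^k / 2) + ennreal (2^k / 2) * (\<integral>\<^sup>+\<omega>. ennreal ((norm (S (K (Suc k)) \<omega> - S (K k) \<omega>))\<^sup>2) \<partial>normal_seq)"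
      by (simp add: nn_integral_add nn_integral_cmult emeasure_space_1)
    also have "\<dots> \<le> ennreal ((1/2)^k / 2) + ennreal (2^k / 2) * ennreal ((1/4)^k)"
      by (intro add_left_mono mult_left_mono sq) auto
    also have "\<dots> = ennreal ((1/2)^k / 2 + 2^k / 2 * (1/4)^k)"
      by (simp add: ennreal_mult[symmetric] ennreal_plus[symmetric] del: ennreal_plus)
    also have "(1/2)^k / 2 + 2^k / 2 * (1/4)^k = ((1/2)^k :: real)"
    proof -
      have "(2::real)^k * (1/4)^k = (1/2)^k" by (simp flip: power_mult_distrib)
      then show ?thesis by simp
    qed
    finally show ?thesis .
  qed
  have "(\<integral>\<^sup>+\<omega>. (\<Sum>k. ennreal (norm (S (K (Suc k)) \<omega> - S (K k) \<omega>))) \<partial>normal_seq) = 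
     (\<Sum>k. \<integral>\<^sup>+\<omega>. ennreal (norm (S (K (Suc k)) \<omega> - S (K k) \<omega>)) \<partial>normal_seq)"
    by (rule nn_integral_suminf) auto
  also have "\<dots> \<le> (\<Sum>k. ennreal ((1/2)^k))" by (intro suminf_le diff) auto
  also have "\<dots> = ennreal (\<Sum>k. (1/2)^k)" by (intro suminf_ennreal2 summable_geometric) auto
  also have "\<dots> < \<infinity>" by simp
  finally have "AE \<omega> in normal_seq. (\<Sum>k. ennreal (norm (S (K (Suc k)) \<omega> - S (K k) \<omega>))) \<noteq> \<infinity>"
    by (intro nn_integral_noteq_infinite) auto
  then have AEconv: "AE \<omega> in normal_seq. convergent (\<lambda>k. S (K k) \<omega>)"
  proof eventually_elim
    case (elim \<omega>)
    have "summable (\<lambda>k. norm (S (K (Suc k)) \<omega> - S (K k) \<omega>))"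
      by (rule summable_suminf_not_top) (use elim in auto)
    then have "summable (\<lambda>k. S (K (Suc k)) \<omega> - S (K k) \<omega>)" by (rule summable_norm_cancel)
    then have "convergent (\<lambda>n. \<Sum>k<n. S (K (Suc k)) \<omega> - S (K k) \<omega>)" by (simp add: summable_iff_convergent)
    then obtain l where "(\<lambda>n. \<Sum>k<n. S (K (Suc k)) \<omega> - S (K k) \<omega>) \<longlonglongrightarrow> l" by (auto simp: convergent_def)
    then have "(\<lambda>n. S (K n) \<omega> - S (K 0) \<omega>) \<longlonglongrightarrow> l"
      using sum_lessThan_telescope[of "\<lambda>k. S (K k) \<omega>"] by simp
    then have "(\<lambda>n. (S (K n) \<omega> - S (K 0) \<omega>) + S (K 0) \<omega>) \<longlonglongrightarrow> l + S (K 0) \<omega>"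
      by (intro tendsto_intros)
    then have "convergent (\<lambda>n. (S (K n) \<omega> - S (K 0) \<omega>) + S (K 0) \<omega>)" by (rule convergentI)
    then show ?case by simp
  qed
  define Y where "Y \<omega> = lim (\<lambda>k. S (K k) \<omega>)" for \<omega>
  have Ym[measurable]: "Y \<in> borel_measurable normal_seq" unfolding Y_def by measurable
  have AElim: "AE \<omega> in normal_seq. (\<lambda>k. S (K k) \<omega>) \<longlonglongrightarrow> Y \<omega>"
    using AEconv by eventually_elim (simp add: Y_def convergent_LIMSEQ_iff)
  define \<mu> where "\<mu> = distr normal_seq borel Y"
  have subK: "filterlim K at_top sequentially"
  proof (rule filterlim_at_top_mono[OF filterlim_ident])
    have "k \<le> K k" for k by (induction k) (auto simp: K_def)
    then show "\<forall>\<^sub>F k in sequentially. k \<le> K k" by simp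
  qed
  have "is_centered_gaussian Q \<mu>"
    unfolding is_centered_gaussian_def
  proof (intro conjI allI)
    show "sets \<mu> = sets borel" by (simp add: \<mu>_def)
    show "prob_space \<mu>" unfolding \<mu>_def by (rule prob_space_distr) simp
    fix h
    have "(\<lambda>k. CLINT \<omega>|normal_seq. iexp (h \<bullet> S (K k) \<omega>)) \<longlonglongrightarrow> (CLINT \<omega>|normal_seq. iexp (h \<bullet> Y \<omega>))"
    proof (rule integral_dominated_convergence[where w = "\<lambda>_. 1"])
      show "AE \<omega> in normal_seq. (\<lambda>k. iexp (h \<bullet> S (K k) \<omega>)) \<longlonglongrightarrow> iexp (h \<bullet> Y \<omega>)"
        using AElim by eventually_elim (intro tendsto_intros)
    qed auto
    moreover have "(\<lambda>k. CLINT \<omega>|normal_seq. iexp (h \<bullet> S (K k) \<omega>)) \<longlonglongrightarrow> complex_of_real (exp (- (Q h \<bullet> h) / 2))"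
    proof -
      have "(\<lambda>N. (\<Sum>n<N. (b n \<bullet> h)\<^sup>2)) \<longlonglongrightarrow> Q h \<bullet> h" using b(1)[of h] by (simp add: sums_def)
      then have "(\<lambda>k. (\<Sum>n<K k. (b n \<bullet> h)\<^sup>2)) \<longlonglongrightarrow> Q h \<bullet> h" using subK by (rule filterlim_compose)
      then show ?thesis unfolding S_def normal_seq_sum_char by (intro tendsto_intros) auto
    qed
    ultimately have "(CLINT \<omega>|normal_seq. iexp (h \<bullet> Y \<omega>)) = complex_of_real (exp (- (Q h \<bullet> h) / 2))"
      by (rule LIMSEQ_unique)
    then show "(CLINT y|\<mu>. iexp (h \<bullet> y)) = complex_of_real (exp (- (Q h \<bullet> h) / 2))"
      unfolding \<mu>_def by (subst integral_distr) auto
  qed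
  moreover have "(\<integral>\<^sup>+y. ennreal ((norm y)\<^sup>2) \<partial>\<mu>) \<le> ennreal \<tau>"
  proof -
    have "(\<integral>\<^sup>+y. ennreal ((norm y)\<^sup>2) \<partial>\<mu>) = (\<integral>\<^sup>+\<omega>. ennreal ((norm (Y \<omega>))\<^sup>2) \<partial>normal_seq)"
      unfolding \<mu>_def by (subst nn_integral_distr) auto
    also have "\<dots> = (\<integral>\<^sup>+\<omega>. liminf (\<lambda>k. ennreal ((norm (S (K k) \<omega>))\<^sup>2)) \<partial>normal_seq)"
    proof (rule nn_integral_cong_AE)
      show "AE \<omega> in normal_seq. ennreal ((norm (Y \<omega>))\<^sup>2) = liminf (\<lambda>k. ennreal ((norm (S (K k) \<omega>))\<^sup>2))"
        using AElim
      proof eventually_elim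
        case (elim \<omega>)
        then have "(\<lambda>k. ennreal ((norm (S (K k) \<omega>))\<^sup>2)) \<longlonglongrightarrow> ennreal ((norm (Y \<omega>))\<^sup>2)"
          by (intro tendsto_intros)
        then show ?case by (intro lim_imp_Liminf[symmetric]) simp_all
      qed
    qed
    also have "\<dots> \<le> liminf (\<lambda>k. \<integral>\<^sup>+\<omega>. ennreal ((norm (S (K k) \<omega>))\<^sup>2) \<partial>normal_seq)"
      by (rule nn_integral_liminf) auto
    also have "\<dots> \<le> ennreal \<tau>"
      unfolding S_def by (subst normal_seq_sum_sq) (auto intro!: Liminf_le always_eventually ennreal_leI b(2))
    finally show ?thesis .
  qed
  ultimately show ?thesis by blast
qed

section \<open>Translates of Gaussian measures\<close>

text \<open>The characteristic functional sees only the quadratic form of the covariance, so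
  comparison on the diagonal is enough.\<close>

lemma centered_gaussian_unique:
  fixes Q :: "'a::{real_inner,second_countable_topology} \<Rightarrow> 'a"
  assumes "is_centered_gaussian Q \<mu>" "is_centered_gaussian Q' \<nu>" "\<And>x. Q x \<bullet> x = Q' x \<bullet> x"
  shows "\<mu> = \<nu>"
  using assms by (intro measure_eqI_char_functional) (auto simp: is_centered_gaussian_def)

lemma centered_gaussian_eqI:
  fixes Q :: "'a::{real_inner,second_countable_topology} \<Rightarrow> 'a"
  assumes "is_centered_gaussian Q \<mu>"
  shows "centered_gaussian Q = \<mu>"
  unfolding centered_gaussian_def using assms centered_gaussian_unique by (intro the_equality) auto

lemma integral_pair_product:
  fixes f :: "'a \<Rightarrow> 'c::{real_normed_field,banach,second_countable_topology}"
  assumes M: "prob_space M" "prob_space N" and f: "integrable M f" and g: "integrable N g"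
  shows "integrable (M \<Otimes>\<^sub>M N) (\<lambda>z. f (fst z) * g (snd z))"
    and "(\<integral>z. f (fst z) * g (snd z) \<partial>(M \<Otimes>\<^sub>M N)) = (\<integral>x. f x \<partial>M) * (\<integral>y. g y \<partial>N)"
proof -
  interpret M: prob_space M by fact
  interpret N: prob_space N by fact
  interpret pair_sigma_finite M N ..
  have [measurable]: "f \<in> borel_measurable M" "g \<in> borel_measurable N" using f g by auto
  show i: "integrable (M \<Otimes>\<^sub>M N) (\<lambda>z. f (fst z) * g (snd z))"
  proof (rule Fubini_integrable)
    show "integrable M (\<lambda>x. \<integral>y. norm (f (fst (x, y)) * g (snd (x, y))) \<partial>N)"
      using f by (simp add: norm_mult)
    show "AE x in M. integrable N (\<lambda>y. f (fst (x, y)) * g (snd (x, y)))"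
      using g by simp
  qed measurable
  show "(\<integral>z. f (fst z) * g (snd z) \<partial>(M \<Otimes>\<^sub>M N)) = (\<integral>x. f x \<partial>M) * (\<integral>y. g y \<partial>N)"
    using integral_fst'[OF i] f g by simp
qed

lemma Cauchy_Schwarz_integral:
  fixes f g :: "'a \<Rightarrow> real"
  assumes [measurable]: "f \<in> borel_measurable M" "g \<in> borel_measurable M"
    and f: "integrable M (\<lambda>x. (f x)\<^sup>2)" and g: "integrable M (\<lambda>x. (g x)\<^sup>2)"
  shows "integrable M (\<lambda>x. f x * g x)"
    and "(\<integral>x. f x * g x \<partial>M)\<^sup>2 \<le> (\<integral>x. (f x)\<^sup>2 \<partial>M) * (\<integral>x. (g x)\<^sup>2 \<partial>M)"
proof -
  show fg: "integrable M (\<lambda>x. f x * g x)"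
  proof (rule Bochner_Integration.integrable_bound)
    show "integrable M (\<lambda>x. (f x)\<^sup>2 + (g x)\<^sup>2)" using f g by simp
    have "\<bar>a * b\<bar> \<le> a\<^sup>2 + b\<^sup>2" for a b :: real
    proof -
      have "2 * (\<bar>a\<bar> * \<bar>b\<bar>) \<le> a\<^sup>2 + b\<^sup>2" using sum_squares_bound[of "\<bar>a\<bar>" "\<bar>b\<bar>"] by simp
      then show ?thesis using mult_nonneg_nonneg[of "\<bar>a\<bar>" "\<bar>b\<bar>"] unfolding abs_mult by linarith
    qed
    then show "AE x in M. norm (f x * g x) \<le> norm ((f x)\<^sup>2 + (g x)\<^sup>2)" by simp
  qed measurable
  let ?A = "\<integral>x. (f x)\<^sup>2 \<partial>M" and ?B = "\<integral>x. f x * g x \<partial>M" and ?C = "\<integral>x. (g x)\<^sup>2 \<partial>M"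
  have q: "0 \<le> ?A + 2 * t * ?B + t\<^sup>2 * ?C" for t
  proof -
    have "0 \<le> (\<integral>x. (f x + t * g x)\<^sup>2 \<partial>M)" by simp
    also have "\<dots> = (\<integral>x. (f x)\<^sup>2 + (2 * t) * (f x * g x) + t\<^sup>2 * (g x)\<^sup>2 \<partial>M)"
      by (intro Bochner_Integration.integral_cong refl) (simp add: power2_eq_square algebra_simps)
    also have "\<dots> = ?A + 2 * t * ?B + t\<^sup>2 * ?C"
      using f g fg by (simp add: mult.assoc)
    finally show ?thesis .
  qed
  have C0: "?C \<ge> 0" by simp
  show "?B\<^sup>2 \<le> ?A * ?C"
  proof (cases "?C = 0")
    case True
    have "?B = 0"
    proof (rule ccontr)
      assume ne: "?B \<noteq> 0"
      show False using q[of "- (?A + 1) / (2 * ?B)"] ne True by (simp add: field_simps)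
    qed
    then show ?thesis using True by simp
  next
    case False
    then have "?C > 0" using C0 by linarith
    then show ?thesis using q[of "- ?B / ?C"] by (simp add: field_simps power2_eq_square)
  qed
qed

section \<open>The one-dimensional Cameron-Martin formula and its two-dimensional use\<close>

definition cm_density :: "real \<Rightarrow> real \<Rightarrow> real" where
  "cm_density s x = exp (s * x - s\<^sup>2 / 2)"

lemma cm_density_measurable [measurable]: "cm_density s \<in> borel_measurable borel"
  unfolding cm_density_def by measurable

lemma cm_density_nonneg [simp]: "0 \<le> cm_density s x"
  by (simp add: cm_density_def)

lemma cm_density_zero [simp]: "cm_density 0 x = 1"
  by (simp add: cm_density_def)

lemma distr_std_normal_shift:
  "distr std_normal_distribution borel (\<lambda>x. x + s) = density std_normal_distribution (\<lambda>x. ennreal (cm_density s x))"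
proof (rule measure_eqI)
  fix A assume "A \<in> sets (distr std_normal_distribution borel (\<lambda>x. x + s))"
  then have [measurable]: "A \<in> sets borel" by simp
  have d: "std_normal_density x * cm_density s x = std_normal_density (x - s)" for x
    by (simp add: std_normal_density_def cm_density_def exp_add[symmetric] power2_eq_square field_simps)
  have "emeasure (distr std_normal_distribution borel (\<lambda>x. x + s)) A 
      = (\<integral>\<^sup>+x. indicator A (x + s) \<partial>std_normal_distribution)"
    by (subst nn_integral_indicator[symmetric], simp, subst nn_integral_distr) auto
  also have "\<dots> = (\<integral>\<^sup>+x. ennreal (std_normal_density x) * indicator A (x + s) \<partial>lborel)"
    by (subst nn_integral_density) auto
  also have "\<dots> = (\<integral>\<^sup>+x. ennreal (std_normal_density (x - s)) * indicator A x \<partial>lborel)"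
    by (subst (2) nn_integral_real_affine[where t = s and c = 1]) (auto simp: add.commute)
  also have "\<dots> = (\<integral>\<^sup>+x. ennreal (std_normal_density x) * (ennreal (cm_density s x) * indicator A x) \<partial>lborel)"
    unfolding d[symmetric] by (simp add: ennreal_mult mult.assoc)
  also have "\<dots> = emeasure (density std_normal_distribution (\<lambda>x. ennreal (cm_density s x))) A"
    by (subst emeasure_density, simp, simp, subst nn_integral_density) auto
  finally show "emeasure (distr std_normal_distribution borel (\<lambda>x. x + s)) A
     = emeasure (density std_normal_distribution (\<lambda>x. ennreal (cm_density s x))) A" .
qed simp

lemma cm_density_integral:
  shows "integrable std_normal_distribution (cm_density s)"
    and "(\<integral>x. cm_density s x \<partial>std_normal_distribution) = 1"
proof -
  have "integrable (distr std_normal_distribution borel (\<lambda>x. x + s)) (\<lambda>x. 1::real)"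
    by (intro finite_measure.integrable_const prob_space.finite_measure prob_space.prob_space_distr) auto
  then show "integrable std_normal_distribution (cm_density s)"
    unfolding distr_std_normal_shift by (subst (asm) integrable_density) auto
  have "(\<integral>x. 1 \<partial>distr std_normal_distribution borel (\<lambda>x. x + s)) = (1::real)"
    using prob_space.prob_space[OF prob_space.prob_space_distr[OF prob_space_std_normal, of "\<lambda>x. x + s" borel]] by simp
  then show "(\<integral>x. cm_density s x \<partial>std_normal_distribution) = 1"
    unfolding distr_std_normal_shift by (subst (asm) integral_density) auto
qed

text \<open>The square of \<open>cm_density s\<close> is exp (s^2) times
  \<open>cm_density (2 * s)\<close>, so the second moment is again a total mass. This variance
  measures the effect of a shift by s.\<close>

lemma cm_density_variance:
  shows "integrable std_normal_distribution (\<lambda>x. (cm_density s x - 1)\<^sup>2)"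
    and "(\<integral>x. (cm_density s x - 1)\<^sup>2 \<partial>std_normal_distribution) = exp (s\<^sup>2) - 1"
proof -
  have sq: "(cm_density s x - 1)\<^sup>2 = exp (s\<^sup>2) * cm_density (2 * s) x - 2 * cm_density s x + 1" for x
    by (simp add: cm_density_def power2_eq_square algebra_simps flip: exp_add)
  interpret prob_space std_normal_distribution by simp
  show "integrable std_normal_distribution (\<lambda>x. (cm_density s x - 1)\<^sup>2)"
    unfolding sq using cm_density_integral(1) by simp
  show "(\<integral>x. (cm_density s x - 1)\<^sup>2 \<partial>std_normal_distribution) = exp (s\<^sup>2) - 1"
    unfolding sq using cm_density_integral prob_space by simp
qed

text \<open>Removing the two rank-one forms leaves a nonnegative form of no larger trace, hence the
  covariance of a Gaussian measure \<open>\<mu>'\<close>. Independence multiplies the characteristic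
  functionals, which adds the forms back.\<close>

lemma gaussian_pair_decomposition:
  fixes Q :: "'a::{real_inner,banach,second_countable_topology} \<Rightarrow> 'a"
  assumes Q: "pos_op Q" and tr: "trace_le Q \<tau>" and \<mu>: "is_centered_gaussian Q \<mu>"
    and b: "\<And>x. (b1 \<bullet> x)\<^sup>2 + (b2 \<bullet> x)\<^sup>2 \<le> Q x \<bullet> x"
  shows "\<exists>\<mu>'. prob_space \<mu>' \<and> sets \<mu>' = sets borel \<and>
    \<mu> = distr (std_normal_distribution \<Otimes>\<^sub>M (std_normal_distribution \<Otimes>\<^sub>M \<mu>')) borel
       (\<lambda>z. fst z *\<^sub>R b1 + (fst (snd z) *\<^sub>R b2 + snd (snd z)))"
proof -
  define Q' where "Q' x = Q x - (b1 \<bullet> x) *\<^sub>R b1 - (b2 \<bullet> x) *\<^sub>R b2" for x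
  have Q'x: "Q' x \<bullet> x = Q x \<bullet> x - (b1 \<bullet> x)\<^sup>2 - (b2 \<bullet> x)\<^sup>2" for x
    by (simp add: Q'_def inner_diff_left power2_eq_square)
  have "pos_op Q'"
    unfolding pos_op_def
  proof (intro conjI allI)
    have "bounded_linear Q" using Q by (simp add: pos_op_def)
    then show "bounded_linear Q'" unfolding Q'_def
      by (intro bounded_linear_sub bounded_linear_compose[OF bounded_linear_scaleR_left bounded_linear_inner_right])
    show "Q' x \<bullet> y = x \<bullet> Q' y" for x y
      using Q by (simp add: pos_op_def Q'_def inner_diff_left inner_diff_right inner_commute)
    show "0 \<le> Q' x \<bullet> x" for x using b[of x] by (simp add: Q'x)
  qed
  moreover have "trace_le Q' \<tau>"
    unfolding trace_le_def
  proof (intro allI impI)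
    fix F :: "'a set" assume F: "orthonormal F"
    have "(\<Sum>e\<in>F. Q' e \<bullet> e) \<le> (\<Sum>e\<in>F. Q e \<bullet> e)" by (intro sum_mono) (simp add: Q'x)
    also have "\<dots> \<le> \<tau>" using tr F by (simp add: trace_le_def)
    finally show "(\<Sum>e\<in>F. Q' e \<bullet> e) \<le> \<tau>" .
  qed
  ultimately obtain \<mu>' where \<mu>': "is_centered_gaussian Q' \<mu>'" using centered_gaussian_exists by blast
  then have ps: "prob_space \<mu>'" and sets[measurable_cong]: "sets \<mu>' = sets borel" by (auto simp: is_centered_gaussian_def)
  let ?\<gamma> = std_normal_distribution
  let ?P = "?\<gamma> \<Otimes>\<^sub>M (?\<gamma> \<Otimes>\<^sub>M \<mu>')"
  let ?\<pi> = "\<lambda>z. fst z *\<^sub>R b1 + (fst (snd z) *\<^sub>R b2 + snd (snd z))"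
  interpret \<mu>': prob_space \<mu>' by fact
  interpret \<gamma>: prob_space ?\<gamma> by simp
  interpret p1: pair_prob_space ?\<gamma> \<mu>' ..
  interpret p2: pair_prob_space ?\<gamma> "?\<gamma> \<Otimes>\<^sub>M \<mu>'" ..
  have "is_centered_gaussian Q (distr ?P borel ?\<pi>)"
    unfolding is_centered_gaussian_def
  proof (intro conjI allI)
    show "prob_space (distr ?P borel ?\<pi>)" by (rule p2.prob_space_distr) measurable
    fix h
    have ig: "integrable ?\<gamma> (\<lambda>x. iexp (t * x))" for t
      by (rule \<gamma>.integrable_const_bound[of _ 1]) auto
    have im: "integrable \<mu>' (\<lambda>y. iexp (h \<bullet> y))"
      by (rule \<mu>'.integrable_const_bound[of _ 1]) auto
    have cg: "(CLINT x|?\<gamma>. iexp (t * x)) = complex_of_real (exp (- t\<^sup>2 / 2))" for t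
      using char_std_normal_distribution by (simp add: char_def fun_eq_iff)
    have "(CLINT y|distr ?P borel ?\<pi>. iexp (h \<bullet> y)) = (CLINT z|?P. iexp (h \<bullet> ?\<pi> z))"
      by (subst integral_distr) auto
    also have "\<dots> = (CLINT z|?P. iexp ((b1 \<bullet> h) * fst z) * (iexp ((b2 \<bullet> h) * fst (snd z)) * iexp (h \<bullet> snd (snd z))))"
      by (intro Bochner_Integration.integral_cong refl)
        (simp add: inner_add_right exp_add[symmetric] inner_commute algebra_simps)
    also have "\<dots> = (CLINT x|?\<gamma>. iexp ((b1 \<bullet> h) * x)) * (CLINT z|(?\<gamma> \<Otimes>\<^sub>M \<mu>'). iexp ((b2 \<bullet> h) * fst z) * iexp (h \<bullet> snd z))"
      by (rule integral_pair_product(2)[OF \<gamma>.prob_space_axioms p1.prob_space_axioms ig 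
            integral_pair_product(1)[OF \<gamma>.prob_space_axioms \<mu>'.prob_space_axioms ig im]])
    also have "(CLINT z|(?\<gamma> \<Otimes>\<^sub>M \<mu>'). iexp ((b2 \<bullet> h) * fst z) * iexp (h \<bullet> snd z)) =
        (CLINT x|?\<gamma>. iexp ((b2 \<bullet> h) * x)) * (CLINT y|\<mu>'. iexp (h \<bullet> y))"
      by (rule integral_pair_product(2)[OF \<gamma>.prob_space_axioms \<mu>'.prob_space_axioms ig im])
    also have "(CLINT y|\<mu>'. iexp (h \<bullet> y)) = complex_of_real (exp (- (Q' h \<bullet> h) / 2))"
      using \<mu>' by (simp add: is_centered_gaussian_def)
    finally have e: "(CLINT y|distr ?P borel ?\<pi>. iexp (h \<bullet> y)) = (CLINT x|?\<gamma>. iexp ((b1 \<bullet> h) * x)) *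
        ((CLINT x|?\<gamma>. iexp ((b2 \<bullet> h) * x)) * complex_of_real (exp (- (Q' h \<bullet> h) / 2)))" .
    have *: "(CLINT y|distr ?P borel ?\<pi>. iexp (h \<bullet> y)) = complex_of_real (exp (- (b1 \<bullet> h)\<^sup>2 / 2) *
        (exp (- (b2 \<bullet> h)\<^sup>2 / 2) * exp (- (Q' h \<bullet> h) / 2)))"
      unfolding e unfolding cg by (simp only: of_real_mult)
    show "(CLINT y|distr ?P borel ?\<pi>. iexp (h \<bullet> y)) = complex_of_real (exp (- (Q h \<bullet> h) / 2))"
      unfolding * exp_add[symmetric] Q'x by (simp add: field_simps)
  qed simp
  then have "\<mu> = distr ?P borel ?\<pi>" using \<mu> centered_gaussian_unique by blast
  then show ?thesis using ps sets by blast
qed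

text \<open>In the coordinates of \<open>gaussian_pair_decomposition\<close> a shift by c1 b1 + c2
  b2 moves only the two scalar coordinates, so it becomes multiplication by two Cameron-Martin
  densities. Differences replace a density by the density minus 1, and Cauchy-Schwarz separates the
  variances from the integral of \<phi>^2. Keeping this integral, instead of M^2, permits summation
  over components later.\<close>

lemma gaussian_shift_estimates:
  fixes Q :: "'a::{real_inner,banach,second_countable_topology} \<Rightarrow> 'a"
  assumes Q: "pos_op Q" and tr: "trace_le Q \<tau>" and \<mu>: "is_centered_gaussian Q \<mu>"
    and b: "\<And>x. (b1 \<bullet> x)\<^sup>2 + (b2 \<bullet> x)\<^sup>2 \<le> Q x \<bullet> x"
    and \<phi>[measurable]: "\<phi> \<in> borel_measurable borel" and \<phi>b: "\<And>x. \<bar>\<phi> x\<bar> \<le> M"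
  defines "J \<equiv> \<lambda>c1 c2. \<integral>y. \<phi> (c1 *\<^sub>R b1 + c2 *\<^sub>R b2 + y) \<partial>\<mu>"
  shows "(J c1 0 - J 0 0)\<^sup>2 \<le> (exp (c1\<^sup>2) - 1) * (\<integral>y. (\<phi> y)\<^sup>2 \<partial>\<mu>)"
    and "(J c1 c2 - J c1 0 - J 0 c2 + J 0 0)\<^sup>2 \<le> (exp (c1\<^sup>2) - 1) * (exp (c2\<^sup>2) - 1) * (\<integral>y. (\<phi> y)\<^sup>2 \<partial>\<mu>)"
proof -
  obtain \<mu>' where ps: "prob_space \<mu>'" and sets[measurable_cong]: "sets \<mu>' = sets borel" and
    \<mu>_eq: "\<mu> = distr (std_normal_distribution \<Otimes>\<^sub>M (std_normal_distribution \<Otimes>\<^sub>M \<mu>')) borel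
       (\<lambda>z. fst z *\<^sub>R b1 + (fst (snd z) *\<^sub>R b2 + snd (snd z)))"
    using gaussian_pair_decomposition[OF Q tr \<mu> b] by blast
  let ?\<gamma> = std_normal_distribution
  let ?P = "?\<gamma> \<Otimes>\<^sub>M (?\<gamma> \<Otimes>\<^sub>M \<mu>')"
  define \<pi> where "\<pi> = (\<lambda>z :: real \<times> real \<times> 'a. fst z *\<^sub>R b1 + (fst (snd z) *\<^sub>R b2 + snd (snd z)))"
  have [measurable]: "\<pi> \<in> borel_measurable ?P" unfolding \<pi>_def by measurable
  interpret \<mu>': prob_space \<mu>' by fact
  interpret \<gamma>: prob_space ?\<gamma> by simp
  interpret p1: pair_prob_space ?\<gamma> \<mu>' ..
  interpret p2: pair_prob_space ?\<gamma> "?\<gamma> \<Otimes>\<^sub>M \<mu>'" ..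
  \<comment> \<open>Each scalar factor carries its own density and the factor \<open>\<mu>'\<close>
    the density 1; the product measure then has the product density.\<close>
  have shift: "distr ?P ?P (\<lambda>z. (fst z + c1, (fst (snd z) + c2, snd (snd z)))) = 
     density ?P (\<lambda>z. ennreal (cm_density c1 (fst z) * cm_density c2 (fst (snd z))))" for c1 c2
  proof -
    have d1: "distr ?\<gamma> ?\<gamma> (\<lambda>x. x + c) = density ?\<gamma> (\<lambda>x. ennreal (cm_density c x))" for c
      unfolding distr_std_normal_shift[symmetric] by (rule distr_cong) auto
    have psd: "prob_space (density ?\<gamma> (\<lambda>x. ennreal (cm_density c x)))" for c
      unfolding d1[symmetric] by (rule \<gamma>.prob_space_distr) simp
    have fm: "finite_measure (density ?\<gamma> (\<lambda>x. ennreal (cm_density c x)))" for c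
      by (rule prob_space.finite_measure[OF psd])
    have sf: "sigma_finite_measure (density ?\<gamma> (\<lambda>x. ennreal (cm_density c x)))" for c
      using fm by (simp add: finite_measure_def)
    have sf1: "sigma_finite_measure (density \<mu>' (\<lambda>x. 1))" by (simp add: density_1 \<mu>'.sigma_finite_measure_axioms)
    have "density ?\<gamma> (\<lambda>x. ennreal (cm_density c2 x)) \<Otimes>\<^sub>M \<mu>' = density ?\<gamma> (\<lambda>x. ennreal (cm_density c2 x)) \<Otimes>\<^sub>M density \<mu>' (\<lambda>x. 1)"
      by (simp add: density_1)
    also have "\<dots> = density (?\<gamma> \<Otimes>\<^sub>M \<mu>') (\<lambda>(x, y). ennreal (cm_density c2 x) * 1)"
      by (rule pair_measure_density) (auto intro: \<mu>'.sigma_finite_measure_axioms sf1)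
    finally have e2: "density ?\<gamma> (\<lambda>x. ennreal (cm_density c2 x)) \<Otimes>\<^sub>M \<mu>' = density (?\<gamma> \<Otimes>\<^sub>M \<mu>') (\<lambda>(x, y). ennreal (cm_density c2 x) * 1)" .
    have psd2: "sigma_finite_measure (density (?\<gamma> \<Otimes>\<^sub>M \<mu>') (\<lambda>(x, y). ennreal (cm_density c2 x) * 1))"
    proof -
      interpret a: prob_space "density ?\<gamma> (\<lambda>x. ennreal (cm_density c2 x))" by (rule psd)
      interpret pair_prob_space "density ?\<gamma> (\<lambda>x. ennreal (cm_density c2 x))" \<mu>' ..
      show ?thesis unfolding e2[symmetric] by (rule sigma_finite_measure_axioms)
    qed
    have e3: "density ?\<gamma> (\<lambda>x. ennreal (cm_density c1 x)) \<Otimes>\<^sub>M density (?\<gamma> \<Otimes>\<^sub>M \<mu>') (\<lambda>(x, y). ennreal (cm_density c2 x) * 1) = 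
       density ?P (\<lambda>(x, z). ennreal (cm_density c1 x) * (case z of (x, y) \<Rightarrow> ennreal (cm_density c2 x) * 1))"
      by (rule pair_measure_density) (use psd2 in \<open>auto intro: p1.sigma_finite_measure_axioms\<close>)
    have "distr ?\<gamma> ?\<gamma> (\<lambda>x. x + c2) \<Otimes>\<^sub>M distr \<mu>' \<mu>' (\<lambda>y. y) = 
       distr (?\<gamma> \<Otimes>\<^sub>M \<mu>') (?\<gamma> \<Otimes>\<^sub>M \<mu>') (\<lambda>(x, y). (x + c2, y))"
      by (rule pair_measure_distr) (auto simp: distr_id2 \<mu>'.sigma_finite_measure_axioms)
    then have f2: "density ?\<gamma> (\<lambda>x. ennreal (cm_density c2 x)) \<Otimes>\<^sub>M \<mu>' = distr (?\<gamma> \<Otimes>\<^sub>M \<mu>') (?\<gamma> \<Otimes>\<^sub>M \<mu>') (\<lambda>(x, y). (x + c2, y))"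
      by (simp add: d1 distr_id2)
    have "distr ?\<gamma> ?\<gamma> (\<lambda>x. x + c1) \<Otimes>\<^sub>M distr (?\<gamma> \<Otimes>\<^sub>M \<mu>') (?\<gamma> \<Otimes>\<^sub>M \<mu>') (\<lambda>(x, y). (x + c2, y)) = 
       distr ?P ?P (\<lambda>(x, z). (x + c1, case z of (x, y) \<Rightarrow> (x + c2, y)))"
      by (rule pair_measure_distr) (use psd2 in \<open>auto simp: f2[symmetric] e2\<close>)
    then have "distr ?P ?P (\<lambda>(x, z). (x + c1, case z of (x, y) \<Rightarrow> (x + c2, y))) = 
       density ?P (\<lambda>(x, z). ennreal (cm_density c1 x) * (case z of (x, y) \<Rightarrow> ennreal (cm_density c2 x) * 1))"
      unfolding f2[symmetric] d1 e2 e3 by simp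
    then show ?thesis
      by (simp add: case_prod_beta' ennreal_mult)
  qed
  have \<phi>b': "\<bar>\<phi> x\<bar> \<le> \<bar>M\<bar>" for x using \<phi>b[of x] by linarith
  have JP: "J c1 c2 = (\<integral>z. \<phi> (\<pi> z) * (cm_density c1 (fst z) * cm_density c2 (fst (snd z))) \<partial>?P)" for c1 c2
  proof -
    have "J c1 c2 = (\<integral>z. \<phi> (c1 *\<^sub>R b1 + c2 *\<^sub>R b2 + \<pi> z) \<partial>?P)"
      unfolding J_def \<mu>_eq \<pi>_def by (subst integral_distr) auto
    also have "\<dots> = (\<integral>z. \<phi> (\<pi> (fst z + c1, (fst (snd z) + c2, snd (snd z)))) \<partial>?P)"
      by (intro Bochner_Integration.integral_cong refl arg_cong[of _ _ \<phi>]) (simp add: \<pi>_def algebra_simps)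
    also have "\<dots> = (\<integral>z. \<phi> (\<pi> z) \<partial>distr ?P ?P (\<lambda>z. (fst z + c1, (fst (snd z) + c2, snd (snd z)))))"
      by (subst integral_distr) auto
    also have "\<dots> = (\<integral>z. \<phi> (\<pi> z) * (cm_density c1 (fst z) * cm_density c2 (fst (snd z))) \<partial>?P)"
      unfolding shift by (subst integral_density) (auto simp: mult.commute)
    finally show ?thesis .
  qed
  have sqP: "(\<integral>y. (\<phi> y)\<^sup>2 \<partial>\<mu>) = (\<integral>z. (\<phi> (\<pi> z))\<^sup>2 \<partial>?P)"
    unfolding \<mu>_eq \<pi>_def by (subst integral_distr) auto
  have i\<phi>: "integrable ?P (\<lambda>z. (\<phi> (\<pi> z))\<^sup>2)"
    by (rule p2.integrable_const_bound[of _ "\<bar>M\<bar>\<^sup>2"]) (auto intro: power_mono[OF \<phi>b', of _ 2, simplified])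
  have iD: "integrable ?P (\<lambda>z. f (fst z) * g (fst (snd z)))"
    and eD: "(\<integral>z. f (fst z) * g (fst (snd z)) \<partial>?P) = (\<integral>x. f x \<partial>?\<gamma>) * (\<integral>x. g x \<partial>?\<gamma>)"
    if f: "integrable ?\<gamma> f" and g: "integrable ?\<gamma> g" for f g :: "real \<Rightarrow> real"
  proof -
    have g1: "integrable (?\<gamma> \<Otimes>\<^sub>M \<mu>') (\<lambda>z. g (fst z))" 
       "(\<integral>z. g (fst z) \<partial>(?\<gamma> \<Otimes>\<^sub>M \<mu>')) = (\<integral>x. g x \<partial>?\<gamma>)"
      using integral_pair_product[OF \<gamma>.prob_space_axioms \<mu>'.prob_space_axioms g, of "\<lambda>_. 1"] \<mu>'.prob_space by auto
    show "integrable ?P (\<lambda>z. f (fst z) * g (fst (snd z)))"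
      and "(\<integral>z. f (fst z) * g (fst (snd z)) \<partial>?P) = (\<integral>x. f x \<partial>?\<gamma>) * (\<integral>x. g x \<partial>?\<gamma>)"
      using integral_pair_product[OF \<gamma>.prob_space_axioms p1.prob_space_axioms f g1(1)] g1(2) by auto
  qed
  have i1: "integrable ?P (\<lambda>z. \<phi> (\<pi> z) * (cm_density c1 (fst z) * cm_density c2 (fst (snd z))))" for c1 c2
  proof (rule Bochner_Integration.integrable_bound)
    show "integrable ?P (\<lambda>z. \<bar>M\<bar> * (cm_density c1 (fst z) * cm_density c2 (fst (snd z))))"
      by (intro integrable_mult_right iD cm_density_integral)
    show "AE z in ?P. norm (\<phi> (\<pi> z) * (cm_density c1 (fst z) * cm_density c2 (fst (snd z))))
       \<le> norm (\<bar>M\<bar> * (cm_density c1 (fst z) * cm_density c2 (fst (snd z))))"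
      using \<phi>b' by (auto simp: abs_mult intro!: mult_right_mono)
  qed measurable
  let ?D = "\<lambda>c x. cm_density c x - 1"
  have "J c1 0 - J 0 0 = (\<integral>z. \<phi> (\<pi> z) * ?D c1 (fst z) \<partial>?P)"
    unfolding JP by (subst Bochner_Integration.integral_diff[symmetric, OF i1 i1]) (simp add: algebra_simps)
  moreover have "(\<integral>z. \<phi> (\<pi> z) * ?D c1 (fst z) \<partial>?P)\<^sup>2 \<le> (\<integral>z. (\<phi> (\<pi> z))\<^sup>2 \<partial>?P) * (\<integral>z. (?D c1 (fst z))\<^sup>2 \<partial>?P)"
    using iD[OF cm_density_variance(1), of "\<lambda>_. 1"] i\<phi> by (intro Cauchy_Schwarz_integral) auto
  moreover have "(\<integral>z. (?D c1 (fst z))\<^sup>2 \<partial>?P) = exp (c1\<^sup>2) - 1"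
    using eD[OF cm_density_variance(1), of "\<lambda>_. 1" c1] cm_density_variance(2)[of c1] \<gamma>.prob_space by simp
  ultimately show "(J c1 0 - J 0 0)\<^sup>2 \<le> (exp (c1\<^sup>2) - 1) * (\<integral>y. (\<phi> y)\<^sup>2 \<partial>\<mu>)"
    by (simp add: sqP mult.commute)
  have "J c1 c2 - J c1 0 - J 0 c2 + J 0 0 = (\<integral>z. \<phi> (\<pi> z) * (?D c1 (fst z) * ?D c2 (fst (snd z))) \<partial>?P)"
    unfolding JP
    by (subst Bochner_Integration.integral_diff[symmetric, OF i1 i1],
        subst Bochner_Integration.integral_diff[symmetric, OF Bochner_Integration.integrable_diff[OF i1 i1] i1],
        subst Bochner_Integration.integral_add[symmetric, OF Bochner_Integration.integrable_diff[OF Bochner_Integration.integrable_diff[OF i1 i1] i1] i1])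
      (simp add: algebra_simps)
  moreover have "(\<integral>z. \<phi> (\<pi> z) * (?D c1 (fst z) * ?D c2 (fst (snd z))) \<partial>?P)\<^sup>2 
     \<le> (\<integral>z. (\<phi> (\<pi> z))\<^sup>2 \<partial>?P) * (\<integral>z. (?D c1 (fst z) * ?D c2 (fst (snd z)))\<^sup>2 \<partial>?P)"
    using iD[OF cm_density_variance(1) cm_density_variance(1)] i\<phi>
    by (intro Cauchy_Schwarz_integral) (auto simp: power_mult_distrib)
  moreover have "(\<integral>z. (?D c1 (fst z) * ?D c2 (fst (snd z)))\<^sup>2 \<partial>?P) = (exp (c1\<^sup>2) - 1) * (exp (c2\<^sup>2) - 1)"
    unfolding power_mult_distrib
    using eD[OF cm_density_variance(1) cm_density_variance(1), of c1 c2] by (simp add: cm_density_variance(2))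
  ultimately show "(J c1 c2 - J c1 0 - J 0 c2 + J 0 0)\<^sup>2 \<le> (exp (c1\<^sup>2) - 1) * (exp (c2\<^sup>2) - 1) * (\<integral>y. (\<phi> y)\<^sup>2 \<partial>\<mu>)"
    by (simp add: sqP mult_ac)
qed

section \<open>The wave group\<close>

lemma selfadjoint_symmetric:
  assumes "selfadjoint D L" "x \<in> D" "y \<in> D"
  shows "L x \<bullet> y = x \<bullet> L y"
  using assms unfolding selfadjoint_def by blast

text \<open>The graph of a self-adjoint operator is the graph of its adjoint, which is cut out by
  equations that survive limits.\<close>

lemma selfadjoint_closed_graph:
  assumes sa: "selfadjoint D L" and x: "\<And>n. x n \<in> D" "x \<longlonglongrightarrow> l" "(\<lambda>n. L (x n)) \<longlonglongrightarrow> y"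
  shows "l \<in> D" "y = L l"
proof -
  have "L z \<bullet> l = z \<bullet> y" if z: "z \<in> D" for z
  proof (rule LIMSEQ_unique)
    show "(\<lambda>n. L z \<bullet> x n) \<longlonglongrightarrow> L z \<bullet> l" by (intro tendsto_intros x)
    have "(\<lambda>n. z \<bullet> L (x n)) \<longlonglongrightarrow> z \<bullet> y" by (intro tendsto_intros x)
    then show "(\<lambda>n. L z \<bullet> x n) \<longlonglongrightarrow> z \<bullet> y"
      using selfadjoint_symmetric[OF sa z x(1)] by simp
  qed
  then show "l \<in> D" "y = L l" using sa unfolding selfadjoint_def by blast+
qed

text \<open>The lower bound gives m |x| <= |L x|, hence injectivity and, with the closed graph, a
  closed range. A vector orthogonal to the range belongs to the domain with image 0, so it is
  0.\<close>

lemma positive_selfadjoint_bijective: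
  fixes D :: "'u::{real_inner,banach} set"
  assumes "positive_selfadjoint D L"
  shows "inj_on L D" "L ` D = UNIV"
proof -
  obtain m where sa: "selfadjoint D L" and m: "m > 0" "\<And>x. x \<in> D \<Longrightarrow> m * (norm x)\<^sup>2 \<le> L x \<bullet> x"
    using assms by (auto simp: positive_selfadjoint_def)
  have D: "subspace D" and Ladd: "\<And>x y. x \<in> D \<Longrightarrow> y \<in> D \<Longrightarrow> L (x + y) = L x + L y"
    and Lsc: "\<And>c x. x \<in> D \<Longrightarrow> L (c *\<^sub>R x) = c *\<^sub>R L x"
    using sa by (auto simp: selfadjoint_def)
  have Ldiff: "L (x - y) = L x - L y" if "x \<in> D" "y \<in> D" for x y
    using Ladd[of x "(-1) *\<^sub>R y"] Lsc[of y "-1"] that D by (simp add: subspace_neg)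
  have bnd: "m * norm x \<le> norm (L x)" if "x \<in> D" for x
  proof -
    have "m * (norm x)\<^sup>2 \<le> norm (L x) * norm x"
      using m(2)[OF that] norm_cauchy_schwarz[of "L x" x] by linarith
    then show ?thesis by (cases "x = 0") (auto simp: power2_eq_square)
  qed
  show "inj_on L D"
  proof (rule inj_onI)
    fix x y assume xy: "x \<in> D" "y \<in> D" "L x = L y"
    then have "m * norm (x - y) \<le> 0" using bnd[of "x - y"] Ldiff[of x y] D by (simp add: subspace_diff)
    then show "x = y" using m by (simp add: mult_le_0_iff)
  qed
  show "L ` D = UNIV"
  proof (rule closed_subspace_eq_UNIV)
    show "subspace (L ` D)"
      unfolding subspace_def
    proof (intro conjI ballI allI)
      show "0 \<in> L ` D" using Lsc[of 0 0] D subspace_0[OF D] by (auto intro!: image_eqI[of _ _ 0])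
      fix x y assume "x \<in> L ` D" "y \<in> L ` D"
      then show "x + y \<in> L ` D" using D Ladd by clarify (metis imageI subspace_add)
    next
      fix c x assume "x \<in> L ` D"
      then show "c *\<^sub>R x \<in> L ` D" using D Lsc by clarify (metis imageI subspace_scale)
    qed
    show "closed (L ` D)"
      unfolding closed_sequential_limits
    proof (intro allI impI)
      fix y l assume "(\<forall>n. y n \<in> L ` D) \<and> y \<longlonglongrightarrow> l"
      then have "\<forall>n. \<exists>x. x \<in> D \<and> y n = L x" and yl: "y \<longlonglongrightarrow> l" by auto
      then obtain x where x: "\<And>n. x n \<in> D" "\<And>n. y n = L (x n)" by metis
      have "Cauchy x"
      proof (rule metric_CauchyI)
        fix e :: real assume e: "e > 0"
        have "Cauchy y" using yl by (rule LIMSEQ_imp_Cauchy)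
        then obtain N where N: "\<And>p q. p \<ge> N \<Longrightarrow> q \<ge> N \<Longrightarrow> dist (y p) (y q) < m * e"
          using e m by (meson Cauchy_def mult_pos_pos)
        have "dist (x p) (x q) < e" if "p \<ge> N" "q \<ge> N" for p q
        proof -
          have "m * norm (x p - x q) \<le> norm (y p - y q)"
            using bnd[of "x p - x q"] Ldiff x D by (simp add: subspace_diff)
          also have "\<dots> < m * e" using N[OF that] by (simp add: dist_norm)
          finally show ?thesis using m by (simp add: dist_norm)
        qed
        then show "\<exists>N. \<forall>p\<ge>N. \<forall>q\<ge>N. dist (x p) (x q) < e" by blast
      qed
      then obtain xl where xl: "x \<longlonglongrightarrow> xl" using Cauchy_convergent_iff convergentD by blast
      have "(\<lambda>n. L (x n)) \<longlonglongrightarrow> l" using yl unfolding x(2)[symmetric] .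
      then show "l \<in> L ` D" using selfadjoint_closed_graph[OF sa x(1) xl] by blast
    qed
    fix y assume y: "\<And>x. x \<in> L ` D \<Longrightarrow> x \<bullet> y = 0"
    then have "\<forall>x\<in>D. L x \<bullet> y = x \<bullet> 0" by simp
    then have "y \<in> D" "L y = 0" using sa unfolding selfadjoint_def by metis+
    then show "y = 0" using bnd[of y] m by (simp add: mult_le_0_iff)
  qed
qed

section \<open>Bessel's inequality, an integral inequality and difference quotients\<close>

lemma orthonormal_bessel:
  assumes "orthonormal F"
  shows "(\<Sum>e\<in>F. (x \<bullet> e)\<^sup>2) \<le> (norm x)\<^sup>2"
proof -
  let ?p = "\<Sum>e\<in>F. (x \<bullet> e) *\<^sub>R e"
  have fin: "finite F" using assms by (simp add: orthonormal_def)
  have pe: "?p \<bullet> e = x \<bullet> e" if "e \<in> F" for e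
  proof -
    have "?p \<bullet> e = (\<Sum>e'\<in>F. if e' = e then x \<bullet> e else 0)"
      unfolding inner_sum_left using assms that
      by (intro sum.cong refl) (auto simp: orthonormal_def dot_square_norm)
    then show ?thesis using fin that by simp
  qed
  have pp: "?p \<bullet> ?p = (\<Sum>e\<in>F. (x \<bullet> e)\<^sup>2)"
    unfolding inner_sum_right[of ?p] by (intro sum.cong refl) (simp add: pe power2_eq_square)
  have xp: "x \<bullet> ?p = (\<Sum>e\<in>F. (x \<bullet> e)\<^sup>2)"
    by (simp add: inner_sum_right power2_eq_square)
  have "0 \<le> (x - ?p) \<bullet> (x - ?p)" by simp
  also have "\<dots> = x \<bullet> x - 2 * (x \<bullet> ?p) + ?p \<bullet> ?p"
    unfolding inner_diff_left inner_diff_right by (simp only: inner_commute[of ?p x])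
  finally show ?thesis by (simp add: pp xp power2_norm_eq_inner)
qed

text \<open>The integral of (g - c)^2 is nonnegative for the mean value c of g.\<close>

lemma integral_square_le:
  fixes g :: "real \<Rightarrow> real"
  assumes ab: "a < b" and g: "continuous_on {a..b} g"
  shows "(integral {a..b} g)\<^sup>2 \<le> (b - a) * integral {a..b} (\<lambda>s. (g s)\<^sup>2)"
proof -
  define c where "c = integral {a..b} g / (b - a)"
  have i1: "g integrable_on {a..b}" and i2: "(\<lambda>s. (g s)\<^sup>2) integrable_on {a..b}"
    by (intro integrable_continuous_real continuous_intros g)+
  have "0 \<le> integral {a..b} (\<lambda>s. (g s - c)\<^sup>2)"
    by (intro Henstock_Kurzweil_Integration.integral_nonneg integrable_continuous_real continuous_intros g) auto
  also have "(\<lambda>s. (g s - c)\<^sup>2) = (\<lambda>s. (g s)\<^sup>2 - 2 * c * g s + c\<^sup>2)"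
    by (simp add: power2_eq_square algebra_simps)
  also have "integral {a..b} \<dots> = integral {a..b} (\<lambda>s. (g s)\<^sup>2) - 2 * c * integral {a..b} g + c\<^sup>2 * (b - a)"
    using ab has_integral_add[OF has_integral_diff[OF integrable_integral[OF i2] has_integral_mult_right[OF integrable_integral[OF i1], of "2 * c"]]
        has_integral_const_real[of "c\<^sup>2" a b]]
    by (intro integral_unique) (simp add: mult.commute)
  also have "\<dots> = integral {a..b} (\<lambda>s. (g s)\<^sup>2) - (integral {a..b} g)\<^sup>2 / (b - a)"
  proof -
    have "X - 2 * (y / d) * y + (y / d)\<^sup>2 * d = X - y\<^sup>2 / d" if "d > 0" for X y d :: real
      using that by (simp add: field_simps power2_eq_square)
    from this[of "b - a"] show ?thesis using ab unfolding c_def by simp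
  qed
  finally show ?thesis using ab by (simp add: field_simps)
qed

lemma vector_derivative_quotientI:
  fixes f :: "real \<Rightarrow> 'a::real_normed_vector"
  assumes "((\<lambda>h. (f (x + h) - f x) /\<^sub>R h) \<longlongrightarrow> d) (at 0)"
  shows "(f has_vector_derivative d) (at x)"
  unfolding has_vector_derivative_def has_derivative_at
proof
  show "bounded_linear (\<lambda>h. h *\<^sub>R d)" by (rule bounded_linear_scaleR_left)
  have "((\<lambda>h. norm ((f (x + h) - f x) /\<^sub>R h - d)) \<longlongrightarrow> norm (d - d)) (at 0)"
    by (intro tendsto_intros assms)
  then have "((\<lambda>h. norm ((f (x + h) - f x) /\<^sub>R h - d)) \<longlongrightarrow> 0) (at 0)" by simp
  moreover have "\<forall>\<^sub>F h in at 0. norm ((f (x + h) - f x) /\<^sub>R h - d) = norm (f (x + h) - f x - h *\<^sub>R d) / norm h"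
    unfolding eventually_at_filter
  proof (intro always_eventually allI impI)
    fix h :: real assume "h \<noteq> 0"
    then have "(f (x + h) - f x) /\<^sub>R h - d = (f (x + h) - f x - h *\<^sub>R d) /\<^sub>R h" by (simp add: scaleR_diff_right)
    then show "norm ((f (x + h) - f x) /\<^sub>R h - d) = norm (f (x + h) - f x - h *\<^sub>R d) / norm h"
      by (simp add: divide_inverse mult.commute)
  qed
  ultimately show "((\<lambda>h. norm (f (x + h) - f x - h *\<^sub>R d) / norm h) \<longlongrightarrow> 0) (at 0)"
    by (rule Lim_transform_eventually)
qed

lemma dense_closed_UNIV:
  assumes "closure S = UNIV" "closed {x. P x}" "\<And>x. x \<in> S \<Longrightarrow> P x"
  shows "P x"
proof -
  have "closure S \<subseteq> {x. P x}" using assms by (intro closure_minimal) auto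
  then show ?thesis using assms(1) by auto
qed

section \<open>The energy spaces and the unitary group\<close>

context wave_setting
begin

lemma S_selfadjoint: "selfadjoint DS S"
  using S_sqrt by (simp add: is_sqrt_op_def)

lemma D_iff: "x \<in> D \<longleftrightarrow> x \<in> DS \<and> S x \<in> DS"
  using S_sqrt by (auto simp: is_sqrt_op_def)

lemma L_eq: "x \<in> D \<Longrightarrow> L x = S (S x)"
  using S_sqrt by (simp add: is_sqrt_op_def)

lemma DS_subspace: "subspace DS" and DS_dense: "closure DS = UNIV"
  and S_add: "x \<in> DS \<Longrightarrow> y \<in> DS \<Longrightarrow> S (x + y) = S x + S y"
  and S_scale: "x \<in> DS \<Longrightarrow> S (c *\<^sub>R x) = c *\<^sub>R S x"
  using S_selfadjoint by (auto simp: selfadjoint_def)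

lemma S_diff: "x \<in> DS \<Longrightarrow> y \<in> DS \<Longrightarrow> S (x - y) = S x - S y"
  using S_add[of x "(-1) *\<^sub>R y"] S_scale[of y "-1"] DS_subspace by (simp add: subspace_neg)

lemma S_symmetric: "x \<in> DS \<Longrightarrow> y \<in> DS \<Longrightarrow> S x \<bullet> y = x \<bullet> S y"
  by (rule selfadjoint_symmetric[OF S_selfadjoint])

lemma S_surj: "S ` DS = UNIV"
proof -
  have "UNIV = L ` D" using positive_selfadjoint_bijective[OF L_positive] by simp
  also have "\<dots> \<subseteq> S ` DS" using D_iff L_eq by auto
  finally show ?thesis by blast
qed

lemma S_inj: "inj_on S DS"
proof (rule inj_onI)
  fix x y assume xy: "x \<in> DS" "y \<in> DS" "S x = S y"
  have d: "x - y \<in> DS" using xy DS_subspace by (simp add: subspace_diff)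
  have s0: "S 0 = 0" using S_scale[of 0 0] subspace_0[OF DS_subspace] by simp
  have "S (x - y) = 0" using xy by (simp add: S_diff)
  then have "x - y \<in> D" "L (x - y) = L 0" "0 \<in> D"
    using d s0 subspace_0[OF DS_subspace] D_iff L_eq by auto
  then have "x - y = 0" using positive_selfadjoint_bijective(1)[OF L_positive] by (meson inj_onD)
  then show "x = y" by simp
qed

abbreviation Si :: "'u \<Rightarrow> 'u" where "Si \<equiv> inv_into DS S"

lemma Si_in [simp]: "Si a \<in> DS" and S_Si [simp]: "S (Si a) = a"
  using S_surj by (auto intro: inv_into_into f_inv_into_f)

lemma Si_S: "x \<in> DS \<Longrightarrow> Si (S x) = x"
  by (rule inv_into_f_f[OF S_inj])

lemma Si_Si_in: "Si (Si a) \<in> D" and L_Si_Si: "L (Si (Si a)) = a"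
  using D_iff[of "Si (Si a)"] L_eq[of "Si (Si a)"] by simp_all

lemma inv_L: "inv_into D L a = Si (Si a)"
proof -
  have "inv_into D L (L (Si (Si a))) = Si (Si a)"
    by (rule inv_into_f_f[OF positive_selfadjoint_bijective(1)[OF L_positive] Si_Si_in])
  then show ?thesis by (simp add: L_Si_Si)
qed

lemma Si_inner: "Si a \<bullet> Si b = Si (Si a) \<bullet> b"
  using S_symmetric[of "Si (Si a)" "Si b"] by simp

text \<open>For x = Si (Si a) the lower bound gives m |x| <= |a|; with |Si a|^2 = x . a this yields
  the constant 1 / sqrt m.\<close>

lemma Si_bound: "\<exists>c>0. \<forall>a. norm (Si a) \<le> c * norm a"
proof -
  obtain m where m: "m > 0" "\<And>x. x \<in> D \<Longrightarrow> m * (norm x)\<^sup>2 \<le> L x \<bullet> x"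
    using L_positive by (auto simp: positive_selfadjoint_def)
  have "norm (Si a) \<le> (1 / sqrt m) * norm a" for a
  proof -
    let ?x = "Si (Si a)"
    have "m * (norm ?x)\<^sup>2 \<le> norm a * norm ?x"
      using m(2)[OF Si_Si_in, of a] norm_cauchy_schwarz[of a ?x] L_Si_Si[of a] by simp
    then have x: "m * norm ?x \<le> norm a" by (cases "?x = 0") (auto simp: power2_eq_square)
    have "m * (norm (Si a))\<^sup>2 = m * (?x \<bullet> a)" by (simp add: power2_norm_eq_inner Si_inner)
    also have "\<dots> \<le> m * (norm ?x * norm a)" using m norm_cauchy_schwarz by (intro mult_left_mono) auto
    also have "\<dots> \<le> norm a * norm a" using mult_right_mono[OF x, of "norm a"] by (simp add: mult.assoc)
    finally have "m * (norm (Si a))\<^sup>2 \<le> (norm a)\<^sup>2" by (simp add: power2_eq_square)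
    then have "(sqrt m * norm (Si a))\<^sup>2 \<le> (norm a)\<^sup>2" using m by (simp add: power_mult_distrib)
    then have "sqrt m * norm (Si a) \<le> norm a" by (rule power2_le_imp_le) simp
    then show ?thesis using m by (simp add: field_simps)
  qed
  then show ?thesis using m by (intro exI[of _ "1 / sqrt m"]) auto
qed

lemma j_bounded_linear: "bounded_linear j"
proof -
  obtain c where c: "\<And>a. norm (Si a) \<le> c * norm a" using Si_bound by blast
  have "norm (j a) = norm (Si a)" for a by (simp add: norm_eq_sqrt_inner j_inner)
  then show ?thesis using j_linear c
    by (intro bounded_linear_intro[of j c]) (auto simp: linear_add linear_scale mult.commute)
qed

lemma i_in: "i v \<in> DS" using i_range by auto

lemma i_bounded_linear: "bounded_linear i"
proof -
  obtain c where c: "\<And>a. norm (Si a) \<le> c * norm a" using Si_bound by blast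
  have "norm (i v) \<le> norm v * c" for v
  proof -
    have "norm (S (i v)) = norm v" by (simp add: norm_eq_sqrt_inner i_inner)
    then show ?thesis using c[of "S (i v)"] Si_S[OF i_in] by (simp add: mult.commute)
  qed
  then show ?thesis using i_linear
    by (intro bounded_linear_intro[of i c]) (auto simp: linear_add linear_scale)
qed

lemma norm_j: "norm (j a) = norm (Si a)" by (simp add: norm_eq_sqrt_inner j_inner)

text \<open>The norm of v in V is |S (i v)|, so y in \<open>DS\<close> close to S (i v) gives the
  approximation Si y of i v; it lies in \<open>D\<close> because S (Si y) = y lies in
  \<open>DS\<close>.\<close>

lemma i_D_dense: "closure {v. i v \<in> D} = UNIV"
proof -
  have "\<exists>v'\<in>{v. i v \<in> D}. dist v' v < e" if e: "e > 0" for v e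
  proof -
    obtain y where y: "y \<in> DS" "dist y (S (i v)) < e"
      using DS_dense e by (metis UNIV_I closure_approachable)
    have x: "Si y \<in> D" using y D_iff[of "Si y"] by simp
    obtain v' where v': "i v' = Si y" using i_range Si_in by (metis rangeE)
    have "norm (v' - v) = norm (S (i (v' - v)))" by (simp add: norm_eq_sqrt_inner i_inner)
    also have "i (v' - v) = Si y - i v" by (simp add: linear_diff[OF i_linear] v')
    also have "S (Si y - i v) = y - S (i v)" by (simp add: S_diff i_in)
    finally have "dist v' v < e" using y by (simp add: dist_norm)
    then show ?thesis using x v' by (intro bexI[of _ v']) auto
  qed
  then show ?thesis by (auto simp: closure_approachable)
qed

text \<open>On \<open>D\<close> this is the symmetry of S, and both sides are continuous in v. It is
  the source of the skew-symmetry of A.\<close>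

lemma Lext_pairing: "Lext v \<bullet> j z = i v \<bullet> z"
proof (rule dense_closed_UNIV[OF i_D_dense])
  show "closed {v. Lext v \<bullet> j z = i v \<bullet> z}"
    by (intro closed_Collect_eq continuous_intros linear_continuous_on Lext_bounded i_bounded_linear)
  fix v assume "v \<in> {v. i v \<in> D}"
  then have v: "i v \<in> D" by simp
  then have "Si (L (i v)) = S (i v)" using D_iff L_eq by (simp add: Si_S)
  then show "Lext v \<bullet> j z = i v \<bullet> z"
    using S_symmetric[OF i_in Si_in, of v z] v by (simp add: Lext_extends j_inner)
qed

lemma Lext_isometry: "norm (Lext v) = norm v"
proof (rule dense_closed_UNIV[OF i_D_dense])
  show "closed {v. norm (Lext v) = norm v}"
    by (intro closed_Collect_eq continuous_intros linear_continuous_on Lext_bounded)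
  fix v assume "v \<in> {v. i v \<in> D}"
  then have v: "i v \<in> D" by simp
  then have "Si (L (i v)) = S (i v)" using D_iff L_eq by (simp add: Si_S)
  then show "norm (Lext v) = norm v"
    using v by (simp add: Lext_extends norm_j) (simp add: norm_eq_sqrt_inner i_inner)
qed

abbreviation emb :: "'v \<times> 'u \<Rightarrow> 'u \<times> 'w" where "emb \<equiv> map_prod i j"

text \<open>The generator as a map defined on all of K. It is isometric into H
  (\<open>norm_Aop\<close>), so norms of K can be computed in H.\<close>

definition Aop :: "'v \<times> 'u \<Rightarrow> 'u \<times> 'w" where "Aop k = (snd k, - Lext (fst k))"

lemma emb_bounded_linear: "bounded_linear emb"
  unfolding map_prod_def case_prod_beta'
  by (intro bounded_linear_Pair bounded_linear_compose[OF i_bounded_linear] bounded_linear_compose[OF j_bounded_linear]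
      bounded_linear_fst bounded_linear_snd)

lemma emb_inj: "inj emb"
proof (rule prod.inj_map)
  show "inj i"
  proof (rule linear_injective_0[THEN iffD2, OF i_linear], intro allI impI)
    fix v assume "i v = 0"
    then have "norm v = norm (S 0)" by (metis i_inner norm_eq_sqrt_inner)
    then show "v = 0" using S_scale[of 0 0] subspace_0[OF DS_subspace] by simp
  qed
  show "inj j"
  proof (rule linear_injective_0[THEN iffD2, OF j_linear], intro allI impI)
    fix a assume "j a = 0"
    then have "Si a = 0" using norm_j[of a] by simp
    then have "a = S 0" by (metis S_Si)
    then show "a = 0" using S_scale[of 0 0] subspace_0[OF DS_subspace] by simp
  qed
qed

lemma emb_dense: "closure (range emb) = UNIV"
proof -
  have "range emb = DS \<times> range j" using i_range by (auto simp: map_prod_def)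
  then show ?thesis by (simp add: closure_Times DS_dense j_dense)
qed

lemma emb_GK: "emb (GK a) = GH j a"
  using linear_0[OF i_linear] by (simp add: GK_def GH_def)

lemma GK_bounded_linear: "bounded_linear (GK :: 'u \<Rightarrow> 'v \<times> 'u)"
  unfolding GK_def by (intro bounded_linear_Pair bounded_linear_zero bounded_linear_ident)

lemma norm_GK [simp]: "norm (GK a :: 'v \<times> 'u) = norm a"
  by (simp add: GK_def norm_Pair)

lemma GH_bounded_linear: "bounded_linear (GH j :: 'u \<Rightarrow> 'u \<times> 'w)"
  unfolding GH_def by (intro bounded_linear_Pair bounded_linear_zero j_bounded_linear)

lemma Aop_bounded_linear: "bounded_linear Aop"
  unfolding Aop_def
  by (intro bounded_linear_Pair bounded_linear_minus bounded_linear_compose[OF Lext_bounded] bounded_linear_fst bounded_linear_snd)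

lemma norm_Aop: "norm (Aop k) = norm k"
  by (simp add: Aop_def norm_prod_def Lext_isometry add.commute)

lemma Aop_skew: "Aop k \<bullet> emb k' = - (emb k \<bullet> Aop k')"
  by (simp add: Aop_def map_prod_def case_prod_beta' Lext_pairing inner_prod_def)
    (metis Lext_pairing inner_commute)

lemma E_linear: "bounded_linear (E t)" and E_zero [simp]: "E 0 x = x"
  and E_plus: "E (s + t) x = E s (E t x)" and E_cont: "continuous_on UNIV (\<lambda>t. E t x)"
  using E_group unfolding strongly_continuous_group_def by (auto simp only: id_apply o_apply)

lemma E_minus [simp]: "E (-t) (E t x) = x" "E t (E (-t) x) = x"
  using E_plus[of "-t" t x] E_plus[of t "-t" x] by simp_all

lemma generator_emb: "((\<lambda>h. (E h (emb k) - emb k) /\<^sub>R h) \<longlongrightarrow> Aop k) (at 0)"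
proof -
  have "(emb k, Aop k) \<in> generator_graph E"
    unfolding E_generator by (rule image_eqI[of _ _ k]) (auto simp: Aop_def map_prod_def case_prod_beta')
  then show ?thesis by (simp add: generator_graph_def)
qed

text \<open>E t commutes with E h, so the difference quotients along the orbit are the images under
  E t of those at time 0.\<close>

lemma generator_orbit: "((\<lambda>h. (E h (E t (emb k)) - E t (emb k)) /\<^sub>R h) \<longlongrightarrow> E t (Aop k)) (at 0)"
proof -
  interpret Et: bounded_linear "E t" by (rule E_linear)
  have "((\<lambda>h. E t ((E h (emb k) - emb k) /\<^sub>R h)) \<longlongrightarrow> E t (Aop k)) (at 0)"
    by (intro Et.tendsto generator_emb)
  moreover have "E t (E h x) = E h (E t x)" for h x using E_plus[of t h x] E_plus[of h t x] by (simp add: add.commute)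
  ultimately show ?thesis by (simp add: Et.scaleR Et.diff)
qed

definition Rt :: "real \<Rightarrow> 'v \<times> 'u \<Rightarrow> 'v \<times> 'u" where "Rt t = restrict_op emb (E t)"

text \<open>The difference quotients at E t (emb k) converge, so this point lies in the domain of
  the generator. The graph of the generator is exactly that of \<open>Aop\<close> over K; hence the
  inverse in \<open>restrict_op\<close> is taken at a point of the range of \<open>emb\<close>, and
  A commutes with the group.\<close>

lemma emb_Rt: "emb (Rt t k) = E t (emb k)" and Aop_Rt: "Aop (Rt t k) = E t (Aop k)"
proof -
  have "(E t (emb k), E t (Aop k)) \<in> generator_graph E"
    using generator_orbit[of t k] by (simp add: generator_graph_def)
  then obtain k' where k': "emb k' = E t (emb k)" "Aop k' = E t (Aop k)"
    unfolding E_generator by (auto simp: Aop_def map_prod_def case_prod_beta')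
  then have "Rt t k = k'" unfolding Rt_def restrict_op_def by (metis emb_inj inv_f_f)
  then show "emb (Rt t k) = E t (emb k)" "Aop (Rt t k) = E t (Aop k)" using k' by simp_all
qed

lemma E_emb_derivative: "((\<lambda>s. E s (emb k)) has_vector_derivative E t (Aop k)) (at t)"
proof (rule vector_derivative_quotientI)
  show "((\<lambda>h. (E (t + h) (emb k) - E t (emb k)) /\<^sub>R h) \<longlongrightarrow> E t (Aop k)) (at 0)"
    using generator_orbit[of t k] by (simp add: E_plus[symmetric] add.commute)
qed

text \<open>Conservation of energy: along an orbit starting in K the derivative of the squared norm
  vanishes by skew-symmetry. Density extends the equation to H.\<close>

lemma E_isometry: "norm (E t x) = norm x"
proof (rule dense_closed_UNIV[OF emb_dense])
  show "closed {x. norm (E t x) = norm x}"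
    by (intro closed_Collect_eq continuous_intros linear_continuous_on E_linear)
  fix x assume "x \<in> range emb"
  then obtain k where k: "x = emb k" by auto
  define f where "f s = E s (emb k) \<bullet> E s (emb k)" for s
  have "(f has_real_derivative 0) (at s)" for s
  proof -
    have "(f has_vector_derivative (E s (emb k) \<bullet> E s (Aop k) + E s (Aop k) \<bullet> E s (emb k))) (at s)"
      unfolding f_def by (rule bounded_bilinear.has_vector_derivative[OF bounded_bilinear_inner E_emb_derivative E_emb_derivative])
    moreover have "E s (Aop k) \<bullet> E s (emb k) = - (E s (emb k) \<bullet> E s (Aop k))"
      using Aop_skew[of "Rt s k" "Rt s k"] by (simp add: emb_Rt Aop_Rt)
    ultimately show ?thesis by (simp add: has_real_derivative_iff_has_vector_derivative)
  qed
  then have "f t = f 0" using DERIV_isconst_all by blast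
  then show "norm (E t x) = norm x" by (simp add: f_def k norm_eq_sqrt_inner)
qed

lemma E_inner: "E t x \<bullet> E t y = x \<bullet> y"
proof -
  interpret Et: bounded_linear "E t" by (rule E_linear)
  have "(norm (E t x + E t y))\<^sup>2 = (norm (x + y))\<^sup>2" by (simp flip: Et.add add: E_isometry)
  moreover have "(norm (E t x))\<^sup>2 = (norm x)\<^sup>2" "(norm (E t y))\<^sup>2 = (norm y)\<^sup>2" by (simp_all add: E_isometry)
  ultimately show ?thesis
    by (simp add: power2_norm_eq_inner inner_add_left inner_add_right inner_commute)
qed

lemma E_adjoint: "E t x \<bullet> y = x \<bullet> E (-t) y"
  using E_inner[of t x "E (-t) y"] by simp

lemma adjoint_E: "adjoint (E t) = E (-t)"
  by (rule adjoint_unique) (simp add: E_adjoint)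

text \<open>\<open>Aop\<close> is isometric from K to H and intertwines \<open>Rt t\<close> with E
  t, so isometry on K follows from isometry on H.\<close>

lemma Rt_linear: "bounded_linear (Rt t)" and Rt_isometry: "norm (Rt t k) = norm k"
proof -
  show n: "norm (Rt t k) = norm k" for k
    using norm_Aop[of "Rt t k"] by (simp add: Aop_Rt E_isometry norm_Aop)
  interpret A: bounded_linear emb by (rule emb_bounded_linear)
  interpret Et: bounded_linear "E t" by (rule E_linear)
  show "bounded_linear (Rt t)"
  proof (rule bounded_linear_intro[of _ 1])
    show "Rt t (x + y) = Rt t x + Rt t y" for x y
      by (rule injD[OF emb_inj]) (simp add: emb_Rt A.add Et.add)
    show "Rt t (c *\<^sub>R x) = c *\<^sub>R Rt t x" for c x
      by (rule injD[OF emb_inj]) (simp add: emb_Rt A.scaleR Et.scaleR)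
  qed (simp add: n)
qed

lemma E_joint_continuous: "continuous_on UNIV (\<lambda>(t, x). E t x)"
proof (rule continuous_on_sequentiallyI)
  fix u :: "nat \<Rightarrow> real \<times> 'u \<times> 'w" and v assume u: "u \<longlonglongrightarrow> v"
  let ?x = "snd v" and ?t = "fst v"
  have ut: "(\<lambda>n. fst (u n)) \<longlonglongrightarrow> ?t" and ux: "(\<lambda>n. snd (u n)) \<longlonglongrightarrow> ?x"
    using tendsto_fst[OF u] tendsto_snd[OF u] by simp_all
  have "(\<lambda>n. E (fst (u n)) (snd (u n) - ?x)) \<longlonglongrightarrow> 0"
  proof (rule tendsto_norm_zero_cancel)
    have "(\<lambda>n. norm (snd (u n) - ?x)) \<longlonglongrightarrow> norm (?x - ?x)" by (intro tendsto_intros ux)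
    then show "(\<lambda>n. norm (E (fst (u n)) (snd (u n) - ?x))) \<longlonglongrightarrow> 0" by (simp add: E_isometry)
  qed
  moreover have "(\<lambda>n. E (fst (u n)) ?x) \<longlonglongrightarrow> E ?t ?x"
    using continuous_on_tendsto_compose[OF E_cont[of ?x] ut] by simp
  ultimately have "(\<lambda>n. E (fst (u n)) (snd (u n) - ?x) + E (fst (u n)) ?x) \<longlonglongrightarrow> 0 + E ?t ?x"
    by (rule tendsto_add)
  then show "(\<lambda>n. case u n of (t, x) \<Rightarrow> E t x) \<longlonglongrightarrow> (case v of (t, x) \<Rightarrow> E t x)"
    by (simp add: linear_diff[OF bounded_linear.linear[OF E_linear]] case_prod_beta')
qed

text \<open>Carried over from H through the isometry \<open>Aop\<close>.\<close>

lemma Rt_joint_continuous: "continuous_on UNIV (\<lambda>(t, k). Rt t k)"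
proof (rule continuous_on_sequentiallyI)
  fix u :: "nat \<Rightarrow> real \<times> 'v \<times> 'u" and v assume u: "u \<longlonglongrightarrow> v"
  let ?x = "snd v" and ?t = "fst v"
  interpret A: bounded_linear Aop by (rule Aop_bounded_linear)
  have ut: "(\<lambda>n. fst (u n)) \<longlonglongrightarrow> ?t" and ux: "(\<lambda>n. snd (u n)) \<longlonglongrightarrow> ?x"
    using tendsto_fst[OF u] tendsto_snd[OF u] by simp_all
  have "(\<lambda>n. E (fst (u n)) (Aop (snd (u n)))) \<longlonglongrightarrow> E ?t (Aop ?x)"
    using continuous_on_tendsto_compose[OF E_joint_continuous tendsto_Pair[OF ut A.tendsto[OF ux]]] by simp
  then have "(\<lambda>n. norm (E (fst (u n)) (Aop (snd (u n))) - E ?t (Aop ?x))) \<longlonglongrightarrow> 0"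
    using LIM_zero tendsto_norm_zero by blast
  moreover have "norm (E (fst (u n)) (Aop (snd (u n))) - E ?t (Aop ?x)) = norm (Rt (fst (u n)) (snd (u n)) - Rt ?t ?x)" for n
    by (simp flip: Aop_Rt A.diff add: norm_Aop)
  ultimately have "(\<lambda>n. norm (Rt (fst (u n)) (snd (u n)) - Rt ?t ?x)) \<longlonglongrightarrow> 0" by simp
  then show "(\<lambda>n. case u n of (t, x) \<Rightarrow> Rt t x) \<longlonglongrightarrow> (case v of (t, x) \<Rightarrow> Rt t x)"
    unfolding case_prod_beta' by (rule LIM_zero_cancel[OF tendsto_norm_zero_cancel])
qed

end

section \<open>The covariance operators and null controllability\<close>

lemma has_integral_bump:
  fixes a b :: real
  assumes "a < b"
  shows "((\<lambda>s. 6 * (s - a) * (b - s) / (b - a)^3) has_integral 1) {a..b}"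
proof -
  define c where "c = inverse ((b - a)^3)"
  \<comment> \<open>A primitive of the bump: the cubic 3 y^2 - 2 y^3 in y = (s - a) / (b -
    a).\<close>
  define P where "P s = (s - a)\<^sup>2 * (3 * (b - a) - 2 * (s - a)) * c" for s
  have "(P has_real_derivative 6 * (s - a) * (b - s) / (b - a)^3) (at s within {a..b})" for s
    unfolding P_def divide_inverse c_def[symmetric]
    by (auto intro!: derivative_eq_intros simp: power2_eq_square algebra_simps)
  then have "((\<lambda>s. 6 * (s - a) * (b - s) / (b - a)^3) has_integral (P b - P a)) {a..b}"
    using assms by (intro fundamental_theorem_of_calculus) (auto simp: has_real_derivative_iff_has_vector_derivative)
  moreover have "P b = 1"
  proof -
    have "(b - a)\<^sup>2 * (3 * (b - a) - 2 * (b - a)) = (b - a)^3" by (simp add: power2_eq_square power3_eq_cube)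
    then show ?thesis using assms by (simp add: P_def c_def)
  qed
  moreover have "P a = 0" by (simp add: P_def)
  ultimately show ?thesis by simp
qed

lemma pos_op_nonneg: "pos_op Q \<Longrightarrow> 0 \<le> Q x \<bullet> x"
  unfolding pos_op_def by blast

context wave_setting
begin

definition Gs :: "'u \<times> 'w \<Rightarrow> 'u" where "Gs = adjoint (GH j)"

text \<open>The adjoint of the map a -> E s (G a), applied to x; unitarity turns the adjoint of E s
  into E (-s).\<close>

definition W :: "real \<Rightarrow> 'u \<times> 'w \<Rightarrow> 'u" where "W s x = Gs (E (-s) x)"

text \<open>The covariance accumulated between the times a and b. Its quadratic form is additive
  over adjacent intervals (\<open>Qab_split\<close>).\<close>

definition Qab :: "real \<Rightarrow> real \<Rightarrow> 'u \<times> 'w \<Rightarrow> 'u \<times> 'w" where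
  "Qab a b x = (LINT s:{a..b}|lborel. E s (GH j (W s x)))"

lemma Qop_eq: "Qop j E r = Qab 0 r"
  unfolding Qop_def Qab_def W_def Gs_def adjoint_E ..

lemma GH_Gs: "GH j a \<bullet> x = a \<bullet> Gs x"
  unfolding Gs_def by (rule adjoint_works_hilbert[OF GH_bounded_linear])

lemma Gs_bounded_linear: "bounded_linear Gs"
  unfolding Gs_def by (rule bounded_linear_adjoint[OF GH_bounded_linear])

lemma W_bounded_linear: "bounded_linear (W s)"
  unfolding W_def by (rule bounded_linear_compose[OF Gs_bounded_linear E_linear])

lemma E_minus_cont: "continuous_on UNIV (\<lambda>s. E (-s) x)"
  by (rule continuous_on_compose2[OF E_cont, of _ uminus]) (auto intro: continuous_intros)

lemma W_cont: "continuous_on UNIV (\<lambda>s. W s x)"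
  unfolding W_def by (rule bounded_linear.continuous_on[OF Gs_bounded_linear E_minus_cont])

lemma EGW_cont: "continuous_on UNIV (\<lambda>s. E s (GH j (W s x)))"
proof -
  have "continuous_on UNIV (\<lambda>s. (s, GH j (W s x)))"
    by (intro continuous_intros bounded_linear.continuous_on[OF GH_bounded_linear] W_cont)
  then show ?thesis
    using continuous_on_compose2[OF E_joint_continuous, of UNIV "\<lambda>s. (s, GH j (W s x))"] by simp
qed

lemma W_inner_integrable: "(\<lambda>s. W s x \<bullet> W s y) integrable_on {a..b}"
  by (intro integrable_continuous_real continuous_intros continuous_on_subset[OF W_cont]) auto

lemma W_sq_integrable: "(\<lambda>s. (norm (W s x))\<^sup>2) integrable_on {a..b}"
  by (intro integrable_continuous_real continuous_intros continuous_on_subset[OF W_cont]) auto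

lemma Qab_inner: "Qab a b x \<bullet> y = integral {a..b} (\<lambda>s. W s x \<bullet> W s y)"
proof -
  have si: "set_integrable lborel {a..b} (\<lambda>s. E s (GH j (W s x)))"
    by (rule borel_integrable_atLeastAtMost') (rule continuous_on_subset[OF EGW_cont], simp)
  have si2: "set_integrable lborel {a..b} (\<lambda>s. W s x \<bullet> W s y)"
    by (rule borel_integrable_atLeastAtMost') (intro continuous_intros continuous_on_subset[OF W_cont], auto)
  have eq: "E s (GH j (W s x)) \<bullet> y = W s x \<bullet> W s y" for s
    by (simp add: E_adjoint GH_Gs W_def)
  have "Qab a b x \<bullet> y = (LINT s|lborel. (indicator {a..b} s *\<^sub>R E s (GH j (W s x))) \<bullet> y)"
    unfolding Qab_def set_lebesgue_integral_def
    by (rule integral_inner_left[symmetric]) (use si in \<open>simp add: set_integrable_def\<close>)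
  also have "\<dots> = (LINT s:{a..b}|lborel. W s x \<bullet> W s y)"
    unfolding set_lebesgue_integral_def by (simp add: eq)
  also have "\<dots> = integral {a..b} (\<lambda>s. W s x \<bullet> W s y)"
    by (rule set_borel_integral_eq_integral[OF si2])
  finally show ?thesis .
qed

lemma Qab_sq: "Qab a b x \<bullet> x = integral {a..b} (\<lambda>s. (norm (W s x))\<^sup>2)"
  by (simp add: Qab_inner power2_norm_eq_inner)

lemma Qab_split: "a \<le> b \<Longrightarrow> b \<le> c \<Longrightarrow> Qab a c x \<bullet> x = Qab a b x \<bullet> x + Qab b c x \<bullet> x"
  unfolding Qab_sq by (rule Henstock_Kurzweil_Integration.integral_combine[symmetric]) (auto intro: W_sq_integrable)

lemma Qab_pos_op:
  assumes ab: "a \<le> b"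
  shows "pos_op (Qab a b)"
  unfolding pos_op_def
proof (intro conjI allI)
  obtain c where c: "c > 0" "\<And>x. norm (Gs x) \<le> norm x * c"
    using bounded_linear.pos_bounded[OF Gs_bounded_linear] by blast
  have Wb: "norm (W s x) \<le> norm x * c" for s x
    using c(2)[of "E (-s) x"] by (simp add: W_def E_isometry)
  have add: "Qab a b (x + y) = Qab a b x + Qab a b y" for x y
  proof (rule vector_eq_rdot[THEN iffD1], rule allI)
    fix z
    show "Qab a b (x + y) \<bullet> z = (Qab a b x + Qab a b y) \<bullet> z"
      by (simp add: Qab_inner inner_add_left linear_add[OF bounded_linear.linear[OF W_bounded_linear]]
          Henstock_Kurzweil_Integration.integral_add[OF W_inner_integrable W_inner_integrable])
  qed
  have sc: "Qab a b (r *\<^sub>R x) = r *\<^sub>R Qab a b x" for r x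
  proof (rule vector_eq_rdot[THEN iffD1], rule allI)
    fix z
    show "Qab a b (r *\<^sub>R x) \<bullet> z = (r *\<^sub>R Qab a b x) \<bullet> z"
      by (simp add: Qab_inner linear_scale[OF bounded_linear.linear[OF W_bounded_linear]])
  qed
  have bnd: "\<bar>Qab a b x \<bullet> y\<bar> \<le> (c * c * (b - a)) * norm x * norm y" for x y
  proof -
    have "norm (integral {a..b} (\<lambda>s. W s x \<bullet> W s y)) \<le> ((norm x * c) * (norm y * c)) * (b - a)"
    proof (rule integral_bound)
      show "continuous_on {a..b} (\<lambda>s. W s x \<bullet> W s y)"
        by (intro continuous_intros continuous_on_subset[OF W_cont]) auto
      fix s
      have "\<bar>W s x \<bullet> W s y\<bar> \<le> norm (W s x) * norm (W s y)" by (rule Cauchy_Schwarz_ineq2)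
      also have "\<dots> \<le> (norm x * c) * (norm y * c)" using c by (intro mult_mono Wb) auto
      finally show "norm (W s x \<bullet> W s y) \<le> (norm x * c) * (norm y * c)" by simp
    qed fact
    then show ?thesis by (simp add: Qab_inner mult_ac)
  qed
  show "bounded_linear (Qab a b)"
  proof (rule bounded_linear_intro[OF add sc])
    fix x
    have "(norm (Qab a b x))\<^sup>2 \<le> (c * c * (b - a)) * norm x * norm (Qab a b x)"
      using bnd[of x "Qab a b x"] by (simp add: power2_norm_eq_inner)
    then show "norm (Qab a b x) \<le> norm x * (c * c * (b - a))"
      using c ab by (cases "Qab a b x = 0") (auto simp: power2_eq_square mult_ac)
  qed
  show "Qab a b x \<bullet> y = x \<bullet> Qab a b y" for x y
    unfolding inner_commute[of x] Qab_inner by (simp add: inner_commute)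
  show "0 \<le> Qab a b x \<bullet> x" for x
    unfolding Qab_sq by (rule Henstock_Kurzweil_Integration.integral_nonneg[OF W_sq_integrable]) simp
qed

text \<open>The sum over F is moved to U: exchanging the double sum and applying Bessel in H bounds
  it by the sum of |G u|^2 over a finite orthonormal set of U, and |G u|^2 = inv_into D L u . u. The
  nuclear representation of the inverse bounds the latter sum, with Cauchy-Schwarz and Bessel in
  each term.\<close>

lemma Gs_trace: "\<exists>\<tau>>0. \<forall>F. orthonormal F \<longrightarrow> (\<Sum>e\<in>F. (norm (Gs e))\<^sup>2) \<le> \<tau>"
proof -
  obtain a b :: "nat \<Rightarrow> 'u" where ab: "summable (\<lambda>n. norm (a n) * norm (b n))"
     "\<And>x. (\<lambda>n. (x \<bullet> a n) *\<^sub>R b n) sums inv_into D L x"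
    using L_inverse_trace_class unfolding trace_class_def by blast
  define \<tau> where "\<tau> = (\<Sum>n. norm (a n) * norm (b n))"
  have "(\<Sum>e\<in>F. (norm (Gs e))\<^sup>2) \<le> \<tau>" if F: "orthonormal F" for F
  proof -
    have fin: "finite F" using F by (simp add: orthonormal_def)
    obtain U0 where U0: "orthonormal U0" "\<And>e. e \<in> F \<Longrightarrow> (norm (Gs e))\<^sup>2 = (\<Sum>u\<in>U0. (Gs e \<bullet> u)\<^sup>2)"
      using orthonormal_parseval[of "Gs ` F"] fin by auto
    have fin0: "finite U0" using U0 by (simp add: orthonormal_def)
    have "(\<Sum>e\<in>F. (norm (Gs e))\<^sup>2) = (\<Sum>e\<in>F. \<Sum>u\<in>U0. (Gs e \<bullet> u)\<^sup>2)" using U0 by simp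
    also have "\<dots> = (\<Sum>u\<in>U0. \<Sum>e\<in>F. (GH j u \<bullet> e)\<^sup>2)"
      by (subst sum.swap) (simp only: GH_Gs inner_commute[of "Gs _" _])
    also have "\<dots> \<le> (\<Sum>u\<in>U0. (norm (GH j u))\<^sup>2)"
      by (intro sum_mono orthonormal_bessel F)
    also have "\<dots> = (\<Sum>u\<in>U0. inv_into D L u \<bullet> u)"
    proof (intro sum.cong refl)
      fix u
      have "(norm (GH j u))\<^sup>2 = j u \<bullet> j u" by (simp add: GH_def norm_Pair power2_norm_eq_inner)
      then show "(norm (GH j u))\<^sup>2 = inv_into D L u \<bullet> u" by (simp only: j_inner Si_inner inv_L)
    qed
    also have "\<dots> = (\<Sum>u\<in>U0. \<Sum>n. (u \<bullet> a n) * (b n \<bullet> u))"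
    proof (intro sum.cong refl)
      fix u
      have "(\<lambda>n. ((u \<bullet> a n) *\<^sub>R b n) \<bullet> u) sums (inv_into D L u \<bullet> u)"
        by (rule bounded_linear.sums[OF bounded_linear_inner_left ab(2)])
      then show "inv_into D L u \<bullet> u = (\<Sum>n. (u \<bullet> a n) * (b n \<bullet> u))"
        by (simp add: sums_iff)
    qed
    also have "\<dots> = (\<Sum>n. \<Sum>u\<in>U0. (u \<bullet> a n) * (b n \<bullet> u))"
    proof (rule suminf_sum[symmetric])
      fix u
      have "(\<lambda>n. ((u \<bullet> a n) *\<^sub>R b n) \<bullet> u) sums (inv_into D L u \<bullet> u)"
        by (rule bounded_linear.sums[OF bounded_linear_inner_left ab(2)])
      then show "summable (\<lambda>n. (u \<bullet> a n) * (b n \<bullet> u))" by (simp add: sums_iff)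
    qed
    also have "\<dots> \<le> \<tau>"
      unfolding \<tau>_def
    proof (rule suminf_le)
      have le: "\<bar>\<Sum>u\<in>U0. (u \<bullet> a n) * (b n \<bullet> u)\<bar> \<le> norm (a n) * norm (b n)" for n
      proof -
        have "(\<Sum>u\<in>U0. (u \<bullet> a n) * (b n \<bullet> u))\<^sup>2 \<le> (\<Sum>u\<in>U0. (a n \<bullet> u)\<^sup>2) * (\<Sum>u\<in>U0. (b n \<bullet> u)\<^sup>2)"
          using Cauchy_Schwarz_ineq_sum[of "\<lambda>u. u \<bullet> a n" "\<lambda>u. b n \<bullet> u" U0] by (simp add: inner_commute)
        also have "\<dots> \<le> (norm (a n))\<^sup>2 * (norm (b n))\<^sup>2"
          by (intro mult_mono orthonormal_bessel U0 sum_nonneg) auto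
        also have "\<dots> = (norm (a n) * norm (b n))\<^sup>2" by (simp add: power_mult_distrib)
        finally have "\<bar>\<Sum>u\<in>U0. (u \<bullet> a n) * (b n \<bullet> u)\<bar> \<le> \<bar>norm (a n) * norm (b n)\<bar>"
          using power2_le_iff_abs_le abs_le_square_iff by blast
        then show ?thesis by simp
      qed
      then show "(\<Sum>u\<in>U0. (u \<bullet> a n) * (b n \<bullet> u)) \<le> norm (a n) * norm (b n)" for n
        using abs_le_D1 by blast
      show "summable (\<lambda>n. \<Sum>u\<in>U0. (u \<bullet> a n) * (b n \<bullet> u))"
        by (rule summable_comparison_test'[OF ab(1), of 0]) (simp add: le)
    qed (rule ab)
    finally show ?thesis .
  qed
  then show ?thesis by (intro exI[of _ "\<bar>\<tau>\<bar> + 1"]) force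
qed

definition \<tau>0 :: real where
  "\<tau>0 = (SOME \<tau>. \<tau> > 0 \<and> (\<forall>F. orthonormal F \<longrightarrow> (\<Sum>e\<in>F. (norm (Gs e))\<^sup>2) \<le> \<tau>))"

lemma \<tau>0: "\<tau>0 > 0" "orthonormal F \<Longrightarrow> (\<Sum>e\<in>F. (norm (Gs e))\<^sup>2) \<le> \<tau>0"
  using someI_ex[OF Gs_trace, folded \<tau>0_def] by auto

text \<open>E (-s) maps orthonormal sets to orthonormal sets, so the trace bound for G holds at
  every time with the same constant.\<close>

lemma Qab_trace_le:
  assumes ab: "a \<le> b"
  shows "trace_le (Qab a b) ((b - a) * \<tau>0)"
  unfolding trace_le_def
proof (intro allI impI)
  fix F :: "('u \<times> 'w) set" assume F: "orthonormal F"
  then have fin: "finite F" by (simp add: orthonormal_def)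
  have le: "(\<Sum>e\<in>F. (norm (W s e))\<^sup>2) \<le> \<tau>0" for s
  proof -
    have inj: "inj_on (E (-s)) F" by (rule inj_on_inverseI[of _ "E s"]) simp
    have "orthonormal (E (-s) ` F)"
      using F by (auto simp: orthonormal_def E_isometry E_inner)
    then have "(\<Sum>e\<in>E (-s) ` F. (norm (Gs e))\<^sup>2) \<le> \<tau>0" by (rule \<tau>0)
    then show ?thesis using inj by (simp add: sum.reindex W_def)
  qed
  have "(\<Sum>e\<in>F. Qab a b e \<bullet> e) = integral {a..b} (\<lambda>s. \<Sum>e\<in>F. (norm (W s e))\<^sup>2)"
    unfolding Qab_sq by (rule Henstock_Kurzweil_Integration.integral_sum[symmetric]) (auto intro: fin W_sq_integrable)
  also have "\<dots> \<le> integral {a..b} (\<lambda>s. \<tau>0)"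
    by (intro integral_le integrable_sum W_sq_integrable integrable_const_ivl fin le)
  also have "\<dots> = (b - a) * \<tau>0" using ab by simp
  finally show "(\<Sum>e\<in>F. Qab a b e \<bullet> e) \<le> (b - a) * \<tau>0" .
qed

text \<open>
  Write \<open>exp((r - s)A) k = (p, q)\<close>, so that \<open>p' = - q\<close>, and let \<open>\<rho>\<close> be a bump of integral 1 vanishing at
  \<open>a\<close> and \<open>b\<close>. Integrating the derivative of \<open>exp(sA) (0, \<rho> p)\<close> over \<open>[a, b]\<close> shows that the control
  \<open>v = 2 \<rho> q - \<rho>' p\<close> steers to \<open>exp(rA) k\<close>.
\<close>

lemma control_estimate:
  assumes ab: "a < b"
    and q: "\<And>s. s \<in> {a..b} \<Longrightarrow> norm (snd (Rt (r - s) k)) \<le> Mq"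
    and p: "\<And>s. s \<in> {a..b} \<Longrightarrow> norm (i (fst (Rt (r - s) k))) \<le> Mp"
  shows "(E r (emb k) \<bullet> x)\<^sup>2 \<le> (3 * Mq / (b - a) + 6 * Mp / (b - a)\<^sup>2)\<^sup>2 * (b - a) * (Qab a b x \<bullet> x)"
proof -
  \<comment> \<open>A bound for the control v: the maximum of 2 \<rho> is 3 / (b - a) and that of
    the derivative of \<rho> is 6 / (b - a)^2.\<close>
  define V where "V = 3 * Mq / (b - a) + 6 * Mp / (b - a)\<^sup>2"
  define \<rho> where "\<rho> s = 6 * (s - a) * (b - s) / (b - a)^3" for s
  define \<rho>' where "\<rho>' s = 6 * (a + b - 2 * s) / (b - a)^3" for s
  define p where "p s = fst (E (r - s) (emb k))" for s
  define q where "q s = snd (Rt (r - s) k)" for s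
  define v where "v s = (2 * \<rho> s) *\<^sub>R q s - \<rho>' s *\<^sub>R p s" for s
  have Mq0: "Mq \<ge> 0" using order_trans[OF norm_ge_zero q[of a]] ab by simp
  have Mp0: "Mp \<ge> 0" using order_trans[OF norm_ge_zero p[of a]] ab by simp
  have p_eq: "p s = i (fst (Rt (r - s) k))" for s
    unfolding p_def emb_Rt[symmetric] by (simp add: map_prod_def case_prod_beta')
  have dE: "((\<lambda>s. E (r - s) (emb k)) has_vector_derivative - E (r - s) (Aop k)) (at s)" for s
  proof -
    have "((\<lambda>s. r - s) has_vector_derivative (-1)) (at s)" by (auto intro!: derivative_eq_intros)
    from vector_diff_chain_at[OF this E_emb_derivative[of k "r - s"]] show ?thesis by (simp add: o_def)
  qed
  have dp: "(p has_vector_derivative - q s) (at s)" for s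
  proof -
    have "(p has_vector_derivative fst (- E (r - s) (Aop k))) (at s)"
      unfolding p_def by (rule bounded_linear.has_vector_derivative[OF bounded_linear_fst dE])
    moreover have "fst (- E (r - s) (Aop k)) = - q s"
      unfolding q_def Aop_Rt[symmetric] by (simp add: Aop_def)
    ultimately show ?thesis by simp
  qed
  have d\<rho>: "(\<rho> has_vector_derivative \<rho>' s) (at s)" for s
    unfolding \<rho>_def \<rho>'_def has_real_derivative_iff_has_vector_derivative[symmetric] divide_inverse
    by (auto intro!: derivative_eq_intros simp: algebra_simps)
  define w where "w s = \<rho> s *\<^sub>R p s" for s
  define w' where "w' s = \<rho>' s *\<^sub>R p s - \<rho> s *\<^sub>R q s" for s
  have dw: "(w has_vector_derivative w' s) (at s)" for s
    using has_vector_derivative_scaleR[OF d\<rho>[unfolded has_real_derivative_iff_has_vector_derivative[symmetric]] dp, of s]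
    unfolding w_def[abs_def] w'_def by (simp add: algebra_simps)
  have vb: "norm (v s) \<le> V" if s: "s \<in> {a..b}" for s
  proof -
    have gen: "(6 * (d\<^sup>2 / 4)) / d^3 = 3 / 2 / d" "6 * d / d^3 = 6 / d\<^sup>2" if "d > 0" for d :: real
      using that by (simp_all add: field_simps power2_eq_square power3_eq_cube)
    have "(s - a) * (b - s) \<le> (b - a)\<^sup>2 / 4"
      using zero_le_power2[of "(s - a) - (b - s)"] by (simp add: power2_eq_square algebra_simps)
    then have "6 * (s - a) * (b - s) \<le> 6 * ((b - a)\<^sup>2 / 4)"
      by (metis mult.assoc mult_left_mono zero_le_numeral)
    then have "\<rho> s \<le> (6 * ((b - a)\<^sup>2 / 4)) / (b - a)^3"
      unfolding \<rho>_def using ab by (intro divide_right_mono) simp_all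
    also have "\<dots> = 3 / 2 / (b - a)" using gen(1)[of "b - a"] ab by simp
    finally have \<rho>1: "\<rho> s \<le> 3 / 2 / (b - a)" .
    have \<rho>0: "0 \<le> \<rho> s" unfolding \<rho>_def using s ab by simp
    have "\<bar>6 * (a + b - 2 * s)\<bar> \<le> 6 * (b - a)" using s by (auto simp: abs_le_iff)
    then have "\<bar>\<rho>' s\<bar> \<le> 6 * (b - a) / (b - a)^3"
      unfolding \<rho>'_def abs_divide using ab by (auto intro!: divide_right_mono)
    also have "\<dots> = 6 / (b - a)\<^sup>2" using gen(2)[of "b - a"] ab by simp
    finally have \<rho>2: "\<bar>\<rho>' s\<bar> \<le> 6 / (b - a)\<^sup>2" .
    have "norm (v s) \<le> (2 * \<rho> s) * norm (q s) + \<bar>\<rho>' s\<bar> * norm (p s)"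
      unfolding v_def using \<rho>0 by (intro order_trans[OF norm_triangle_ineq4]) simp
    also have "\<dots> \<le> (2 * (3 / 2 / (b - a))) * Mq + (6 / (b - a)\<^sup>2) * Mp"
      using \<rho>1 \<rho>2 \<rho>0 q[OF s] p[OF s] ab unfolding q_def p_eq
      by (intro add_mono mult_mono) auto
    also have "\<dots> = V" using ab by (simp add: V_def field_simps)
    finally show ?thesis .
  qed
  have V0: "V \<ge> 0" using order_trans[OF norm_ge_zero vb[of a]] ab by simp
  show ?thesis
  \<comment> \<open>For x in the range of \<open>emb\<close> the map s -> E (-s) x is
    differentiable; both sides are continuous in x, so density suffices.\<close>
  proof (rule dense_closed_UNIV[OF emb_dense])
    have bl: "bounded_linear (Qab a b)" using Qab_pos_op[of a b] ab unfolding pos_op_def by simp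
    show "closed {x. (E r (emb k) \<bullet> x)\<^sup>2 \<le> (3 * Mq / (b - a) + 6 * Mp / (b - a)\<^sup>2)\<^sup>2 * (b - a) * (Qab a b x \<bullet> x)}"
      by (intro closed_Collect_le continuous_intros linear_continuous_on bl)
    fix x assume "x \<in> range emb"
    then obtain k2 where k2: "x = emb k2" by auto
    define h where "h s = E (-s) x" for s
    define \<kappa> where "\<kappa> = E r (emb k) \<bullet> x"
    have dh: "(h has_vector_derivative - E (-s) (Aop k2)) (at s)" for s
    proof -
      have "((\<lambda>s. - s) has_vector_derivative (-1)) (at s)" by (auto intro!: derivative_eq_intros)
      from vector_diff_chain_at[OF this E_emb_derivative[of k2 "- s"]] show ?thesis unfolding h_def[abs_def] k2 by (simp add: o_def)
    qed
    have dG: "((\<lambda>s. GH j (w s)) has_vector_derivative GH j (w' s)) (at s)" for s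
      by (rule bounded_linear.has_vector_derivative[OF GH_bounded_linear dw])
    have df: "((\<lambda>s. GH j (w s) \<bullet> h s) has_vector_derivative (GH j (w s) \<bullet> (- E (-s) (Aop k2)) + GH j (w' s) \<bullet> h s)) (at s)" for s
      by (rule bounded_bilinear.has_vector_derivative[OF bounded_bilinear_inner dG dh])
    \<comment> \<open>By skew-symmetry the first term is (w s, 0) . h s, and by unitarity \<kappa> =
      (p s, 0) . h s + GH j (q s) . h s for every s. Integrated, the identity gives \<kappa> as the
      integral of v . W, because \<rho> has integral 1 and w vanishes at both ends.\<close>
    have key: "GH j (w s) \<bullet> (- E (-s) (Aop k2)) + GH j (w' s) \<bullet> h s = \<rho> s * \<kappa> - v s \<bullet> W s x" for s
    proof -
      interpret G: bounded_linear "GH j :: 'u \<Rightarrow> 'u \<times> 'w" by (rule GH_bounded_linear)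
      have "GH j (w s) \<bullet> E (-s) (Aop k2) = emb (GK (w s)) \<bullet> Aop (Rt (-s) k2)" by (simp add: emb_GK Aop_Rt)
      also have "\<dots> = - (Aop (GK (w s)) \<bullet> h s)"
        using Aop_skew[of "GK (w s)" "Rt (-s) k2"] unfolding h_def k2 emb_Rt by linarith
      also have "Aop (GK (w s)) = (w s, 0)"
        by (simp add: Aop_def GK_def linear_0[OF bounded_linear.linear[OF Lext_bounded]])
      finally have 1: "GH j (w s) \<bullet> (- E (-s) (Aop k2)) = (w s, 0) \<bullet> h s" by simp
      have "\<kappa> = E (- s) (E r (emb k)) \<bullet> E (- s) x" unfolding \<kappa>_def by (simp add: E_inner)
      also have "E (- s) (E r (emb k)) = E (r - s) (emb k)" using E_plus[of "-s" r "emb k"] by (simp add: add.commute)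
      also have "\<dots> = (p s, 0) + GH j (q s)"
        unfolding p_def q_def emb_Rt[symmetric] by (simp add: map_prod_def case_prod_beta' GH_def)
      finally have 2: "\<rho> s * \<kappa> = (w s, 0) \<bullet> h s + \<rho> s * (GH j (q s) \<bullet> h s)"
        by (simp add: h_def inner_add_left w_def distrib_left inner_prod_def)
      have 3: "v s \<bullet> W s x = 2 * \<rho> s * (GH j (q s) \<bullet> h s) - \<rho>' s * (GH j (p s) \<bullet> h s)"
        by (simp add: v_def W_def h_def GH_Gs inner_diff_left)
      have 4: "GH j (w' s) \<bullet> h s = \<rho>' s * (GH j (p s) \<bullet> h s) - \<rho> s * (GH j (q s) \<bullet> h s)"
        by (simp add: w'_def G.diff G.scaleR inner_diff_left)
      show ?thesis unfolding 1 2 3 4 by simp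
    qed
    have "((\<lambda>s. \<rho> s * \<kappa> - v s \<bullet> W s x) has_integral (GH j (w b) \<bullet> h b - GH j (w a) \<bullet> h a)) {a..b}"
      using ab df unfolding key by (intro fundamental_theorem_of_calculus) (auto intro: has_vector_derivative_at_within)
    moreover have "w a = 0" "w b = 0" by (simp_all add: w_def \<rho>_def)
    ultimately have 0: "((\<lambda>s. \<rho> s * \<kappa> - v s \<bullet> W s x) has_integral 0) {a..b}"
      using linear_0[OF bounded_linear.linear[OF GH_bounded_linear]] by simp
    have "((\<lambda>s. \<rho> s * \<kappa>) has_integral (1 * \<kappa>)) {a..b}"
      unfolding \<rho>_def by (rule has_integral_mult_left[OF has_integral_bump[OF ab]])
    from has_integral_diff[OF this 0] have hi: "((\<lambda>s. v s \<bullet> W s x) has_integral \<kappa>) {a..b}" by simp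
    have ci: "continuous_on {a..b} (\<lambda>s. norm (W s x))"
      by (intro continuous_intros continuous_on_subset[OF W_cont]) auto
    have "\<bar>\<kappa>\<bar> = norm (integral {a..b} (\<lambda>s. v s \<bullet> W s x))" using hi by (simp add: integral_unique)
    also have "\<dots> \<le> integral {a..b} (\<lambda>s. V * norm (W s x))"
    proof (rule integral_norm_bound_integral)
      show "(\<lambda>s. v s \<bullet> W s x) integrable_on {a..b}" using hi by blast
      show "(\<lambda>s. V * norm (W s x)) integrable_on {a..b}"
        by (intro integrable_continuous_real continuous_intros ci)
      fix s assume s: "s \<in> {a..b}"
      have "\<bar>v s \<bullet> W s x\<bar> \<le> norm (v s) * norm (W s x)" by (rule Cauchy_Schwarz_ineq2)
      also have "\<dots> \<le> V * norm (W s x)" by (intro mult_right_mono vb s) auto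
      finally show "norm (v s \<bullet> W s x) \<le> V * norm (W s x)" by simp
    qed
    also have "\<dots> = V * integral {a..b} (\<lambda>s. norm (W s x))" by simp
    finally have "\<bar>\<kappa>\<bar>\<^sup>2 \<le> (V * integral {a..b} (\<lambda>s. norm (W s x)))\<^sup>2" by (rule power_mono) simp
    also have "\<dots> = V\<^sup>2 * (integral {a..b} (\<lambda>s. norm (W s x)))\<^sup>2" by (simp add: power_mult_distrib)
    also have "\<dots> \<le> V\<^sup>2 * ((b - a) * integral {a..b} (\<lambda>s. (norm (W s x))\<^sup>2))"
      by (intro mult_left_mono integral_square_le ab ci) auto
    finally show "(E r (emb k) \<bullet> x)\<^sup>2 \<le> (3 * Mq / (b - a) + 6 * Mp / (b - a)\<^sup>2)\<^sup>2 * (b - a) * (Qab a b x \<bullet> x)"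
      by (simp add: V_def \<kappa>_def Qab_sq mult.assoc)
  qed
qed

text \<open>The position component of the orbit of G a starts at 0 with velocity at most |a|, so it
  is at most r |a| up to time r. This gains a factor r in the control over general k.\<close>

lemma control_G:
  assumes r: "r > 0"
  shows "(E r (GH j a) \<bullet> x)\<^sup>2 \<le> (900 / r) * (norm a)\<^sup>2 * (Qab 0 (r/2) x \<bullet> x)"
proof -
  have nq: "norm (snd (Rt t (GK a))) \<le> norm a" for t
    by (metis Rt_isometry norm_GK norm_snd_le prod.collapse)
  have np: "norm (i (fst (Rt t (GK a)))) \<le> t * norm a" if t: "t \<ge> 0" for t
  proof -
    define p where "p t = fst (E t (emb (GK a)))" for t
    have p_eq: "p t = i (fst (Rt t (GK a)))" for t
      unfolding p_def emb_Rt[symmetric] by (simp add: map_prod_def case_prod_beta')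
    have "(p has_vector_derivative fst (E t (Aop (GK a)))) (at t)" for t
      unfolding p_def by (rule bounded_linear.has_vector_derivative[OF bounded_linear_fst E_emb_derivative])
    then have dp: "(p has_vector_derivative snd (Rt t (GK a))) (at t)" for t
      unfolding Aop_Rt[symmetric] by (simp add: Aop_def)
    have "norm (p t - p 0) \<le> norm a * norm (t - 0)"
    proof (rule differentiable_bound[of UNIV p "\<lambda>t h. h *\<^sub>R snd (Rt t (GK a))"])
      show "(p has_derivative (\<lambda>h. h *\<^sub>R snd (Rt t (GK a)))) (at t within UNIV)" for t
        using dp[of t] by (simp add: has_vector_derivative_def)
      show "onorm (\<lambda>h. h *\<^sub>R snd (Rt t (GK a))) \<le> norm a" for t
        by (rule onorm_le) (use nq[of t] in \<open>auto simp: mult.commute[of "norm a"] intro!: mult_left_mono\<close>)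
    qed auto
    moreover have "p 0 = 0" by (simp add: p_def emb_GK) (simp add: GH_def)
    ultimately show ?thesis using t by (simp add: p_eq mult.commute)
  qed
  have "(E r (emb (GK a)) \<bullet> x)\<^sup>2 \<le> (3 * norm a / (r/2 - 0) + 6 * (r * norm a) / (r/2 - 0)\<^sup>2)\<^sup>2 * (r/2 - 0) * (Qab 0 (r/2) x \<bullet> x)"
  proof (rule control_estimate)
    fix s assume s: "s \<in> {0..r/2}"
    then show "norm (i (fst (Rt (r - s) (GK a)))) \<le> r * norm a"
      using r by (intro order_trans[OF np] mult_right_mono) auto
  qed (use r nq in auto)
  \<comment> \<open>6 / r + 24 / r = 30 / r, whose square times r / 2 is 450 / r; doubling it
    afterwards makes the square root of the constant 30 / sqrt r.\<close>
  also have "(3 * norm a / (r/2 - 0) + 6 * (r * norm a) / (r/2 - 0)\<^sup>2)\<^sup>2 * (r/2 - 0) = (450 / r) * (norm a)\<^sup>2"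
    using r by (simp add: field_simps power2_eq_square)
  also have "(450 / r) * (norm a)\<^sup>2 * (Qab 0 (r/2) x \<bullet> x) \<le> (900 / r) * (norm a)\<^sup>2 * (Qab 0 (r/2) x \<bullet> x)"
    using r by (intro mult_right_mono divide_right_mono pos_op_nonneg Qab_pos_op) auto
  finally show ?thesis by (simp add: emb_GK)
qed

text \<open>For general k the position component is only bounded by a multiple of |k|, so a control
  on an interval of length r / 2 has size r^(-2), and its squared L^2 norm in time has size
  r^(-3).\<close>

lemma control_K:
  "\<exists>c>0. \<forall>r x k. 0 < r \<longrightarrow> r \<le> T \<longrightarrow> (E r (emb k) \<bullet> x)\<^sup>2 \<le> (c / r powr (3/2))\<^sup>2 * (norm k)\<^sup>2 * (Qab (r/2) r x \<bullet> x)"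
proof -
  obtain ci where ci: "ci > 0" "\<And>v. norm (i v) \<le> norm v * ci"
    using bounded_linear.pos_bounded[OF i_bounded_linear] by blast
  \<comment> \<open>The coefficients 3 and 6 of \<open>control_estimate\<close>, divided by r / 2
    and by its square, give (6 r + 24 ci) / r^2.\<close>
  define c where "c = 6 * \<bar>T\<bar> + 24 * ci"
  have c0: "c > 0" using ci by (simp add: c_def add_nonneg_pos)
  have "(E r (emb k) \<bullet> x)\<^sup>2 \<le> (c / r powr (3/2))\<^sup>2 * (norm k)\<^sup>2 * (Qab (r/2) r x \<bullet> x)"
    if r: "0 < r" "r \<le> T" for r x k
  proof -
    have nq: "norm (snd (Rt t k)) \<le> norm k" for t
      by (metis Rt_isometry norm_snd_le prod.collapse)
    have nf: "norm (fst (Rt t k)) \<le> norm k" for t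
      by (metis Rt_isometry norm_fst_le prod.collapse)
    have np: "norm (i (fst (Rt t k))) \<le> norm k * ci" for t
      using ci(2)[of "fst (Rt t k)"] mult_right_mono[OF nf[of t], of ci] ci(1) by linarith
    have nn: "0 \<le> Qab (r/2) r x \<bullet> x" using r by (intro pos_op_nonneg Qab_pos_op) simp
    have "(E r (emb k) \<bullet> x)\<^sup>2 \<le> (3 * norm k / (r - r/2) + 6 * (norm k * ci) / (r - r/2)\<^sup>2)\<^sup>2 * (r - r/2) * (Qab (r/2) r x \<bullet> x)"
      by (rule control_estimate) (use r nq np in auto)
    also have "\<dots> \<le> ((c / r powr (3/2))\<^sup>2 * (norm k)\<^sup>2) * (Qab (r/2) r x \<bullet> x)"
    proof (rule mult_right_mono[OF _ nn])
      have "3 * norm k / (r - r/2) + 6 * (norm k * ci) / (r - r/2)\<^sup>2 = (6 * r + 24 * ci) * norm k / r\<^sup>2"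
        using r by (simp add: field_simps power2_eq_square)
      also have "\<dots> \<le> c * norm k / r\<^sup>2"
        using r by (intro divide_right_mono mult_right_mono) (auto simp: c_def)
      finally have "(3 * norm k / (r - r/2) + 6 * (norm k * ci) / (r - r/2)\<^sup>2)\<^sup>2 \<le> (c * norm k / r\<^sup>2)\<^sup>2"
        using r ci by (intro power_mono) auto
      then have "(3 * norm k / (r - r/2) + 6 * (norm k * ci) / (r - r/2)\<^sup>2)\<^sup>2 * (r - r/2) \<le> (c * norm k / r\<^sup>2)\<^sup>2 * r"
        using r by (intro mult_mono) auto
      also have "(c * norm k / r\<^sup>2)\<^sup>2 * r = c\<^sup>2 * (norm k)\<^sup>2 / r^3"
        using r by (simp add: field_simps power2_eq_square power3_eq_cube)
      also have "r^3 = (r powr (3/2))\<^sup>2"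
        using r by (simp add: powr_power)
      finally show "(3 * norm k / (r - r/2) + 6 * (norm k * ci) / (r - r/2)\<^sup>2)\<^sup>2 * (r - r/2) \<le> (c / r powr (3/2))\<^sup>2 * (norm k)\<^sup>2"
        by (simp add: power_divide)
    qed
    finally show ?thesis .
  qed
  then show ?thesis using c0 by blast
qed

end

section \<open>The Gaussian transition kernel\<close>

lemma gaussian_convolution:
  fixes Q :: "'a::{real_inner,second_countable_topology} \<Rightarrow> 'a"
  assumes g1: "is_centered_gaussian Q1 \<mu>1" and g2: "is_centered_gaussian Q2 \<mu>2" and g: "is_centered_gaussian Q \<mu>"
    and Q: "\<And>x. Q x \<bullet> x = Q1 x \<bullet> x + Q2 x \<bullet> x"
  shows "\<mu> = distr (\<mu>1 \<Otimes>\<^sub>M \<mu>2) borel (\<lambda>z. fst z + snd z)"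
proof (rule centered_gaussian_unique[OF g, of Q])
  have ps: "prob_space \<mu>1" "prob_space \<mu>2" and [measurable_cong]: "sets \<mu>1 = sets borel" "sets \<mu>2 = sets borel"
    using g1 g2 by (auto simp: is_centered_gaussian_def)
  interpret p1: prob_space \<mu>1 by fact
  interpret p2: prob_space \<mu>2 by fact
  interpret p: pair_prob_space \<mu>1 \<mu>2 ..
  show "is_centered_gaussian Q (distr (\<mu>1 \<Otimes>\<^sub>M \<mu>2) borel (\<lambda>z. fst z + snd z))"
    unfolding is_centered_gaussian_def
  proof (intro conjI allI)
    show "prob_space (distr (\<mu>1 \<Otimes>\<^sub>M \<mu>2) borel (\<lambda>z. fst z + snd z))" by (rule p.prob_space_distr) measurable
    fix h
    have i1: "integrable \<mu>1 (\<lambda>y. iexp (h \<bullet> y))" by (rule p1.integrable_const_bound[of _ 1]) auto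
    have i2: "integrable \<mu>2 (\<lambda>y. iexp (h \<bullet> y))" by (rule p2.integrable_const_bound[of _ 1]) auto
    have "(CLINT y|distr (\<mu>1 \<Otimes>\<^sub>M \<mu>2) borel (\<lambda>z. fst z + snd z). iexp (h \<bullet> y))
      = (CLINT z|(\<mu>1 \<Otimes>\<^sub>M \<mu>2). iexp (h \<bullet> fst z) * iexp (h \<bullet> snd z))"
      by (subst integral_distr) (auto simp: inner_add_right exp_add[symmetric] algebra_simps)
    also have "\<dots> = (CLINT y|\<mu>1. iexp (h \<bullet> y)) * (CLINT y|\<mu>2. iexp (h \<bullet> y))"
      by (rule integral_pair_product(2)[OF ps i1 i2])
    also have "\<dots> = complex_of_real (exp (- (Q1 h \<bullet> h) / 2)) * complex_of_real (exp (- (Q2 h \<bullet> h) / 2))"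
      using g1 g2 by (simp add: is_centered_gaussian_def)
    also have "\<dots> = complex_of_real (exp (- (Q h \<bullet> h) / 2))"
      unfolding of_real_mult[symmetric] exp_add[symmetric] Q by (simp add: field_simps)
    finally show "(CLINT y|distr (\<mu>1 \<Otimes>\<^sub>M \<mu>2) borel (\<lambda>z. fst z + snd z). iexp (h \<bullet> y)) = complex_of_real (exp (- (Q h \<bullet> h) / 2))" .
  qed simp
qed simp

section \<open>The Gaussian measures as a kernel in time\<close>

context wave_setting
begin

definition \<mu> :: "real \<Rightarrow> ('u \<times> 'w) measure" where "\<mu> r = centered_gaussian (Qab 0 r)"

lemma Qab_gaussian_exists:
  assumes "a \<le> b"
  shows "\<exists>\<nu>. is_centered_gaussian (Qab a b) \<nu> \<and> (\<integral>\<^sup>+y. ennreal ((norm y)\<^sup>2) \<partial>\<nu>) \<le> ennreal ((b - a) * \<tau>0)"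
  by (rule centered_gaussian_exists[OF Qab_pos_op[OF assms] Qab_trace_le[OF assms]])

lemma \<mu>_gaussian: "r \<ge> 0 \<Longrightarrow> is_centered_gaussian (Qab 0 r) (\<mu> r)"
  using Qab_gaussian_exists[of 0 r] centered_gaussian_eqI unfolding \<mu>_def by metis

lemma \<mu>_prob: "r \<ge> 0 \<Longrightarrow> prob_space (\<mu> r)" and sets_\<mu>: "r \<ge> 0 \<Longrightarrow> sets (\<mu> r) = sets borel"
  using \<mu>_gaussian[of r] by (auto simp: is_centered_gaussian_def)

text \<open>The measure at time r1 is the one at r0 convolved with the Gaussian of covariance
  \<open>Qab r0 r1\<close>, whose mean norm is at most the square root of its second moment. This
  continuity is the way to measurability in time.\<close>

lemma \<mu>_lipschitz:
  fixes f :: "'u \<times> 'w \<Rightarrow> real"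
  assumes r: "0 \<le> r0" "r0 \<le> r1" and [measurable]: "f \<in> borel_measurable borel"
    and fb: "\<And>x. \<bar>f x\<bar> \<le> M" and fL: "\<And>x y. \<bar>f (x + y) - f x\<bar> \<le> K * norm y" and K: "K \<ge> 0"
  shows "\<bar>(\<integral>y. f y \<partial>\<mu> r1) - (\<integral>y. f y \<partial>\<mu> r0)\<bar> \<le> K * sqrt ((r1 - r0) * \<tau>0)"
proof -
  obtain \<nu> where \<nu>: "is_centered_gaussian (Qab r0 r1) \<nu>" "(\<integral>\<^sup>+y. ennreal ((norm y)\<^sup>2) \<partial>\<nu>) \<le> ennreal ((r1 - r0) * \<tau>0)"
    using Qab_gaussian_exists[OF r(2)] by blast
  have ps: "prob_space (\<mu> r0)" "prob_space \<nu>" and [measurable_cong]: "sets (\<mu> r0) = sets borel" "sets \<nu> = sets borel"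
    using \<nu> \<mu>_prob[of r0] sets_\<mu>[of r0] r by (auto simp: is_centered_gaussian_def)
  interpret p1: prob_space "\<mu> r0" by fact
  interpret p2: prob_space \<nu> by fact
  interpret p: pair_prob_space "\<mu> r0" \<nu> ..
  have "\<mu> r1 = distr (\<mu> r0 \<Otimes>\<^sub>M \<nu>) borel (\<lambda>z. fst z + snd z)"
    by (rule gaussian_convolution[OF \<mu>_gaussian[OF r(1)] \<nu>(1) \<mu>_gaussian[OF order_trans[OF r]] Qab_split[OF r]])
  then have 1: "(\<integral>y. f y \<partial>\<mu> r1) = (\<integral>z. f (fst z + snd z) \<partial>(\<mu> r0 \<Otimes>\<^sub>M \<nu>))"
    by (simp add: integral_distr)
  have i0: "integrable (\<mu> r0) f" by (rule p1.integrable_const_bound[of _ M]) (auto simp: fb)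
  have 2: "(\<integral>y. f y \<partial>\<mu> r0) = (\<integral>z. f (fst z) \<partial>(\<mu> r0 \<Otimes>\<^sub>M \<nu>))"
    using integral_pair_product(2)[OF ps i0, of "\<lambda>_. 1"] p2.prob_space by simp
  have i1: "integrable (\<mu> r0 \<Otimes>\<^sub>M \<nu>) (\<lambda>z. f (fst z + snd z))" "integrable (\<mu> r0 \<Otimes>\<^sub>M \<nu>) (\<lambda>z. f (fst z))"
    by (rule p.integrable_const_bound[of _ M]; auto simp: fb)+
  have n2: "integrable \<nu> (\<lambda>y. (norm y)\<^sup>2)"
  proof (rule integrableI_bounded)
    have "(\<integral>\<^sup>+y. ennreal ((norm y)\<^sup>2) \<partial>\<nu>) < \<infinity>" using \<nu>(2) by (rule le_less_trans) simp
    then show "(\<integral>\<^sup>+y. ennreal (norm ((norm y)\<^sup>2)) \<partial>\<nu>) < \<infinity>" by simp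
  qed measurable
  have n2b: "(\<integral>y. (norm y)\<^sup>2 \<partial>\<nu>) \<le> (r1 - r0) * \<tau>0"
    using \<nu>(2) nn_integral_eq_integral[OF n2] r \<tau>0(1) by (simp add: ennreal_le_iff)
  have n1: "integrable \<nu> (\<lambda>y. norm y)" "(\<integral>y. norm y \<partial>\<nu>)\<^sup>2 \<le> (\<integral>y. (norm y)\<^sup>2 \<partial>\<nu>)"
    using Cauchy_Schwarz_integral[of "\<lambda>y. norm y" \<nu> "\<lambda>_. 1"] n2 p2.prob_space by auto
  have n1b: "(\<integral>y. norm y \<partial>\<nu>) \<le> sqrt ((r1 - r0) * \<tau>0)"
    by (rule real_le_rsqrt) (use n1 n2b in linarith)
  have i3: "integrable (\<mu> r0 \<Otimes>\<^sub>M \<nu>) (\<lambda>z. norm (snd z))" "(\<integral>z. norm (snd z) \<partial>(\<mu> r0 \<Otimes>\<^sub>M \<nu>)) = (\<integral>y. norm y \<partial>\<nu>)"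
    using integral_pair_product[OF ps _ n1(1), of "\<lambda>_. 1"] p1.prob_space by auto
  have "\<bar>(\<integral>y. f y \<partial>\<mu> r1) - (\<integral>y. f y \<partial>\<mu> r0)\<bar> = norm (\<integral>z. f (fst z + snd z) - f (fst z) \<partial>(\<mu> r0 \<Otimes>\<^sub>M \<nu>))"
    unfolding 1 2 using i1 by simp
  also have "\<dots> \<le> (\<integral>z. K * norm (snd z) \<partial>(\<mu> r0 \<Otimes>\<^sub>M \<nu>))"
    using i1 i3(1) fL by (intro order_trans[OF integral_norm_bound integral_mono]) auto
  also have "\<dots> = K * (\<integral>y. norm y \<partial>\<nu>)" by (simp add: i3)
  also have "\<dots> \<le> K * sqrt ((r1 - r0) * \<tau>0)" by (intro mult_left_mono n1b K)
  finally show ?thesis .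
qed

text \<open>Clipping at 0 extends the family constantly to negative times, so that continuity can be
  stated on the whole line.\<close>

lemma \<mu>_continuous:
  fixes f :: "'u \<times> 'w \<Rightarrow> real"
  assumes f[measurable]: "f \<in> borel_measurable borel"
    and fb: "\<And>x. \<bar>f x\<bar> \<le> M" and fL: "\<And>x y. \<bar>f (x + y) - f x\<bar> \<le> K * norm y" and K: "K \<ge> 0"
  shows "continuous_on UNIV (\<lambda>r. \<integral>y. f y \<partial>\<mu> (max 0 r))"
proof (rule continuous_on_sequentiallyI)
  fix u :: "nat \<Rightarrow> real" and a assume u: "u \<longlonglongrightarrow> a"
  have le: "\<bar>(\<integral>y. f y \<partial>\<mu> (max 0 s)) - (\<integral>y. f y \<partial>\<mu> (max 0 r))\<bar> \<le> K * sqrt (\<bar>max 0 s - max 0 r\<bar> * \<tau>0)" for r s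
  proof (cases "r \<le> s")
    case True
    then show ?thesis using \<mu>_lipschitz[of "max 0 r" "max 0 s", OF _ _ f fb fL K] by simp
  next
    case False
    then show ?thesis using \<mu>_lipschitz[of "max 0 s" "max 0 r", OF _ _ f fb fL K] by (simp add: abs_minus_commute)
  qed
  have "(\<lambda>n. K * sqrt (\<bar>max 0 (u n) - max 0 a\<bar> * \<tau>0)) \<longlonglongrightarrow> K * sqrt (\<bar>max 0 a - max 0 a\<bar> * \<tau>0)"
    by (intro tendsto_intros u)
  then have "(\<lambda>n. K * sqrt (\<bar>max 0 (u n) - max 0 a\<bar> * \<tau>0)) \<longlonglongrightarrow> 0" by simp
  then have "(\<lambda>n. (\<integral>y. f y \<partial>\<mu> (max 0 (u n))) - (\<integral>y. f y \<partial>\<mu> (max 0 a))) \<longlonglongrightarrow> 0"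
    by (rule Lim_null_comparison[rotated]) (simp add: le)
  then show "(\<lambda>n. \<integral>y. f y \<partial>\<mu> (max 0 (u n))) \<longlonglongrightarrow> (\<integral>y. f y \<partial>\<mu> (max 0 a))"
    by (rule LIM_zero_cancel)
qed

text \<open>Open sets generate, and the indicator of an open set is the limit of truncated multiples
  of the distance to its complement. These are Lipschitz, so their integrals are continuous in
  time.\<close>

lemma \<mu>_kernel: "(\<lambda>r. \<mu> (max 0 r)) \<in> borel \<rightarrow>\<^sub>M subprob_algebra borel"
proof (rule measurable_prob_algebraD, rule measurable_prob_algebra_generated[where G = "{S. open S}" and \<Omega> = UNIV])
  show "sets borel = sigma_sets UNIV {S :: ('u \<times> 'w) set. open S}" by (simp add: borel_def)
  show "Int_stable {S :: ('u \<times> 'w) set. open S}" by (auto simp: Int_stable_def)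
  show "{S :: ('u \<times> 'w) set. open S} \<subseteq> Pow UNIV" by auto
  show "prob_space (\<mu> (max 0 a))" for a by (rule \<mu>_prob) simp
  show "sets (\<mu> (max 0 a)) = sets borel" for a by (rule sets_\<mu>) simp
  fix A :: "('u \<times> 'w) set" assume "A \<in> {S. open S}"
  then have A: "open A" by simp
  show "(\<lambda>a. emeasure (\<mu> (max 0 a)) A) \<in> borel_measurable borel"
  \<comment> \<open>Treated separately because \<open>infdist\<close> to the empty set is 0.\<close>
  proof (cases "A = UNIV")
    case True
    have "emeasure (\<mu> (max 0 a)) A = 1" for a
      using prob_space.emeasure_space_1[OF \<mu>_prob[of "max 0 a"]] sets_eq_imp_space_eq[OF sets_\<mu>[of "max 0 a"]] True by simp
    then show ?thesis by simp
  next
    case False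
    define f where "f n x = min 1 (real n * infdist x (- A))" for n and x :: "'u \<times> 'w"
    have fm: "f n \<in> borel_measurable borel" for n
      unfolding f_def by (intro borel_measurable_continuous_onI continuous_intros)
    have fb: "\<bar>f n x\<bar> \<le> 1" for n x by (simp add: f_def infdist_nonneg)
    have fL: "\<bar>f n (x + y) - f n x\<bar> \<le> real n * norm y" for n x y
    proof -
      have "\<bar>f n (x + y) - f n x\<bar> \<le> \<bar>real n * infdist (x + y) (-A) - real n * infdist x (-A)\<bar>"
        unfolding f_def by linarith
      also have "\<dots> = real n * \<bar>infdist (x + y) (-A) - infdist x (-A)\<bar>"
        by (simp add: abs_mult flip: right_diff_distrib)
      also have "\<dots> \<le> real n * norm y"
        using infdist_triangle_abs[of "x + y" "-A" x] by (intro mult_left_mono) (auto simp: dist_norm)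
      finally show ?thesis .
    qed
    have [measurable]: "(\<lambda>r. \<integral>y. f n y \<partial>\<mu> (max 0 r)) \<in> borel_measurable borel" for n
      by (intro borel_measurable_continuous_onI \<mu>_continuous[OF fm fb fL]) simp
    have lim: "(\<lambda>n. f n x) \<longlonglongrightarrow> indicator A x" for x
    proof (cases "x \<in> A")
      case True
      have d: "infdist x (-A) > 0"
        using True in_closed_iff_infdist_zero[of "-A" x] A False infdist_nonneg[of x "-A"] by (auto simp: closed_def less_le)
      obtain N where N: "1 / infdist x (-A) < real N" using reals_Archimedean2 by blast
      have "\<forall>n\<ge>N. f n x = 1"
      proof (intro allI impI)
        fix n assume "n \<ge> N"
        then have "1 / infdist x (-A) \<le> real n" using N by linarith
        then show "f n x = 1" using d by (simp add: f_def field_simps min_def)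
      qed
      then have "\<forall>\<^sub>F n in sequentially. f n x = 1" unfolding eventually_sequentially by blast
      then show ?thesis using True by (simp add: tendsto_eventually)
    next
      case False
      then show ?thesis by (simp add: f_def)
    qed
    have "(\<lambda>n. \<integral>y. f n y \<partial>\<mu> (max 0 r)) \<longlonglongrightarrow> (\<integral>y. indicator A y \<partial>\<mu> (max 0 r))" for r
    proof -
      interpret prob_space "\<mu> (max 0 r)" by (rule \<mu>_prob) simp
      have [measurable_cong]: "sets (\<mu> (max 0 r)) = sets borel" by (rule sets_\<mu>) simp
      have [measurable]: "A \<in> sets borel" using A by simp
      note fm[measurable]
      show ?thesis
        by (rule integral_dominated_convergence[where w = "\<lambda>_. 1"]) (auto simp: lim fb)
    qed
    then have "(\<lambda>r. \<integral>y. indicator A y \<partial>\<mu> (max 0 r) :: real) \<in> borel_measurable borel"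
      by (rule borel_measurable_LIMSEQ_metric[rotated]) measurable
    moreover have "emeasure (\<mu> (max 0 r)) A = ennreal (\<integral>y. indicator A y \<partial>\<mu> (max 0 r))" for r
    proof -
      interpret prob_space "\<mu> (max 0 r)" by (rule \<mu>_prob) simp
      show ?thesis using A sets_\<mu>[of "max 0 r"] sets_eq_imp_space_eq[OF sets_\<mu>[of "max 0 r"]] by (simp add: emeasure_eq_measure)
    qed
    ultimately show ?thesis by simp
  qed
qed

text \<open>The integrand also depends on r, so the kernel is first pushed forward to the law of the
  pair (r, y), against which a fixed F is integrated.\<close>

lemma \<mu>_integral_measurable:
  fixes F :: "real \<times> 'u \<times> 'w \<Rightarrow> 'k::{banach,second_countable_topology}"
  assumes F[measurable]: "F \<in> borel_measurable borel"
  shows "(\<lambda>r. \<integral>y. F (r, y) \<partial>\<mu> (max 0 r)) \<in> borel_measurable borel"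
proof -
  note [measurable] = \<mu>_kernel
  have "(\<lambda>r. distr (\<mu> (max 0 r)) borel (\<lambda>y. (r, y))) \<in> borel \<rightarrow>\<^sub>M subprob_algebra borel"
  proof (rule measurable_distr2[where M = borel])
    have "(\<lambda>z. z) \<in> borel \<Otimes>\<^sub>M borel \<rightarrow>\<^sub>M (borel :: (real \<times> 'u \<times> 'w) measure)"
      unfolding borel_prod by (rule measurable_ident_sets) simp
    then show "(\<lambda>(r, y). (r, y)) \<in> borel \<Otimes>\<^sub>M borel \<rightarrow>\<^sub>M (borel :: (real \<times> 'u \<times> 'w) measure)"
      by (simp add: case_prod_unfold)
  qed (rule \<mu>_kernel)
  then have "(\<lambda>r. integral\<^sup>L (distr (\<mu> (max 0 r)) borel (\<lambda>y. (r, y))) F) \<in> borel_measurable borel"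
    by (rule measurable_compose[OF _ integral_measurable_subprob_algebra[OF F]])
  moreover have "integral\<^sup>L (distr (\<mu> (max 0 r)) borel (\<lambda>y. (r, y))) F = (\<integral>y. F (r, y) \<partial>\<mu> (max 0 r))" for r
  proof -
    have [measurable_cong]: "sets (\<mu> (max 0 r)) = sets borel" by (rule sets_\<mu>) simp
    have "(\<lambda>y. (r, y)) \<in> borel_measurable (\<mu> (max 0 r))"
      by (intro borel_measurable_Pair) auto
    then show ?thesis by (rule integral_distr) fact
  qed
  ultimately show ?thesis by simp
qed

lemma Rsg_eq: "Rsg j E r \<Phi> x = (\<integral>y. \<Phi> (E r x + y) \<partial>\<mu> r)"
  by (simp add: Rsg_def Qop_eq \<mu>_def)

lemma Rsg_norm_le:
  fixes \<Phi> :: "'u \<times> 'w \<Rightarrow> 'k::{banach,second_countable_topology}"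
  assumes r: "r \<ge> 0" and M: "\<And>y. norm (\<Phi> y) \<le> M"
  shows "norm (Rsg j E r \<Phi> x) \<le> M"
proof -
  interpret prob_space "\<mu> r" by (rule \<mu>_prob[OF r])
  have M0: "M \<ge> 0" using M[of 0] norm_ge_zero order_trans by blast
  show ?thesis
  proof (cases "integrable (\<mu> r) (\<lambda>y. \<Phi> (E r x + y))")
    case True
    have "norm (Rsg j E r \<Phi> x) \<le> (\<integral>y. M \<partial>\<mu> r)"
      unfolding Rsg_eq using M True by (intro order_trans[OF integral_norm_bound integral_mono]) auto
    then show ?thesis by (simp add: prob_space)
  next
    case False
    \<comment> \<open>A non-integrable function has Bochner integral 0, and M is
      nonnegative.\<close>
    then show ?thesis using M0 by (simp add: Rsg_eq not_integrable_integral_eq)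
  qed
qed

lemma Rsg_integrable:
  fixes \<Phi> :: "'u \<times> 'w \<Rightarrow> 'k::{banach,second_countable_topology}"
  assumes r: "r \<ge> 0" and [measurable]: "\<Phi> \<in> borel_measurable borel" and M: "\<And>y. norm (\<Phi> y) \<le> M"
  shows "integrable (\<mu> r) (\<lambda>y. \<Phi> (x + y))"
proof -
  interpret prob_space "\<mu> r" by (rule \<mu>_prob[OF r])
  have [measurable_cong]: "sets (\<mu> r) = sets borel" by (rule sets_\<mu>[OF r])
  show ?thesis by (rule integrable_const_bound[of _ M]) (auto simp: M)
qed

text \<open>Translating x by z translates the data by E r z. A Hoelder function can thus enter
  through its increment, which is bounded by the seminorm times a power of |z|, by
  unitarity.\<close>

lemma Rsg_translate_diff:
  fixes \<Phi> :: "'u \<times> 'w \<Rightarrow> 'k::{banach,second_countable_topology}"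
  assumes r: "r \<ge> 0" and \<Phi>: "\<Phi> \<in> borel_measurable borel" and M: "\<And>y. norm (\<Phi> y) \<le> M"
  shows "Rsg j E r (\<lambda>y. \<Phi> (y + E r z) - \<Phi> y) x = Rsg j E r \<Phi> (x + z) - Rsg j E r \<Phi> x"
proof -
  interpret E: bounded_linear "E r" by (rule E_linear)
  have "Rsg j E r (\<lambda>y. \<Phi> (y + E r z) - \<Phi> y) x = (\<integral>y. \<Phi> ((E r x + E r z) + y) - \<Phi> (E r x + y) \<partial>\<mu> r)"
    unfolding Rsg_eq by (simp add: ac_simps)
  then show ?thesis
    unfolding Rsg_eq E.add using Rsg_integrable[OF r \<Phi> M] by simp
qed

end

section \<open>Elementary inequalities and interpolation by halving\<close>

lemma exp_square_minus_one_le: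
  fixes c :: real
  assumes "0 \<le> c" "c \<le> 1"
  shows "exp (c\<^sup>2) - 1 \<le> (2 * c)\<^sup>2"
proof -
  have c2: "c\<^sup>2 \<le> 1" using assms by (simp add: power_le_one)
  have "exp (c\<^sup>2) \<le> 1 + c\<^sup>2 + (c\<^sup>2)\<^sup>2" by (rule exp_bound) (use c2 in auto)
  moreover have "(c\<^sup>2)\<^sup>2 \<le> c\<^sup>2" using mult_left_mono[OF c2, of "c\<^sup>2"] by (simp add: power2_eq_square)
  ultimately show ?thesis
    using zero_le_power2[of c] unfolding power_mult_distrib by (simp only: power2_eq_square)
qed

lemma bessel_family:
  fixes f :: "nat \<Rightarrow> 'a::real_inner"
  assumes "finite F" "\<And>m. m \<in> F \<Longrightarrow> norm (f m) = 1" "\<And>m n. m \<in> F \<Longrightarrow> n \<in> F \<Longrightarrow> m \<noteq> n \<Longrightarrow> f m \<bullet> f n = 0"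
  shows "(\<Sum>m\<in>F. (v \<bullet> f m)\<^sup>2) \<le> (norm v)\<^sup>2"
proof -
  have inj: "inj_on f F"
  proof (rule inj_onI)
    fix m n assume mn: "m \<in> F" "n \<in> F" "f m = f n"
    show "m = n"
    proof (rule ccontr)
      assume "m \<noteq> n"
      then have "f m \<bullet> f m = 0" using assms(3)[of m n] mn by simp
      then show False using assms(2)[of m] mn by simp
    qed
  qed
  have "orthonormal (f ` F)"
    using assms by (auto simp: orthonormal_def)
  from orthonormal_bessel[OF this, of v] show ?thesis by (simp add: sum.reindex[OF inj])
qed

text \<open>Interpolation: \<open>n\<close> stands for the size of a difference quotient with increment \<open>\<epsilon>\<close>.
  Downward halving keeps \<open>n \<epsilon> \<le> K \<epsilon> - \<kappa> \<epsilon>\<^sup>1\<^sup>+\<^sup>\<alpha>\<close> invariant.\<close>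

lemma halving_interpolation:
  fixes n :: "real \<Rightarrow> real"
  assumes \<alpha>: "1/2 \<le> \<alpha>" "\<alpha> < 1" and A: "A \<ge> 0" and \<eta>: "\<eta> > 0"
    and n1: "\<And>\<epsilon>. \<epsilon> > 0 \<Longrightarrow> n \<epsilon> \<le> A * \<epsilon> powr \<alpha>"
    and n2: "\<And>\<epsilon>. 0 < \<epsilon> \<Longrightarrow> \<epsilon> \<le> \<eta> \<Longrightarrow> n \<epsilon> \<le> n (2 * \<epsilon>) / 2 + (A / \<eta>) * \<epsilon> powr (1 + \<alpha>)"
    and \<epsilon>: "\<epsilon> > 0"
  shows "n \<epsilon> \<le> 6 * A * \<eta> powr (\<alpha> - 1) * \<epsilon>"
proof (cases "\<epsilon> > \<eta>")
  case True
  have "\<epsilon> powr (\<alpha> - 1) \<le> \<eta> powr (\<alpha> - 1)" using True \<eta> \<alpha> by (intro powr_mono2') auto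
  moreover have "\<epsilon> powr \<alpha> = \<epsilon> powr (\<alpha> - 1) * \<epsilon>" using \<epsilon> by (simp add: powr_diff)
  ultimately have "n \<epsilon> \<le> A * (\<eta> powr (\<alpha> - 1) * \<epsilon>)"
    using n1[OF \<epsilon>] A \<epsilon> by (metis mult_left_mono mult_right_mono order_trans less_imp_le)
  also have "\<dots> \<le> 6 * (A * (\<eta> powr (\<alpha> - 1) * \<epsilon>))" using A \<epsilon> by simp
  finally show ?thesis by (simp add: mult_ac)
next
  case False
  \<comment> \<open>6 = 2 + 4 collects the two terms of the base case. The value \<kappa> = 4 A /
    \<eta> makes \<kappa> (2^\<alpha> - 1) >= A / \<eta>, because 2^\<alpha> >= sqrt 2 >= 5/4; here
    \<alpha> >= 1/2 enters.\<close>
  define K where "K = 6 * A * \<eta> powr (\<alpha> - 1)"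
  define \<kappa> where "\<kappa> = 4 * A / \<eta>"
  have \<kappa>0: "\<kappa> \<ge> 0" using A \<eta> by (simp add: \<kappa>_def)
  \<comment> \<open>The index p runs through the dyadic shells below \<eta>; doubling \<epsilon>
    moves one shell up.\<close>
  have claim: "n \<epsilon> \<le> K * \<epsilon> - \<kappa> * \<epsilon> powr (1 + \<alpha>)" if "\<eta> / 2 ^ Suc p < \<epsilon>" "\<epsilon> \<le> \<eta> / 2 ^ p" for p \<epsilon>
    using that
  proof (induction p arbitrary: \<epsilon>)
    case 0
    then have e: "\<eta> / 2 < \<epsilon>" "\<epsilon> \<le> \<eta>" "0 < \<epsilon>" using \<eta> by auto
    have "\<epsilon> powr (\<alpha> - 1) \<le> (\<eta> / 2) powr (\<alpha> - 1)" using e \<eta> \<alpha> by (intro powr_mono2') auto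
    also have "\<dots> = \<eta> powr (\<alpha> - 1) * 2 powr (1 - \<alpha>)"
      using \<eta> by (simp add: powr_divide powr_diff field_simps)
    also have "\<dots> \<le> \<eta> powr (\<alpha> - 1) * 2"
      using \<alpha> powr_mono[of "1 - \<alpha>" 1 2] by (intro mult_left_mono) auto
    finally have 1: "\<epsilon> powr (\<alpha> - 1) \<le> \<eta> powr (\<alpha> - 1) * 2" .
    have "\<epsilon> powr \<alpha> \<le> \<eta> powr \<alpha>" using e \<alpha> by (intro powr_mono2) auto
    then have 2: "\<kappa> * \<epsilon> powr \<alpha> \<le> 4 * A * \<eta> powr (\<alpha> - 1)"
      using A \<eta> mult_left_mono[of "\<epsilon> powr \<alpha>" "\<eta> powr \<alpha>" "\<kappa>"] \<kappa>0 by (simp add: \<kappa>_def powr_diff)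
    have "A * \<epsilon> powr (\<alpha> - 1) + \<kappa> * \<epsilon> powr \<alpha> \<le> K"
      using mult_left_mono[OF 1 A] 2 by (simp add: K_def)
    then have "(A * \<epsilon> powr (\<alpha> - 1) + \<kappa> * \<epsilon> powr \<alpha>) * \<epsilon> \<le> K * \<epsilon>" using e by (intro mult_right_mono) auto
    moreover have "\<epsilon> powr (\<alpha> - 1) * \<epsilon> = \<epsilon> powr \<alpha>" "\<epsilon> powr \<alpha> * \<epsilon> = \<epsilon> powr (1 + \<alpha>)"
      using e by (simp_all add: powr_diff powr_add)
    ultimately have "A * \<epsilon> powr \<alpha> + \<kappa> * \<epsilon> powr (1 + \<alpha>) \<le> K * \<epsilon>"
      by (simp add: distrib_right mult.assoc)
    then show ?case using n1[OF e(3)] by linarith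
  next
    case (Suc p)
    have e0: "0 < \<epsilon>" using Suc.prems(1) \<eta> by (meson divide_pos_pos less_trans zero_less_numeral zero_less_power)
    have "\<epsilon> \<le> \<eta> / 2 ^ Suc p" by (rule Suc.prems)
    also have "\<dots> \<le> \<eta> / 1" using \<eta> one_le_power[of "2::real" "Suc p"] by (intro divide_left_mono) auto
    finally have e1: "\<epsilon> \<le> \<eta>" by simp
    have IH: "n (2 * \<epsilon>) \<le> K * (2 * \<epsilon>) - \<kappa> * (2 * \<epsilon>) powr (1 + \<alpha>)"
      using Suc.prems by (intro Suc.IH) (auto simp: field_simps)
    have p2: "(2 * \<epsilon>) powr (1 + \<alpha>) = 2 * 2 powr \<alpha> * \<epsilon> powr (1 + \<alpha>)"
      using e0 by (simp add: powr_mult powr_add)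
    have "(5/4)\<^sup>2 \<le> (2::real)" by (simp add: power2_eq_square)
    then have "5/4 \<le> sqrt (2::real)" by (rule real_le_rsqrt)
    also have "\<dots> = 2 powr (1/2)" by (simp add: powr_half_sqrt)
    also have "\<dots> \<le> 2 powr \<alpha>" using \<alpha> by (intro powr_mono) auto
    finally have "\<kappa> * (5/4) \<le> \<kappa> * 2 powr \<alpha>" using \<kappa>0 by (intro mult_left_mono)
    then have "\<kappa> + A / \<eta> \<le> \<kappa> * 2 powr \<alpha>" by (simp add: \<kappa>_def)
    then have "(\<kappa> + A / \<eta>) * \<epsilon> powr (1 + \<alpha>) \<le> (\<kappa> * 2 powr \<alpha>) * \<epsilon> powr (1 + \<alpha>)"
      by (intro mult_right_mono) auto
    then have "\<kappa> * \<epsilon> powr (1 + \<alpha>) + A / \<eta> * \<epsilon> powr (1 + \<alpha>) \<le> \<kappa> * 2 powr \<alpha> * \<epsilon> powr (1 + \<alpha>)"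
      by (simp only: distrib_right)
    moreover have "n \<epsilon> \<le> (K * (2 * \<epsilon>) - \<kappa> * (2 * 2 powr \<alpha> * \<epsilon> powr (1 + \<alpha>))) / 2 + (A / \<eta>) * \<epsilon> powr (1 + \<alpha>)"
      by (rule order_trans[OF n2[OF e0 e1] add_right_mono[OF divide_right_mono[OF IH[unfolded p2]]]]) simp
    moreover have "(K * (2 * \<epsilon>) - \<kappa> * (2 * 2 powr \<alpha> * \<epsilon> powr (1 + \<alpha>))) / 2 = K * \<epsilon> - \<kappa> * 2 powr \<alpha> * \<epsilon> powr (1 + \<alpha>)"
      by (simp add: diff_divide_distrib)
    ultimately show ?case by linarith
  qed
  obtain p where p: "\<eta> / 2 ^ Suc p < \<epsilon>" "\<epsilon> \<le> \<eta> / 2 ^ p"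
  proof -
    have "\<exists>p. \<eta> / 2 ^ Suc p < \<epsilon>"
    proof -
      obtain q where "(1/2::real) ^ q < \<epsilon> / \<eta>" using real_arch_pow_inv[of "\<epsilon> / \<eta>" "1/2"] \<epsilon> \<eta> by auto
      then have "\<eta> / 2 ^ q < \<epsilon>" using \<eta> by (simp add: power_divide field_simps)
      moreover have "\<eta> / 2 ^ Suc q \<le> \<eta> / 2 ^ q" using \<eta> by (intro divide_left_mono) auto
      ultimately show ?thesis by (meson le_less_trans)
    qed
    define q where "q = (LEAST p. \<eta> / 2 ^ Suc p < \<epsilon>)"
    have q1: "\<eta> / 2 ^ Suc q < \<epsilon>" unfolding q_def by (rule LeastI_ex) fact
    have q2: "\<epsilon> \<le> \<eta> / 2 ^ q"
    proof (cases q)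
      case 0
      then show ?thesis using False by simp
    next
      case (Suc q')
      then have "\<not> \<eta> / 2 ^ Suc q' < \<epsilon>" using not_less_Least[of q' "\<lambda>p. \<eta> / 2 ^ Suc p < \<epsilon>"] unfolding q_def by simp
      then show ?thesis using Suc by simp
    qed
    show ?thesis using that q1 q2 by blast
  qed
  have "n \<epsilon> \<le> K * \<epsilon> - \<kappa> * \<epsilon> powr (1 + \<alpha>)" by (rule claim[OF p])
  also have "\<dots> \<le> K * \<epsilon>" using \<kappa>0 by simp
  finally show ?thesis by (simp add: K_def)
qed

section \<open>Smoothing estimates for the transition semigroup\<close>

context wave_setting
begin

text \<open>Names the constant of \<open>control_K\<close>, so that it is chosen once and enters the
  final constant explicitly.\<close>

definition control_const :: "real \<Rightarrow> real \<Rightarrow> bool" where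
  "control_const T c \<longleftrightarrow> c > 0 \<and> (\<forall>r x k. 0 < r \<longrightarrow> r \<le> T \<longrightarrow>
     (E r (emb k) \<bullet> x)\<^sup>2 \<le> (c / r powr (3/2))\<^sup>2 * (norm k)\<^sup>2 * (Qab (r/2) r x \<bullet> x))"

lemma Rsg_inner:
  fixes \<Phi> :: "'u \<times> 'w \<Rightarrow> 'k::{real_inner,banach,second_countable_topology}"
  assumes "r \<ge> 0" "\<Phi> \<in> borel_measurable borel" "\<And>y. norm (\<Phi> y) \<le> M"
  shows "Rsg j E r \<Phi> x \<bullet> v = (\<integral>y. \<Phi> (E r x + y) \<bullet> v \<partial>\<mu> r)"
  unfolding Rsg_eq by (rule integral_inner_left[symmetric]) (use Rsg_integrable[OF assms] in blast)

text \<open>Dividing E r (G a) and E r (emb k) by the constants of the control estimates gives b1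
  and b2 dominated by the covariances of the two halves of [0, r], which together make up Q. In
  these units the shifts have lengths c1 and c2.\<close>

lemma Rsg_shift_estimates:
  fixes \<Phi> :: "'u \<times> 'w \<Rightarrow> 'k::{real_inner,banach,second_countable_topology}"
    and \<delta> \<epsilon> :: real and a :: 'u and k :: "'v \<times> 'u" and v :: 'k and x :: "'u \<times> 'w"
  assumes c: "control_const T c" and r: "0 < r" "r \<le> T"
    and \<Phi>[measurable]: "\<Phi> \<in> borel_measurable borel" and M: "\<And>y. norm (\<Phi> y) \<le> M"
  defines "c1 \<equiv> \<delta> * (30 / sqrt r * norm a)" and "c2 \<equiv> \<epsilon> * (c / r powr (3/2) * norm k)"
    and "I \<equiv> (\<integral>y. (\<Phi> (E r x + y) \<bullet> v)\<^sup>2 \<partial>\<mu> r)"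
  shows "((Rsg j E r \<Phi> (x + \<delta> *\<^sub>R GH j a) - Rsg j E r \<Phi> x) \<bullet> v)\<^sup>2 \<le> (exp (c1\<^sup>2) - 1) * I"
    and "((Rsg j E r \<Phi> (x + \<delta> *\<^sub>R GH j a + \<epsilon> *\<^sub>R emb k) - Rsg j E r \<Phi> (x + \<delta> *\<^sub>R GH j a)
           - Rsg j E r \<Phi> (x + \<epsilon> *\<^sub>R emb k) + Rsg j E r \<Phi> x) \<bullet> v)\<^sup>2 \<le> (exp (c1\<^sup>2) - 1) * (exp (c2\<^sup>2) - 1) * I"
proof -
  have r0: "r \<ge> 0" using r by simp
  interpret E: bounded_linear "E r" by (rule E_linear)
  define l1 where "l1 = 30 / sqrt r * norm a"
  define l2 where "l2 = c / r powr (3/2) * norm k"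
  define b1 where "b1 = (1 / l1) *\<^sub>R E r (GH j a)"
  define b2 where "b2 = (1 / l2) *\<^sub>R E r (emb k)"
  have cpos: "c > 0" using c by (simp add: control_const_def)
  have l1sq: "l1\<^sup>2 = (900 / r) * (norm a)\<^sup>2" using r by (simp add: l1_def power_mult_distrib power_divide)
  have s1: "(b1 \<bullet> x)\<^sup>2 \<le> Qab 0 (r/2) x \<bullet> x" for x
  \<comment> \<open>For a = 0 the length \<open>l1\<close> is 0, and division by it gives b1 =
    0.\<close>
  proof (cases "a = 0")
    case True
    then show ?thesis using pos_op_nonneg[OF Qab_pos_op[of 0 "r/2"]] r by (simp add: b1_def l1_def)
  next
    case False
    then have l: "l1 > 0" using r by (simp add: l1_def)
    have "(b1 \<bullet> x)\<^sup>2 = (E r (GH j a) \<bullet> x)\<^sup>2 / l1\<^sup>2" by (simp add: b1_def power_divide)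
    also have "\<dots> \<le> (l1\<^sup>2 * (Qab 0 (r/2) x \<bullet> x)) / l1\<^sup>2"
      unfolding l1sq by (intro divide_right_mono control_G r) (use r in auto)
    also have "\<dots> = Qab 0 (r/2) x \<bullet> x" using l by simp
    finally show ?thesis .
  qed
  have s2: "(b2 \<bullet> x)\<^sup>2 \<le> Qab (r/2) r x \<bullet> x" for x
  proof (cases "k = 0")
    case True
    then show ?thesis using pos_op_nonneg[OF Qab_pos_op[of "r/2" r]] r by (simp add: b2_def l2_def)
  next
    case False
    then have l: "l2 > 0" using r cpos by (simp add: l2_def)
    have "(b2 \<bullet> x)\<^sup>2 = (E r (emb k) \<bullet> x)\<^sup>2 / l2\<^sup>2" by (simp add: b2_def power_divide)
    also have "\<dots> \<le> (l2\<^sup>2 * (Qab (r/2) r x \<bullet> x)) / l2\<^sup>2"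
    proof (rule divide_right_mono)
      show "(E r (emb k) \<bullet> x)\<^sup>2 \<le> l2\<^sup>2 * (Qab (r/2) r x \<bullet> x)"
        using c r unfolding control_const_def l2_def power_mult_distrib by blast
    qed simp
    also have "\<dots> = Qab (r/2) r x \<bullet> x" using l by simp
    finally show ?thesis .
  qed
  have s: "(b1 \<bullet> x)\<^sup>2 + (b2 \<bullet> x)\<^sup>2 \<le> Qab 0 r x \<bullet> x" for x
    using s1[of x] s2[of x] Qab_split[of 0 "r/2" r x] r by simp
  have e1: "c1 *\<^sub>R b1 = \<delta> *\<^sub>R E r (GH j a)"
  proof (cases "a = 0")
    case True
    then show ?thesis
      by (simp add: b1_def linear_0[OF bounded_linear.linear[OF GH_bounded_linear]] E.zero)
  next
    case False
    then show ?thesis using r by (simp add: b1_def c1_def l1_def)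
  qed
  have e2: "c2 *\<^sub>R b2 = \<epsilon> *\<^sub>R E r (emb k)"
  proof (cases "k = 0")
    case True
    then show ?thesis
      using linear_0[OF bounded_linear.linear[OF emb_bounded_linear]] by (simp add: b2_def E.zero)
  next
    case False
    then show ?thesis using r cpos by (simp add: b2_def c2_def l2_def)
  qed
  define \<phi> where "\<phi> y = \<Phi> (E r x + y) \<bullet> v" for y
  have \<phi>m: "\<phi> \<in> borel_measurable borel" unfolding \<phi>_def by measurable
  have \<phi>b: "\<bar>\<phi> y\<bar> \<le> M * norm v" for y
    unfolding \<phi>_def using Cauchy_Schwarz_ineq2[of "\<Phi> (E r x + y)" v] mult_right_mono[OF M, of "norm v"] order_trans
    by (metis norm_ge_zero)
  have J: "(\<integral>y. \<phi> (d1 *\<^sub>R b1 + d2 *\<^sub>R b2 + y) \<partial>\<mu> r) = Rsg j E r \<Phi> z \<bullet> v"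
    if "E r z = E r x + (d1 *\<^sub>R b1 + d2 *\<^sub>R b2)" for d1 d2 z
    unfolding Rsg_inner[OF r0 \<Phi> M] that \<phi>_def by (simp add: add.assoc)
  have j00: "(\<integral>y. \<phi> (0 *\<^sub>R b1 + 0 *\<^sub>R b2 + y) \<partial>\<mu> r) = Rsg j E r \<Phi> x \<bullet> v" by (rule J) simp
  have j10: "(\<integral>y. \<phi> (c1 *\<^sub>R b1 + 0 *\<^sub>R b2 + y) \<partial>\<mu> r) = Rsg j E r \<Phi> (x + \<delta> *\<^sub>R GH j a) \<bullet> v"
    by (rule J) (simp add: e1 E.add E.scaleR)
  have j01: "(\<integral>y. \<phi> (0 *\<^sub>R b1 + c2 *\<^sub>R b2 + y) \<partial>\<mu> r) = Rsg j E r \<Phi> (x + \<epsilon> *\<^sub>R emb k) \<bullet> v"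
    by (rule J) (simp add: e2 E.add E.scaleR)
  have j11: "(\<integral>y. \<phi> (c1 *\<^sub>R b1 + c2 *\<^sub>R b2 + y) \<partial>\<mu> r) = Rsg j E r \<Phi> (x + \<delta> *\<^sub>R GH j a + \<epsilon> *\<^sub>R emb k) \<bullet> v"
    by (rule J) (simp add: e1 e2 E.add E.scaleR)
  have I: "I = (\<integral>y. (\<phi> y)\<^sup>2 \<partial>\<mu> r)" by (simp add: I_def \<phi>_def)
  note est = gaussian_shift_estimates[OF Qab_pos_op[OF r0] Qab_trace_le[OF r0] \<mu>_gaussian[OF r0] s \<phi>m \<phi>b]
  show "((Rsg j E r \<Phi> (x + \<delta> *\<^sub>R GH j a) - Rsg j E r \<Phi> x) \<bullet> v)\<^sup>2 \<le> (exp (c1\<^sup>2) - 1) * I"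
    using est(1)[of c1] unfolding j00 j10 I inner_diff_left .
  show "((Rsg j E r \<Phi> (x + \<delta> *\<^sub>R GH j a + \<epsilon> *\<^sub>R emb k) - Rsg j E r \<Phi> (x + \<delta> *\<^sub>R GH j a)
           - Rsg j E r \<Phi> (x + \<epsilon> *\<^sub>R emb k) + Rsg j E r \<Phi> x) \<bullet> v)\<^sup>2 \<le> (exp (c1\<^sup>2) - 1) * (exp (c2\<^sup>2) - 1) * I"
    using est(2)[of c1 c2] unfolding j00 j10 j01 j11 I inner_diff_left inner_add_left .
qed

text \<open>The third bound is Bessel's inequality under the integral sign. It does not depend on
  the number of components: this is where the cardinality of F disappears.\<close>

lemma sq_integral_le:
  fixes \<Phi> :: "'u \<times> 'w \<Rightarrow> 'k::{real_inner,banach,second_countable_topology}"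
  assumes r: "r \<ge> 0" and [measurable]: "\<Phi> \<in> borel_measurable borel" and M: "\<And>y. norm (\<Phi> y) \<le> M"
  shows "integrable (\<mu> r) (\<lambda>y. (\<Phi> (x + y) \<bullet> v)\<^sup>2)"
    and "(\<integral>y. (\<Phi> (x + y) \<bullet> v)\<^sup>2 \<partial>\<mu> r) \<le> (M * norm v)\<^sup>2"
    and "finite F \<Longrightarrow> (\<And>m. m \<in> F \<Longrightarrow> norm (f m) = 1) \<Longrightarrow> (\<And>m n. m \<in> F \<Longrightarrow> n \<in> F \<Longrightarrow> m \<noteq> n \<Longrightarrow> f m \<bullet> f n = 0)
      \<Longrightarrow> (\<Sum>m\<in>F. \<integral>y. (\<Phi> (x + y) \<bullet> (f :: nat \<Rightarrow> 'k) m)\<^sup>2 \<partial>\<mu> r) \<le> M\<^sup>2"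
proof -
  interpret prob_space "\<mu> r" by (rule \<mu>_prob[OF r])
  have [measurable_cong]: "sets (\<mu> r) = sets borel" by (rule sets_\<mu>[OF r])
  have b: "\<bar>\<Phi> (x + y) \<bullet> v\<bar> \<le> M * norm v" for y v
    using Cauchy_Schwarz_ineq2[of "\<Phi> (x + y)" v] mult_right_mono[OF M, of "norm v"] order_trans
    by (metis norm_ge_zero)
  have b2: "(\<Phi> (x + y) \<bullet> v)\<^sup>2 \<le> (M * norm v)\<^sup>2" for y v
    using power_mono[OF b, where n = 2] by simp
  show i: "integrable (\<mu> r) (\<lambda>y. (\<Phi> (x + y) \<bullet> v)\<^sup>2)" for v
    by (rule integrable_const_bound[of _ "(M * norm v)\<^sup>2"]) (auto simp: b2)
  have "(\<integral>y. (\<Phi> (x + y) \<bullet> v)\<^sup>2 \<partial>\<mu> r) \<le> (\<integral>y. (M * norm v)\<^sup>2 \<partial>\<mu> r)"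
    by (intro integral_mono i b2) auto
  then show "(\<integral>y. (\<Phi> (x + y) \<bullet> v)\<^sup>2 \<partial>\<mu> r) \<le> (M * norm v)\<^sup>2" by (simp add: prob_space)
  assume F: "finite F" "\<And>m. m \<in> F \<Longrightarrow> norm (f m) = 1" "\<And>m n. m \<in> F \<Longrightarrow> n \<in> F \<Longrightarrow> m \<noteq> n \<Longrightarrow> f m \<bullet> f n = 0"
  have "(\<Sum>m\<in>F. \<integral>y. (\<Phi> (x + y) \<bullet> f m)\<^sup>2 \<partial>\<mu> r) = (\<integral>y. (\<Sum>m\<in>F. (\<Phi> (x + y) \<bullet> f m)\<^sup>2) \<partial>\<mu> r)"
    by (rule Bochner_Integration.integral_sum[symmetric]) (rule i)
  also have "\<dots> \<le> (\<integral>y. M\<^sup>2 \<partial>\<mu> r)"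
  proof (intro integral_mono Bochner_Integration.integrable_sum i)
    fix y
    have "(\<Sum>m\<in>F. (\<Phi> (x + y) \<bullet> f m)\<^sup>2) \<le> (norm (\<Phi> (x + y)))\<^sup>2" by (rule bessel_family) (fact F)+
    also have "\<dots> \<le> M\<^sup>2" by (intro power_mono M) simp
    finally show "(\<Sum>m\<in>F. (\<Phi> (x + y) \<bullet> f m)\<^sup>2) \<le> M\<^sup>2" .
  qed simp
  finally show "(\<Sum>m\<in>F. \<integral>y. (\<Phi> (x + y) \<bullet> f m)\<^sup>2 \<partial>\<mu> r) \<le> M\<^sup>2" by (simp add: prob_space)
qed

text \<open>Testing the difference w with v = w turns the scalar estimate into one for the norm. For
  c1 > 1 the trivial bound 2 M is already below 2 c1 M.\<close>

lemma Rsg_first_difference: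
  fixes \<Phi> :: "'u \<times> 'w \<Rightarrow> 'k::{real_inner,banach,second_countable_topology}"
  assumes r: "0 < r" and \<Phi>: "\<Phi> \<in> borel_measurable borel" and M: "\<And>y. norm (\<Phi> y) \<le> M" and \<delta>: "\<delta> \<ge> 0"
  shows "norm (Rsg j E r \<Phi> (x + \<delta> *\<^sub>R GH j a) - Rsg j E r \<Phi> x) \<le> 60 * M * norm a * \<delta> / sqrt r"
proof -
  obtain c where c: "control_const r c" using control_K[of r] unfolding control_const_def by blast
  have r0: "r \<ge> 0" using r by simp
  define c1 where "c1 = \<delta> * (30 / sqrt r * norm a)"
  have c10: "c1 \<ge> 0" using \<delta> r by (simp add: c1_def)
  have M0: "M \<ge> 0" using order_trans[OF norm_ge_zero M] .
  let ?w = "Rsg j E r \<Phi> (x + \<delta> *\<^sub>R GH j a) - Rsg j E r \<Phi> x"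
  have "norm ?w \<le> 2 * c1 * M"
  proof (cases "c1 \<le> 1")
    case True
    have "(?w \<bullet> ?w)\<^sup>2 \<le> (exp (c1\<^sup>2) - 1) * (\<integral>y. (\<Phi> (E r x + y) \<bullet> ?w)\<^sup>2 \<partial>\<mu> r)"
      unfolding c1_def by (rule Rsg_shift_estimates(1)[OF c r order_refl \<Phi> M])
    also have "\<dots> \<le> (2 * c1)\<^sup>2 * (M * norm ?w)\<^sup>2"
      by (intro mult_mono exp_square_minus_one_le c10 True sq_integral_le(2)[OF r0 \<Phi> M]) auto
    also have "\<dots> = (2 * c1 * M * norm ?w)\<^sup>2" by (simp add: power_mult_distrib)
    finally have "?w \<bullet> ?w \<le> 2 * c1 * M * norm ?w"
      by (rule power2_le_imp_le) (use c10 M0 in simp)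
    then have "norm ?w * norm ?w \<le> 2 * c1 * M * norm ?w" by (simp add: dot_square_norm power2_eq_square)
    then show ?thesis using c10 M0 by (cases "?w = 0") auto
  next
    case False
    have "norm ?w \<le> M + M"
      by (intro order_trans[OF norm_triangle_ineq4] add_mono Rsg_norm_le[OF r0 M])
    also have "\<dots> \<le> 2 * c1 * M" using False M0 mult_right_mono[of 1 c1 M] by simp
    finally show ?thesis .
  qed
  also have "2 * c1 * M = 60 * M * norm a * \<delta> / sqrt r" by (simp add: c1_def)
  finally show ?thesis .
qed

text \<open>\<open>Rsg_first_difference\<close> applied to the increment of \<Phi> between two
  translates, whose sup norm the Hoelder bound controls.\<close>

lemma Rsg_first_difference_holder:
  fixes \<Phi> :: "'u \<times> 'w \<Rightarrow> 'k::{real_inner,banach,second_countable_topology}"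
  assumes r: "0 < r" and \<Phi>[measurable]: "\<Phi> \<in> borel_measurable borel" and M: "\<And>y. norm (\<Phi> y) \<le> M" and \<delta>: "\<delta> \<ge> 0"
    and N: "\<And>y y'. norm (\<Phi> y - \<Phi> y') \<le> N * norm (y - y') powr \<alpha>"
  shows "norm ((Rsg j E r \<Phi> (x' + \<delta> *\<^sub>R GH j a) - Rsg j E r \<Phi> x') - (Rsg j E r \<Phi> (x + \<delta> *\<^sub>R GH j a) - Rsg j E r \<Phi> x))
     \<le> 60 * (N * norm (x' - x) powr \<alpha>) * norm a * \<delta> / sqrt r"
proof -
  have r0: "r \<ge> 0" using r by simp
  define \<Psi> where "\<Psi> y = \<Phi> (y + E r (x' - x)) - \<Phi> y" for y
  have \<Psi>: "\<Psi> \<in> borel_measurable borel" unfolding \<Psi>_def by measurable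
  have \<Psi>b: "norm (\<Psi> y) \<le> N * norm (x' - x) powr \<alpha>" for y
    unfolding \<Psi>_def using N[of "y + E r (x' - x)" y] by (simp add: E_isometry)
  have tr: "Rsg j E r \<Psi> z = Rsg j E r \<Phi> (z + (x' - x)) - Rsg j E r \<Phi> z" for z
    unfolding \<Psi>_def by (rule Rsg_translate_diff[OF r0 \<Phi> M])
  have "norm (Rsg j E r \<Psi> (x + \<delta> *\<^sub>R GH j a) - Rsg j E r \<Psi> x) \<le> 60 * (N * norm (x' - x) powr \<alpha>) * norm a * \<delta> / sqrt r"
    by (rule Rsg_first_difference[OF r \<Psi> \<Psi>b \<delta>])
  then show ?thesis unfolding tr by (simp add: algebra_simps)
qed

definition sdiff :: "real \<Rightarrow> ('u \<times> 'w \<Rightarrow> 'v \<times> 'u) \<Rightarrow> 'u \<times> 'w \<Rightarrow> real \<Rightarrow> 'u \<Rightarrow> real \<Rightarrow> 'v \<times> 'u \<Rightarrow> 'v \<times> 'u" where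
  "sdiff r \<Phi> x \<delta> a \<epsilon> k = Rsg j E r \<Phi> (x + \<delta> *\<^sub>R GH j a + \<epsilon> *\<^sub>R emb k) - Rsg j E r \<Phi> (x + \<delta> *\<^sub>R GH j a)
           - Rsg j E r \<Phi> (x + \<epsilon> *\<^sub>R emb k) + Rsg j E r \<Phi> x"

text \<open>The direction \<open>a m\<close> may change with m: each component is estimated by the
  integral of its own squared component of \<Phi>, and only these integrals are summed. The
  smallness conditions linearise exp (c^2) - 1.\<close>

lemma Rsg_difference_L2:
  fixes \<Phi> :: "'u \<times> 'w \<Rightarrow> 'v \<times> 'u" and f :: "nat \<Rightarrow> 'v \<times> 'u"
  assumes c: "control_const T c" and r: "0 < r" "r \<le> T"
    and \<Phi>: "\<Phi> \<in> borel_measurable borel" and M: "\<And>y. norm (\<Phi> y) \<le> M"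
    and F: "finite F" "\<And>m. m \<in> F \<Longrightarrow> norm (f m) = 1" "\<And>m n. m \<in> F \<Longrightarrow> n \<in> F \<Longrightarrow> m \<noteq> n \<Longrightarrow> f m \<bullet> f n = 0"
    and a: "\<And>m. norm (a m) = 1" and \<delta>: "0 \<le> \<delta>" "\<delta> * (30 / sqrt r) \<le> 1"
  shows "L2_set (\<lambda>m. (Rsg j E r \<Phi> (x + \<delta> *\<^sub>R GH j (a m)) - Rsg j E r \<Phi> x) \<bullet> f m) F \<le> 2 * (\<delta> * (30 / sqrt r)) * M"
    and "0 \<le> \<epsilon> \<Longrightarrow> \<epsilon> * (c / r powr (3/2) * norm k) \<le> 1 \<Longrightarrow>
       L2_set (\<lambda>m. sdiff r \<Phi> x \<delta> (a m) \<epsilon> k \<bullet> f m) F \<le> 2 * (\<delta> * (30 / sqrt r)) * (2 * (\<epsilon> * (c / r powr (3/2) * norm k))) * M"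
proof -
  have r0: "r \<ge> 0" using r by simp
  have M0: "M \<ge> 0" using order_trans[OF norm_ge_zero M] .
  have cpos: "c > 0" using c by (simp add: control_const_def)
  define c1 where "c1 = \<delta> * (30 / sqrt r)"
  have c1: "0 \<le> c1" "c1 \<le> 1" using \<delta> r by (auto simp: c1_def)
  define I where "I m = (\<integral>y. (\<Phi> (E r x + y) \<bullet> f m)\<^sup>2 \<partial>\<mu> r)" for m
  have I: "(\<Sum>m\<in>F. I m) \<le> M\<^sup>2" "0 \<le> I m" for m
    unfolding I_def using sq_integral_le(3)[OF r0 \<Phi> M F] by auto
  have "(\<Sum>m\<in>F. ((Rsg j E r \<Phi> (x + \<delta> *\<^sub>R GH j (a m)) - Rsg j E r \<Phi> x) \<bullet> f m)\<^sup>2) \<le> (\<Sum>m\<in>F. (2 * c1)\<^sup>2 * I m)"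
  proof (rule sum_mono)
    fix m
    have "((Rsg j E r \<Phi> (x + \<delta> *\<^sub>R GH j (a m)) - Rsg j E r \<Phi> x) \<bullet> f m)\<^sup>2 \<le> (exp (c1\<^sup>2) - 1) * I m"
      using Rsg_shift_estimates(1)[OF c r \<Phi> M, of x \<delta> "a m" "f m"] by (simp add: c1_def I_def a)
    also have "\<dots> \<le> (2 * c1)\<^sup>2 * I m" by (intro mult_right_mono exp_square_minus_one_le c1 I)
    finally show "((Rsg j E r \<Phi> (x + \<delta> *\<^sub>R GH j (a m)) - Rsg j E r \<Phi> x) \<bullet> f m)\<^sup>2 \<le> (2 * c1)\<^sup>2 * I m" .
  qed
  also have "\<dots> \<le> (2 * c1)\<^sup>2 * M\<^sup>2"
    unfolding sum_distrib_left[symmetric] by (intro mult_left_mono I) simp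
  also have "\<dots> = (2 * c1 * M)\<^sup>2" by (simp add: power_mult_distrib)
  finally show "L2_set (\<lambda>m. (Rsg j E r \<Phi> (x + \<delta> *\<^sub>R GH j (a m)) - Rsg j E r \<Phi> x) \<bullet> f m) F \<le> 2 * (\<delta> * (30 / sqrt r)) * M"
    unfolding L2_set_def c1_def[symmetric] using c1 M0 by (intro real_le_lsqrt) (auto simp: sum_nonneg)
  define c2 where "c2 = \<epsilon> * (c / r powr (3/2) * norm k)"
  assume "0 \<le> \<epsilon>" "\<epsilon> * (c / r powr (3/2) * norm k) \<le> 1"
  then have c2: "0 \<le> c2" "c2 \<le> 1" using cpos by (auto simp: c2_def)
  have "(\<Sum>m\<in>F. (sdiff r \<Phi> x \<delta> (a m) \<epsilon> k \<bullet> f m)\<^sup>2) \<le> (\<Sum>m\<in>F. ((2 * c1)\<^sup>2 * (2 * c2)\<^sup>2) * I m)"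
  proof (rule sum_mono)
    fix m
    have "(sdiff r \<Phi> x \<delta> (a m) \<epsilon> k \<bullet> f m)\<^sup>2 \<le> (exp (c1\<^sup>2) - 1) * (exp (c2\<^sup>2) - 1) * I m"
      using Rsg_shift_estimates(2)[OF c r \<Phi> M, of x \<delta> "a m" \<epsilon> k "f m"] by (simp add: c1_def c2_def I_def a sdiff_def)
    also have "\<dots> \<le> ((2 * c1)\<^sup>2 * (2 * c2)\<^sup>2) * I m" by (intro mult_right_mono mult_mono exp_square_minus_one_le c1 c2 I) auto
    finally show "(sdiff r \<Phi> x \<delta> (a m) \<epsilon> k \<bullet> f m)\<^sup>2 \<le> ((2 * c1)\<^sup>2 * (2 * c2)\<^sup>2) * I m" .
  qed
  also have "\<dots> \<le> ((2 * c1)\<^sup>2 * (2 * c2)\<^sup>2) * M\<^sup>2"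
    unfolding sum_distrib_left[symmetric] by (intro mult_left_mono I) simp
  also have "\<dots> = (2 * c1 * (2 * c2) * M)\<^sup>2" by (simp add: power_mult_distrib)
  finally show "L2_set (\<lambda>m. sdiff r \<Phi> x \<delta> (a m) \<epsilon> k \<bullet> f m) F \<le> 2 * (\<delta> * (30 / sqrt r)) * (2 * (\<epsilon> * (c / r powr (3/2) * norm k))) * M"
    unfolding L2_set_def c1_def[symmetric] c2_def[symmetric] using c1 c2 M0 by (intro real_le_lsqrt) (auto simp: sum_nonneg)
qed

text \<open>Let \<Psi> be the increment of \<Phi> by E r (\<epsilon> k), of size
  \<epsilon>^\<alpha>. The mixed difference of \<Phi> is a first difference of \<Psi>, which gives
  \<open>n1\<close>; the mixed difference of \<Psi> compares the increments \<epsilon> and 2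
  \<epsilon>, which gives \<open>n2\<close>. Halving then trades \<epsilon>^\<alpha> for \<epsilon>
  at the cost of \<eta>^(\<alpha> - 1).\<close>

lemma sdiff_L2_holder:
  fixes \<Phi> :: "'u \<times> 'w \<Rightarrow> 'v \<times> 'u" and f :: "nat \<Rightarrow> 'v \<times> 'u"
  assumes c: "control_const T c" and r: "0 < r" "r \<le> T" and \<alpha>: "1/2 \<le> \<alpha>" "\<alpha> < 1"
    and \<Phi>[measurable]: "\<Phi> \<in> borel_measurable borel" and M: "\<And>y. norm (\<Phi> y) \<le> M"
    and N: "\<And>y y'. norm (\<Phi> y - \<Phi> y') \<le> N * norm (y - y') powr \<alpha>" and N0: "N \<ge> 0"
    and F: "finite F" "\<And>m. m \<in> F \<Longrightarrow> norm (f m) = 1" "\<And>m n. m \<in> F \<Longrightarrow> n \<in> F \<Longrightarrow> m \<noteq> n \<Longrightarrow> f m \<bullet> f n = 0"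
    and a: "\<And>m. norm (a m) = 1" and \<delta>: "0 \<le> \<delta>" "\<delta> * (30 / sqrt r) \<le> 1"
    and \<epsilon>: "\<epsilon> > 0" and ce: "\<And>k. norm (emb k) \<le> ce * norm k" "ce > 0"
  shows "L2_set (\<lambda>m. sdiff r \<Phi> x \<delta> (a m) \<epsilon> k \<bullet> f m) F
    \<le> 360 * ce powr \<alpha> * c powr (1 - \<alpha>) * N * norm k * r powr (3 * \<alpha> / 2 - 2) * \<delta> * \<epsilon>"
proof (cases "k = 0")
  case True
  then show ?thesis
    using linear_0[OF bounded_linear.linear[OF emb_bounded_linear]] by (simp add: sdiff_def L2_set_def)
next
  case False
  then have nk: "norm k > 0" by simp
  have r0: "r \<ge> 0" using r by simp
  have cpos: "c > 0" using c by (simp add: control_const_def)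
  interpret e: bounded_linear emb by (rule emb_bounded_linear)
  define n where "n \<epsilon> = L2_set (\<lambda>m. sdiff r \<Phi> x \<delta> (a m) \<epsilon> k \<bullet> f m) F" for \<epsilon>
  define \<kappa> where "\<kappa> = N * (ce * norm k) powr \<alpha>"
  define A where "A = 2 * (\<delta> * (30 / sqrt r)) * \<kappa>"
  \<comment> \<open>The increment along k at which the Cameron-Martin length \<open>c2\<close>
    reaches 1.\<close>
  define \<eta> where "\<eta> = r powr (3/2) / (c * norm k)"
  have A0: "A \<ge> 0" using \<delta> r N0 by (simp add: A_def \<kappa>_def)
  have \<eta>0: "\<eta> > 0" using r cpos nk by (simp add: \<eta>_def)
  define \<Psi> where "\<Psi> \<epsilon> y = \<Phi> (y + E r (\<epsilon> *\<^sub>R emb k)) - \<Phi> y" for \<epsilon> y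
  have \<Psi>: "\<Psi> \<epsilon> \<in> borel_measurable borel" for \<epsilon> unfolding \<Psi>_def by measurable
  have \<Psi>b: "norm (\<Psi> \<epsilon> y) \<le> \<kappa> * \<epsilon> powr \<alpha>" if "\<epsilon> > 0" for \<epsilon> y
  proof -
    have "norm (\<Psi> \<epsilon> y) \<le> N * norm (\<epsilon> *\<^sub>R emb k) powr \<alpha>"
      unfolding \<Psi>_def using N[of "y + E r (\<epsilon> *\<^sub>R emb k)" y] by (simp add: E_isometry)
    also have "\<dots> \<le> N * (\<epsilon> * (ce * norm k)) powr \<alpha>"
      using that \<alpha> ce(1)[of k] by (intro mult_left_mono N0 powr_mono2) auto
    also have "\<dots> = \<kappa> * \<epsilon> powr \<alpha>" using that ce nk by (simp add: powr_mult \<kappa>_def)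
    finally show ?thesis .
  qed
  have tr: "Rsg j E r (\<Psi> \<epsilon>) z = Rsg j E r \<Phi> (z + \<epsilon> *\<^sub>R emb k) - Rsg j E r \<Phi> z" for z \<epsilon>
    unfolding \<Psi>_def by (rule Rsg_translate_diff[OF r0 \<Phi> M])
  have n1: "n \<epsilon> \<le> A * \<epsilon> powr \<alpha>" if "\<epsilon> > 0" for \<epsilon>
  proof -
    have "sdiff r \<Phi> x \<delta> b \<epsilon> k = Rsg j E r (\<Psi> \<epsilon>) (x + \<delta> *\<^sub>R GH j b) - Rsg j E r (\<Psi> \<epsilon>) x" for b
      unfolding tr sdiff_def by simp
    then have "n \<epsilon> \<le> 2 * (\<delta> * (30 / sqrt r)) * (\<kappa> * \<epsilon> powr \<alpha>)"
      unfolding n_def using Rsg_difference_L2(1)[OF c r \<Psi> \<Psi>b[OF that] F a \<delta>] by simp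
    then show ?thesis by (simp add: A_def mult.assoc)
  qed
  have n2: "n \<epsilon> \<le> n (2 * \<epsilon>) / 2 + (A / \<eta>) * \<epsilon> powr (1 + \<alpha>)" if e: "0 < \<epsilon>" "\<epsilon> \<le> \<eta>" for \<epsilon>
  proof -
    have two: "(2 * \<epsilon>) *\<^sub>R emb k = \<epsilon> *\<^sub>R emb k + \<epsilon> *\<^sub>R emb k" by (simp add: scaleR_add_left[symmetric])
    \<comment> \<open>A second difference in direction k: the mixed difference at \<epsilon> is half
      the one at 2 \<epsilon>, up to half of a mixed difference of \<Psi>.\<close>
    have sd: "sdiff r (\<Psi> \<epsilon>) x \<delta> b \<epsilon> k = sdiff r \<Phi> x \<delta> b (2 * \<epsilon>) k - 2 *\<^sub>R sdiff r \<Phi> x \<delta> b \<epsilon> k" for b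
      unfolding sdiff_def tr two by (simp add: algebra_simps scaleR_2)
    have ck: "\<epsilon> * (c / r powr (3/2) * norm k) = \<epsilon> / \<eta>" by (simp add: \<eta>_def)
    have "L2_set (\<lambda>m. sdiff r (\<Psi> \<epsilon>) x \<delta> (a m) \<epsilon> k \<bullet> f m) F \<le> 2 * (\<delta> * (30 / sqrt r)) * (2 * (\<epsilon> / \<eta>)) * (\<kappa> * \<epsilon> powr \<alpha>)"
      using Rsg_difference_L2(2)[OF c r \<Psi> \<Psi>b[OF e(1)] F a \<delta>, where x = x and \<epsilon> = \<epsilon> and k = k] e \<eta>0 unfolding ck by simp
    also have "\<dots> = 2 * ((A / \<eta>) * \<epsilon> powr (1 + \<alpha>))" using e by (simp add: A_def powr_add)
    finally have 1: "L2_set (\<lambda>m. sdiff r (\<Psi> \<epsilon>) x \<delta> (a m) \<epsilon> k \<bullet> f m) F \<le> 2 * ((A / \<eta>) * \<epsilon> powr (1 + \<alpha>))" .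
    have h: "L2_set (\<lambda>m. (1/2) * g m) F = (1/2) * L2_set g F" for g
      by (rule L2_set_right_distrib[symmetric]) simp
    have "n \<epsilon> = L2_set (\<lambda>m. (1/2) * (sdiff r \<Phi> x \<delta> (a m) (2 * \<epsilon>) k \<bullet> f m) + (1/2) * (- (sdiff r (\<Psi> \<epsilon>) x \<delta> (a m) \<epsilon> k \<bullet> f m))) F"
      unfolding n_def sd by (intro L2_set_cong refl) (simp add: inner_diff_left diff_divide_distrib)
    also have "\<dots> \<le> L2_set (\<lambda>m. (1/2) * (sdiff r \<Phi> x \<delta> (a m) (2 * \<epsilon>) k \<bullet> f m)) F
       + L2_set (\<lambda>m. (1/2) * (- (sdiff r (\<Psi> \<epsilon>) x \<delta> (a m) \<epsilon> k \<bullet> f m))) F"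
      by (rule L2_set_triangle_ineq)
    also have "\<dots> = (1/2) * n (2 * \<epsilon>) + (1/2) * L2_set (\<lambda>m. - (sdiff r (\<Psi> \<epsilon>) x \<delta> (a m) \<epsilon> k \<bullet> f m)) F"
      unfolding n_def h ..
    also have "L2_set (\<lambda>m. - (sdiff r (\<Psi> \<epsilon>) x \<delta> (a m) \<epsilon> k \<bullet> f m)) F = L2_set (\<lambda>m. sdiff r (\<Psi> \<epsilon>) x \<delta> (a m) \<epsilon> k \<bullet> f m) F"
      by (simp add: L2_set_def)
    finally show ?thesis using 1 by simp
  qed
  have "n \<epsilon> \<le> 6 * A * \<eta> powr (\<alpha> - 1) * \<epsilon>"
    by (rule halving_interpolation[OF \<alpha> A0 \<eta>0 n1 n2 \<epsilon>])
  also have "\<eta> powr (\<alpha> - 1) = r powr (3/2 * (\<alpha> - 1)) * (c powr (1 - \<alpha>) * norm k powr (1 - \<alpha>))"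
  proof -
    have "(q / d) powr (\<alpha> - 1) = q powr (\<alpha> - 1) * d powr (1 - \<alpha>)" if "q > 0" "d > 0" for q d :: real
      using that by (simp add: powr_divide powr_diff field_simps)
    from this[of "r powr (3/2)" "c * norm k"] show ?thesis
      unfolding \<eta>_def using r cpos nk by (simp add: powr_powr powr_mult)
  qed
  also have "A = 60 * \<delta> * r powr (-1/2) * N * ce powr \<alpha> * norm k powr \<alpha>"
    unfolding A_def \<kappa>_def using r ce nk
    by (simp add: powr_mult powr_minus_divide powr_half_sqrt)
  also have "6 * (60 * \<delta> * r powr (-1/2) * N * ce powr \<alpha> * norm k powr \<alpha>) * (r powr (3/2 * (\<alpha> - 1)) * (c powr (1 - \<alpha>) * norm k powr (1 - \<alpha>))) * \<epsilon>
     = 360 * ce powr \<alpha> * c powr (1 - \<alpha>) * N * (norm k powr \<alpha> * norm k powr (1 - \<alpha>)) * (r powr (-1/2) * r powr (3/2 * (\<alpha> - 1))) * \<delta> * \<epsilon>"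
    by (simp only: mult_ac)
  also have "norm k powr \<alpha> * norm k powr (1 - \<alpha>) = norm k" using nk by (simp flip: powr_add)
  also have "r powr (-1/2) * r powr (3/2 * (\<alpha> - 1)) = r powr (3 * \<alpha> / 2 - 2)"
  proof -
    have "-1/2 + 3/2 * (\<alpha> - 1) = 3 * \<alpha> / 2 - 2" by (simp add: field_simps)
    then show ?thesis by (simp flip: powr_add)
  qed
  finally show ?thesis by (simp add: n_def)
qed

end

section \<open>Integrals with a singularity at the initial time\<close>

text \<open>The primitive is continuous up to the singular endpoint, which gives a gauge integral;
  nonnegativity makes it a Lebesgue integral.\<close>

lemma set_integral_powr_singularity:
  fixes p t T :: real
  assumes p: "0 \<le> p" "p < 1" and t: "0 \<le> t" "t \<le> T"
  shows "set_integrable lborel {t..T} (\<lambda>s. (s - t) powr (-p))"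
    and "(LINT s:{t..T}|lborel. (s - t) powr (-p)) \<le> T powr (1 - p) / (1 - p)"
proof -
  define P where "P s = (s - t) powr (1 - p) / (1 - p)" for s
  have "((\<lambda>s. (s - t) powr (-p)) has_integral (P T - P t)) {t..T}"
  proof (rule fundamental_theorem_of_calculus_interior)
    show "continuous_on {t..T} P"
      unfolding P_def using p by (intro continuous_intros continuous_on_powr') auto
    fix s assume s: "s \<in> {t<..<T}"
    have "(P has_real_derivative (s - t) powr (-p)) (at s)"
      unfolding P_def using s p by (auto intro!: derivative_eq_intros)
    then show "(P has_vector_derivative (s - t) powr (-p)) (at s)"
      by (simp add: has_real_derivative_iff_has_vector_derivative)
  qed fact
  moreover have "P t = 0" by (simp add: P_def)
  ultimately have hi: "((\<lambda>s. (s - t) powr (-p)) has_integral P T) {t..T}" by simp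
  have "(\<lambda>s. (s - t) powr (-p)) absolutely_integrable_on {t..T}"
    by (rule nonnegative_absolutely_integrable_1) (use hi in auto)
  then have "integrable lebesgue (\<lambda>s. indicator {t..T} s *\<^sub>R (s - t) powr (-p))"
    by (simp add: set_integrable_def)
  then show si: "set_integrable lborel {t..T} (\<lambda>s. (s - t) powr (-p))"
    unfolding set_integrable_def by (subst (asm) integrable_completion) auto
  have "(LINT s:{t..T}|lborel. (s - t) powr (-p)) = P T"
    using set_borel_integral_eq_integral(2)[OF si] hi by (simp add: integral_unique)
  also have "\<dots> \<le> T powr (1 - p) / (1 - p)"
    unfolding P_def using p t by (intro divide_right_mono powr_mono2) auto
  finally show "(LINT s:{t..T}|lborel. (s - t) powr (-p)) \<le> T powr (1 - p) / (1 - p)" .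
qed

text \<open>At the endpoint t a negative power has the value 0 instead of blowing up, so singular
  majorants may fail there; a single point is null.\<close>

lemma set_integral_mono_interior:
  fixes g h :: "real \<Rightarrow> real"
  assumes "set_integrable lborel {t..T} g" "set_integrable lborel {t..T} h"
    and "\<And>s. t < s \<Longrightarrow> s \<le> T \<Longrightarrow> g s \<le> h s"
  shows "(LINT s:{t..T}|lborel. g s) \<le> (LINT s:{t..T}|lborel. h s)"
  unfolding set_lebesgue_integral_def
proof (rule integral_mono_AE)
  have "AE s in lborel. s \<noteq> t" by (rule AE_lborel_singleton)
  then show "AE s in lborel. indicator {t..T} s *\<^sub>R g s \<le> indicator {t..T} s *\<^sub>R h s"
    by eventually_elim (use assms(3) in \<open>auto simp: indicator_def\<close>)
qed (use assms in \<open>auto simp: set_integrable_def\<close>)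

lemma set_integral_norm_bound_interior:
  fixes g :: "real \<Rightarrow> 'a::{banach,second_countable_topology}"
  assumes g: "set_integrable lborel {t..T} g" and h: "set_integrable lborel {t..T} h"
    and le: "\<And>s. t < s \<Longrightarrow> s \<le> T \<Longrightarrow> norm (g s) \<le> h s"
  shows "norm (LINT s:{t..T}|lborel. g s) \<le> (LINT s:{t..T}|lborel. h s)"
proof -
  have "norm (LINT s:{t..T}|lborel. g s) \<le> (LINT s:{t..T}|lborel. norm (g s))"
    unfolding set_lebesgue_integral_def
    by (rule order_trans[OF integral_norm_bound]) simp
  also have "\<dots> \<le> (LINT s:{t..T}|lborel. h s)"
    by (intro set_integral_mono_interior set_integrable_norm g h le)
  finally show ?thesis .
qed

text \<open>The exponents are -1/2, from a first derivative along G, and -1/2 - 1/4, where -1/4 is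
  the price of the exponential weight in the Gronwall argument.\<close>

lemma singular_integral_bound:
  fixes D :: "real \<Rightarrow> 'a::{banach,second_countable_topology}"
  assumes t: "0 \<le> t" "t \<le> T" and D: "set_integrable lborel {t..T} D"
    and M: "M1 \<ge> 0" "M2 \<ge> 0"
    and le: "\<And>s. t < s \<Longrightarrow> s \<le> T \<Longrightarrow> norm (D s) \<le> M1 * (s - t) powr (-1/2) + M2 * (s - t) powr (-3/4)"
  shows "norm (LINT s:{t..T}|lborel. D s) \<le> M1 * (2 * sqrt T) + M2 * (4 * T powr (1/4))"
proof -
  have i1: "set_integrable lborel {t..T} (\<lambda>s. (s - t) powr (-1/2))"
    and b1: "(LINT s:{t..T}|lborel. (s - t) powr (-1/2)) \<le> 2 * sqrt T"
    using set_integral_powr_singularity[of "1/2" t T] t by (auto simp: powr_half_sqrt)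
  have i2: "set_integrable lborel {t..T} (\<lambda>s. (s - t) powr (-3/4))"
    and b2: "(LINT s:{t..T}|lborel. (s - t) powr (-3/4)) \<le> 4 * T powr (1/4)"
    using set_integral_powr_singularity[of "3/4" t T] t by (auto simp: mult.commute)
  have "norm (LINT s:{t..T}|lborel. D s) \<le> (LINT s:{t..T}|lborel. M1 * (s - t) powr (-1/2) + M2 * (s - t) powr (-3/4))"
    by (intro set_integral_norm_bound_interior D set_integral_add(1) set_integrable_mult_right i1 i2 le)
  also have "\<dots> = M1 * (LINT s:{t..T}|lborel. (s - t) powr (-1/2)) + M2 * (LINT s:{t..T}|lborel. (s - t) powr (-3/4))"
    using i1 i2 by (subst set_integral_add(2)) auto
  also have "\<dots> \<le> M1 * (2 * sqrt T) + M2 * (4 * T powr (1/4))"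
    by (intro add_mono mult_left_mono b1 b2 M)
  finally show ?thesis .
qed

text \<open>Minkowski's inequality for integrals, by duality: pair the vector A of integrals with
  itself, apply Cauchy-Schwarz under the integral, and divide by the norm of A.\<close>

lemma L2_set_integral_le:
  fixes g :: "'i \<Rightarrow> real \<Rightarrow> real"
  assumes F: "finite F" and g: "\<And>m. m \<in> F \<Longrightarrow> set_integrable lborel {t..T} (g m)"
    and h: "set_integrable lborel {t..T} h"
    and le: "\<And>s. t < s \<Longrightarrow> s \<le> T \<Longrightarrow> L2_set (\<lambda>m. g m s) F \<le> h s"
  shows "L2_set (\<lambda>m. LINT s:{t..T}|lborel. g m s) F \<le> (LINT s:{t..T}|lborel. h s)"
proof -
  define A where "A m = (LINT s:{t..T}|lborel. g m s)" for m
  define S where "S = L2_set A F"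
  have h0: "0 \<le> (LINT s:{t..T}|lborel. h s)"
  proof -
    have "(LINT s:{t..T}|lborel. 0) \<le> (LINT s:{t..T}|lborel. h s)"
      by (rule set_integral_mono_interior) (use h le in \<open>auto intro: order_trans[OF L2_set_nonneg] simp: set_integrable_def\<close>)
    then show ?thesis by (simp add: set_lebesgue_integral_def)
  qed
  have "S\<^sup>2 = (\<Sum>m\<in>F. A m * A m)" unfolding S_def L2_set_def by (simp add: sum_nonneg power2_eq_square)
  also have "\<dots> = (\<Sum>m\<in>F. LINT s|lborel. A m * (indicator {t..T} s *\<^sub>R g m s))"
    using g by (intro sum.cong refl) (simp add: A_def set_lebesgue_integral_def)
  also have "\<dots> = (LINT s|lborel. (\<Sum>m\<in>F. A m * (indicator {t..T} s *\<^sub>R g m s)))"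
    by (rule Bochner_Integration.integral_sum[symmetric]) (use g in \<open>simp add: set_integrable_def\<close>)
  also have "\<dots> = (LINT s:{t..T}|lborel. (\<Sum>m\<in>F. A m * g m s))"
    unfolding set_lebesgue_integral_def
    by (intro Bochner_Integration.integral_cong refl) (simp add: scaleR_sum_right mult_ac sum_distrib_left)
  also have "\<dots> \<le> (LINT s:{t..T}|lborel. S * h s)"
  proof (rule set_integral_mono_interior)
    show "set_integrable lborel {t..T} (\<lambda>s. \<Sum>m\<in>F. A m * g m s)"
    proof -
      have "integrable lborel (\<lambda>s. \<Sum>m\<in>F. A m * (indicator {t..T} s *\<^sub>R g m s))"
        using g by (intro Bochner_Integration.integrable_sum) (simp add: set_integrable_def)
      then show ?thesis by (simp add: set_integrable_def sum_distrib_left mult_ac)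
    qed
    show "set_integrable lborel {t..T} (\<lambda>s. S * h s)" using h by simp
    fix s assume s: "t < s" "s \<le> T"
    have "(\<Sum>m\<in>F. A m * g m s) \<le> (\<Sum>m\<in>F. \<bar>A m\<bar> * \<bar>g m s\<bar>)"
      by (intro sum_mono) (metis abs_ge_self abs_mult)
    also have "\<dots> \<le> L2_set A F * L2_set (\<lambda>m. g m s) F" by (rule L2_set_mult_ineq)
    also have "\<dots> \<le> S * h s" unfolding S_def by (intro mult_left_mono le s) simp
    finally show "(\<Sum>m\<in>F. A m * g m s) \<le> S * h s" .
  qed
  also have "\<dots> = S * (LINT s:{t..T}|lborel. h s)" by simp
  finally have "S * S \<le> S * (LINT s:{t..T}|lborel. h s)" by (simp add: power2_eq_square)
  moreover have "S \<ge> 0" by (simp add: S_def)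
  ultimately have "S \<le> (LINT s:{t..T}|lborel. h s)" using h0 by (cases "S = 0") auto
  then show ?thesis unfolding S_def A_def .
qed

text \<open>Taking for H the supremum of X, which is finite, the term H / 2 is absorbed. Mere
  finiteness thus turns into a bound by D alone.\<close>

lemma contraction_bound:
  fixes X :: "real set"
  assumes X: "bdd_above X" "\<And>x. x \<in> X \<Longrightarrow> 0 \<le> x"
    and step: "\<And>H. 0 \<le> H \<Longrightarrow> (\<And>x. x \<in> X \<Longrightarrow> x \<le> H) \<Longrightarrow> (\<And>x. x \<in> X \<Longrightarrow> x \<le> D + H / 2)"
    and x: "x \<in> X"
  shows "x \<le> 2 * D"
proof -
  have le: "y \<le> Sup X" if "y \<in> X" for y using that X(1) by (rule cSup_upper)
  then have "0 \<le> Sup X" using X(2) x by (meson order_trans)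
  then have "y \<le> D + Sup X / 2" if "y \<in> X" for y using step[of "Sup X" y] le that by blast
  then have "Sup X \<le> D + Sup X / 2" using x by (intro cSup_least) auto
  then show ?thesis using le[OF x] by linarith
qed

text \<open>From y^(1/4) <= exp y at y = l^4 r. The fourth power makes the gain exactly 1 / l, for
  an integrable singularity in r.\<close>

lemma exp_minus_le_powr:
  fixes l :: real
  assumes "l > 0" "r > 0"
  shows "exp (- (l ^ 4 * r)) \<le> r powr (-1/4) / l"
proof -
  define y where "y = l ^ 4 * r"
  have y: "y > 0" using assms by (simp add: y_def)
  have "y powr (1/4) \<le> (1 + y) powr (1/4)" using y by (intro powr_mono2) auto
  also have "\<dots> \<le> (1 + y) powr 1" using y by (intro powr_mono) auto
  also have "\<dots> \<le> exp y" using y exp_ge_add_one_self[of y] by simp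
  finally have "y powr (1/4) * exp (- y) \<le> exp y * exp (- y)" by (intro mult_right_mono) auto
  then have 1: "y powr (1/4) * exp (- y) \<le> 1" by (simp flip: exp_add)
  have l: "(l ^ 4) powr (1/4) = l" using assms powr_powr[of l 4 "1/4"] by simp
  have 2: "y powr (1/4) = l * r powr (1/4)" using assms by (simp add: y_def powr_mult l)
  have "exp (- y) \<le> 1 / (l * r powr (1/4))" using 1 assms unfolding 2 by (simp add: field_simps)
  also have "\<dots> = r powr (-1/4) / l" using assms by (simp add: powr_minus_divide)
  finally show ?thesis by (simp add: y_def)
qed

section \<open>Measurability of evaluations and bounds for directional derivatives\<close>

lemma borel_measurable_blinfun_apply2:
  fixes N :: "'a \<Rightarrow> 'b::{real_normed_vector,second_countable_topology} \<Rightarrow>\<^sub>L 'c::real_normed_vector"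
  assumes N: "N \<in> borel_measurable M" and g: "g \<in> borel_measurable M"
  shows "(\<lambda>z. blinfun_apply (N z) (g z)) \<in> borel_measurable M"
proof -
  \<comment> \<open>The operator space need not be separable, so the pair of N and g is not treated
    as one Borel map. Instead g is approximated by simple functions; on each level set N is
    evaluated at a fixed vector.\<close>
  obtain G where G: "\<And>i. simple_function M (G i)" "\<And>z. z \<in> space M \<Longrightarrow> (\<lambda>i. G i z) \<longlonglongrightarrow> g z"
    using borel_measurable_implies_sequence_metric[OF g, of 0] by blast
  show ?thesis
  proof (rule borel_measurable_LIMSEQ_metric)
    fix i
    have Nv: "(\<lambda>z. blinfun_apply (N z) v) \<in> borel_measurable M" for v
    proof -
      have "(\<lambda>f :: 'b \<Rightarrow>\<^sub>L 'c. blinfun_apply f v) \<in> borel_measurable borel"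
        by (intro borel_measurable_continuous_onI continuous_intros)
      then show ?thesis using N by (rule measurable_compose[rotated])
    qed
    show "(\<lambda>z. blinfun_apply (N z) (G i z)) \<in> borel_measurable M"
      by (rule measurable_compose_countable'[where I = "G i ` space M" and g = "G i" and f = "\<lambda>v z. blinfun_apply (N z) v"])
        (use G(1)[of i] Nv in \<open>auto simp: simple_function_def measurable_count_space_eq2 intro: countable_finite\<close>)
    show "(\<lambda>i. blinfun_apply (N z) (G i z)) \<longlonglongrightarrow> blinfun_apply (N z) (g z)" if "z \<in> space M" for z
      by (intro tendsto_intros G that)
  qed
qed

lemma dir_deriv_eqI:
  assumes "has_dir_deriv \<iota> F k x d"
  shows "dir_deriv \<iota> F k x = d"
  unfolding dir_deriv_def
proof (rule the_equality)
  fix d' assume "has_dir_deriv \<iota> F k x d'"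
  then show "d' = d" using assms unfolding has_dir_deriv_def by (intro tendsto_unique[of "at 0"]) auto
qed fact

lemma K_differentiable_has_dir_deriv:
  assumes "K_differentiable \<iota> F"
  shows "has_dir_deriv \<iota> F k x (dir_deriv \<iota> F k x)"
  using assms dir_deriv_eqI unfolding K_differentiable_def by metis

lemma nablaK_apply:
  assumes "K_differentiable \<iota> F"
  shows "blinfun_apply (nablaK \<iota> F x) k = dir_deriv \<iota> F k x"
  using assms unfolding nablaK_def K_differentiable_def by (simp add: bounded_linear_Blinfun_apply)

text \<open>Difference estimates are made for positive increments, and a one-sided limit is enough
  to bound the derivative.\<close>

lemma has_dir_deriv_right:
  assumes "has_dir_deriv \<iota> F k x d"
  shows "((\<lambda>s. (F (x + s *\<^sub>R \<iota> k) - F x) /\<^sub>R s) \<longlongrightarrow> d) (at_right 0)"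
  using assms unfolding has_dir_deriv_def by (rule tendsto_mono[rotated]) (simp add: at_le)

lemma has_dir_deriv_norm_le:
  assumes d: "has_dir_deriv \<iota> F k x d" and d': "has_dir_deriv \<iota> F k x' d'"
    and le: "\<And>s. s > 0 \<Longrightarrow> norm ((F (x' + s *\<^sub>R \<iota> k) - F x') - (F (x + s *\<^sub>R \<iota> k) - F x)) \<le> C * s"
  shows "norm (d' - d) \<le> C"
proof (rule tendsto_upperbound)
  show "((\<lambda>s. norm ((F (x' + s *\<^sub>R \<iota> k) - F x') /\<^sub>R s - (F (x + s *\<^sub>R \<iota> k) - F x) /\<^sub>R s)) \<longlongrightarrow> norm (d' - d)) (at_right 0)"
    by (intro tendsto_intros has_dir_deriv_right d d')
  show "\<forall>\<^sub>F s in at_right 0. norm ((F (x' + s *\<^sub>R \<iota> k) - F x') /\<^sub>R s - (F (x + s *\<^sub>R \<iota> k) - F x) /\<^sub>R s) \<le> C"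
    using eventually_at_right_less[of "0::real"]
  proof eventually_elim
    case (elim s)
    have "norm ((F (x' + s *\<^sub>R \<iota> k) - F x') /\<^sub>R s - (F (x + s *\<^sub>R \<iota> k) - F x) /\<^sub>R s)
      = norm ((F (x' + s *\<^sub>R \<iota> k) - F x') - (F (x + s *\<^sub>R \<iota> k) - F x)) / s"
      using elim by (simp add: scaleR_diff_right[symmetric] divide_inverse mult.commute)
    also have "\<dots> \<le> C * s / s" using elim le by (intro divide_right_mono) auto
    finally show ?case using elim by simp
  qed
qed simp

lemma has_dir_deriv_norm_le1:
  assumes d: "has_dir_deriv \<iota> F k x d"
    and le: "\<And>s. s > 0 \<Longrightarrow> norm (F (x + s *\<^sub>R \<iota> k) - F x) \<le> C * s"
  shows "norm d \<le> C"
proof (rule tendsto_upperbound)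
  show "((\<lambda>s. norm ((F (x + s *\<^sub>R \<iota> k) - F x) /\<^sub>R s)) \<longlongrightarrow> norm d) (at_right 0)"
    by (intro tendsto_intros has_dir_deriv_right d)
  show "\<forall>\<^sub>F s in at_right 0. norm ((F (x + s *\<^sub>R \<iota> k) - F x) /\<^sub>R s) \<le> C"
    using eventually_at_right_less[of "0::real"]
  proof eventually_elim
    case (elim s)
    have "norm ((F (x + s *\<^sub>R \<iota> k) - F x) /\<^sub>R s) = norm (F (x + s *\<^sub>R \<iota> k) - F x) / s"
      using elim by (simp add: divide_inverse mult.commute)
    also have "\<dots> \<le> C * s / s" using elim le by (intro divide_right_mono) auto
    finally show ?case using elim by simp
  qed
qed simp

section \<open>The integrand of the integral equation\<close>

context wave_setting
begin

definition Gop :: "real \<Rightarrow> (real \<Rightarrow> 'u \<times> 'w \<Rightarrow> 'v \<times> 'u) \<Rightarrow> 'u \<times> 'w \<Rightarrow> real \<Rightarrow> 'v \<times> 'u" where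
  "Gop t F x s = Rsg j E (s - t) (\<lambda>y. Rt (-(s - t)) (F s y)) x"

lemma bounded_borel_section:
  fixes F :: "real \<Rightarrow> 'u \<times> 'w \<Rightarrow> 'k::real_normed_vector"
  assumes "bounded_borel T F" "s \<in> {0..T}"
  shows "F s \<in> borel_measurable borel"
proof -
  have 1: "(\<lambda>(t, x). F t x) \<in> borel_measurable (restrict_space borel ({0..T} \<times> UNIV))"
    using assms(1) by (simp add: bounded_borel_def)
  have 2: "(\<lambda>x. (s, x)) \<in> borel \<rightarrow>\<^sub>M restrict_space borel ({0..T} \<times> UNIV)"
    using assms(2) by (intro measurable_restrict_space2) (auto intro!: borel_measurable_continuous_onI continuous_intros)
  show ?thesis using measurable_compose[OF 2 1] by simp
qed

lemma Rt_section_measurable: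
  fixes F :: "real \<Rightarrow> 'u \<times> 'w \<Rightarrow> 'v \<times> 'u"
  assumes "bounded_borel T F" "s \<in> {0..T}"
  shows "(\<lambda>y. Rt r (F s y)) \<in> borel_measurable borel"
  by (rule measurable_compose[OF bounded_borel_section[OF assms]
      borel_measurable_continuous_onI[OF linear_continuous_on[OF Rt_linear]]])

text \<open>With r = s - t the integrand is the integral of one jointly Borel function H of (r, y)
  against the kernel at time r, so \<open>\<mu>_integral_measurable\<close> applies; F is extended
  by 0 outside [0, T].\<close>

lemma Gop_integrable:
  assumes F: "bounded_borel T F" and t: "t \<in> {0..T}"
  shows "set_integrable lborel {t..T} (Gop t F x)"
proof -
  define F' where "F' = (\<lambda>z. indicator ({0..T} \<times> UNIV) z *\<^sub>R (case z of (s, y) \<Rightarrow> F s y))"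
  have F'm[measurable]: "F' \<in> borel_measurable borel"
    unfolding F'_def using F by (subst borel_measurable_restrict_space_iff[symmetric]) (auto simp: bounded_borel_def borel_closed closed_Times)
  obtain M where M: "\<And>s y. s \<in> {0..T} \<Longrightarrow> norm (F s y) \<le> M" using F unfolding bounded_borel_def by blast
  have Ejm: "(\<lambda>z. E (fst z) (snd z)) \<in> borel_measurable borel"
    using borel_measurable_continuous_onI[OF E_joint_continuous] by (simp add: case_prod_beta')
  have Rjm: "(\<lambda>z. Rt (fst z) (snd z)) \<in> borel_measurable borel"
    using borel_measurable_continuous_onI[OF Rt_joint_continuous] by (simp add: case_prod_beta')
  define H where "H = (\<lambda>z. Rt (- fst z) (F' (fst z + t, E (fst z) x + snd z)))"
  have "H \<in> borel_measurable borel"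
  proof -
    have "(\<lambda>z :: real \<times> 'u \<times> 'w. E (fst z) x) \<in> borel_measurable borel"
      by (rule measurable_compose[of "\<lambda>z. (fst z, x)" borel borel "\<lambda>z. E (fst z) (snd z)", simplified])
        (auto intro!: borel_measurable_continuous_onI continuous_intros Ejm)
    then have "(\<lambda>z. F' (fst z + t, E (fst z) x + snd z)) \<in> borel_measurable borel"
      by (intro measurable_compose[OF _ F'm] borel_measurable_Pair borel_measurable_add)
        (auto intro!: borel_measurable_continuous_onI continuous_intros)
    then have "(\<lambda>z. (- fst z, F' (fst z + t, E (fst z) x + snd z))) \<in> borel_measurable borel"
      by (intro borel_measurable_Pair) (auto intro!: borel_measurable_continuous_onI continuous_intros)
    from measurable_compose[OF this Rjm] show ?thesis by (simp add: H_def)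
  qed
  then have "(\<lambda>r. \<integral>y. H (r, y) \<partial>\<mu> (max 0 r)) \<in> borel_measurable borel"
    by (rule \<mu>_integral_measurable)
  then have m: "(\<lambda>s. \<integral>y. H (s - t, y) \<partial>\<mu> (max 0 (s - t))) \<in> borel_measurable borel"
    by (rule measurable_compose[rotated]) measurable
  have eq: "Gop t F x s = (\<integral>y. H (s - t, y) \<partial>\<mu> (max 0 (s - t)))" if "s \<in> {t..T}" for s
    using that t by (simp add: Gop_def Rsg_eq H_def F'_def)
  have "set_integrable lborel {t..T} (\<lambda>s. \<integral>y. H (s - t, y) \<partial>\<mu> (max 0 (s - t)))"
    unfolding set_integrable_def
  proof (rule integrableI_bounded_set_indicator[where B = M])
    show "AE s in lborel. s \<in> {t..T} \<longrightarrow> norm (\<integral>y. H (s - t, y) \<partial>\<mu> (max 0 (s - t))) \<le> M"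
    proof (rule AE_I2, rule impI)
      fix s assume s: "s \<in> {t..T}"
      have "norm (Gop t F x s) \<le> M"
        unfolding Gop_def using s t M by (intro Rsg_norm_le) (auto simp: Rt_isometry)
      then show "norm (\<integral>y. H (s - t, y) \<partial>\<mu> (max 0 (s - t))) \<le> M" using eq[OF s] by simp
    qed
  qed (use m in \<open>auto simp: emeasure_lborel_Icc_eq\<close>)
  then show ?thesis
    using set_integrable_cong[of lborel lborel "{t..T}" "{t..T}" "Gop t F x" "\<lambda>s. \<integral>y. H (s - t, y) \<partial>\<mu> (max 0 (s - t))"] eq by simp
qed

lemma Gop_add:
  assumes F1: "bounded_borel T F1" and F2: "bounded_borel T F2" and t: "t \<in> {0..T}" and s: "s \<in> {t..T}"
  shows "Gop t (\<lambda>s y. F1 s y + F2 s y) x s = Gop t F1 x s + Gop t F2 x s"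
proof -
  obtain M1 M2 where M: "\<And>s y. s \<in> {0..T} \<Longrightarrow> norm (F1 s y) \<le> M1" "\<And>s y. s \<in> {0..T} \<Longrightarrow> norm (F2 s y) \<le> M2"
    using F1 F2 unfolding bounded_borel_def by blast
  have s0: "s \<in> {0..T}" "0 \<le> s - t" using s t by auto
  have i1: "integrable (\<mu> (s - t)) (\<lambda>y. Rt (-(s - t)) (F1 s (E (s - t) x + y)))"
    by (rule Rsg_integrable[OF s0(2) Rt_section_measurable[OF F1 s0(1)], where M = M1]) (simp only: Rt_isometry, rule M(1)[OF s0(1)])
  have i2: "integrable (\<mu> (s - t)) (\<lambda>y. Rt (-(s - t)) (F2 s (E (s - t) x + y)))"
    by (rule Rsg_integrable[OF s0(2) Rt_section_measurable[OF F2 s0(1)], where M = M2]) (simp only: Rt_isometry, rule M(2)[OF s0(1)])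
  show ?thesis
    unfolding Gop_def Rsg_eq linear_add[OF bounded_linear.linear[OF Rt_linear]]
    by (rule Bochner_Integration.integral_add[OF i1 i2])
qed

end

section \<open>Solutions of the integral equation\<close>

lemma powr_quarter_div_sqrt:
  fixes r :: real
  assumes "r > 0"
  shows "(M1 + M2 * r powr (-1/4)) / sqrt r = M1 * r powr (-1/2) + M2 * r powr (-3/4)"
proof -
  have "r powr (-3/4) = r powr (-1/4) * r powr (-1/2)" by (simp flip: powr_add)
  moreover have "r powr (-1/2) = 1 / sqrt r" using assms by (simp add: powr_minus_divide powr_half_sqrt)
  ultimately show ?thesis by (simp add: add_divide_distrib)
qed

text \<open>\<beta> bounds both the sup norm and the Hoelder seminorm of B. Although u is fixed
  here, the final bounds contain only T, \<alpha>, \<beta> and constants of the setting, which makes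
  them uniform in u.\<close>

locale wave_solution = wave_setting D L DS S i j Lext E
  for D :: "'u::{real_inner,banach,second_countable_topology} set" and L DS S
    and i :: "'v::{real_inner,banach,second_countable_topology} \<Rightarrow> 'u"
    and j :: "'u \<Rightarrow> 'w::{real_inner,banach,second_countable_topology}"
    and Lext :: "'v \<Rightarrow> 'w" and E :: "real \<Rightarrow> 'u \<times> 'w \<Rightarrow> 'u \<times> 'w" +
  fixes T \<alpha> \<beta> :: real and B :: "real \<Rightarrow> 'u \<times> 'w \<Rightarrow> 'u" and u :: "real \<Rightarrow> 'u \<times> 'w \<Rightarrow> 'v \<times> 'u"
  assumes T: "T > 0" and \<alpha>: "2/3 < \<alpha>" "\<alpha> < 1"
    and B_borel: "bounded_borel T B" and \<beta>0: "\<beta> \<ge> 0"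
    and B_le: "\<And>t x. t \<in> {0..T} \<Longrightarrow> norm (B t x) \<le> \<beta>"
    and B_holder: "\<And>t x y. t \<in> {0..T} \<Longrightarrow> norm (B t x - B t y) \<le> \<beta> * norm (x - y) powr \<alpha>"
    and u_E0: "u \<in> E0 T \<alpha> (map_prod i j)"
    and u_solves: "solves_integral_equation T i j E B u"
begin

lemma u_K_differentiable: "t \<in> {0..T} \<Longrightarrow> K_differentiable emb (u t)"
  and du_K_differentiable: "t \<in> {0..T} \<Longrightarrow> K_differentiable emb (dir_deriv emb (u t) (GK \<xi>))"
  and nablaK_borel: "bounded_borel T (\<lambda>t. nablaK emb (u t))"
  and nablaG_holder0: "\<exists>C>0. \<forall>s\<in>{0..T}. \<forall>x y.
        norm (nablaG emb (u s) x - nablaG emb (u s) y) \<le> C * norm (x - y) powr \<alpha>"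
  and nablaK2_bounded: "\<exists>M. \<forall>t\<in>{0..T}. \<forall>x \<xi>. norm \<xi> = 1 \<longrightarrow>
        norm (nablaK emb (dir_deriv emb (u t) (GK \<xi>)) x) \<le> M"
  using u_E0 unfolding E0_def by blast+

lemma nablaG_apply: "t \<in> {0..T} \<Longrightarrow> blinfun_apply (nablaG emb (u t) x) a = dir_deriv emb (u t) (GK a) x"
proof -
  assume t: "t \<in> {0..T}"
  have "bounded_linear (\<lambda>k. dir_deriv emb (u t) k x)"
    using u_K_differentiable[OF t] unfolding K_differentiable_def by blast
  from bounded_linear_compose[OF this GK_bounded_linear]
  show "blinfun_apply (nablaG emb (u t) x) a = dir_deriv emb (u t) (GK a) x"
    unfolding nablaG_def by (simp add: bounded_linear_Blinfun_apply)
qed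

lemma u_has_dir_deriv: "t \<in> {0..T} \<Longrightarrow> has_dir_deriv emb (u t) (GK a) x (blinfun_apply (nablaG emb (u t) x) a)"
  using K_differentiable_has_dir_deriv[OF u_K_differentiable] nablaG_apply by metis

lemma nablaG_bounded0: "\<exists>M. \<forall>t\<in>{0..T}. \<forall>x. norm (nablaG emb (u t) x) \<le> M"
proof -
  obtain M where M: "\<And>t x. t \<in> {0..T} \<Longrightarrow> norm (nablaK emb (u t) x) \<le> M"
    using nablaK_borel unfolding bounded_borel_def by blast
  have "norm (nablaG emb (u t) x) \<le> M" if t: "t \<in> {0..T}" for t x
  proof (rule norm_blinfun_bound)
    show "0 \<le> M" using order_trans[OF norm_ge_zero M[OF t]] .
    fix a
    have "norm (blinfun_apply (nablaG emb (u t) x) a) = norm (blinfun_apply (nablaK emb (u t) x) (GK a))"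
      by (simp add: nablaG_apply[OF t] nablaK_apply[OF u_K_differentiable[OF t]])
    also have "\<dots> \<le> norm (nablaK emb (u t) x) * norm (GK a :: 'v \<times> 'u)" by (rule norm_blinfun)
    also have "\<dots> \<le> M * norm a" unfolding norm_GK by (intro mult_right_mono M[OF t]) auto
    finally show "norm (blinfun_apply (nablaG emb (u t) x) a) \<le> M * norm a" .
  qed
  then show ?thesis by blast
qed

text \<open>Both source terms of the integral equation together, so that u is a single time integral
  (\<open>u_eq\<close>).\<close>

definition FF :: "real \<Rightarrow> 'u \<times> 'w \<Rightarrow> 'v \<times> 'u" where
  "FF s y = GK (B s y) + dir_deriv emb (u s) (GK (B s y)) y"

lemma FF_eq: "s \<in> {0..T} \<Longrightarrow> FF s y = GK (B s y) + blinfun_apply (nablaG emb (u s) y) (B s y)"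
  by (simp add: FF_def nablaG_apply)

lemma GKB_borel: "bounded_borel T (\<lambda>s y. GK (B s y) :: 'v \<times> 'u)"
  unfolding bounded_borel_def
proof
  have "(\<lambda>(t, x). B t x) \<in> borel_measurable (restrict_space borel ({0..T} \<times> UNIV))"
    using B_borel by (simp add: bounded_borel_def)
  from measurable_compose[OF this borel_measurable_continuous_onI[OF linear_continuous_on[OF GK_bounded_linear]]]
  show "(\<lambda>(t, x). GK (B t x) :: 'v \<times> 'u) \<in> borel_measurable (restrict_space borel ({0..T} \<times> UNIV))"
    by (simp add: case_prod_beta')
  show "\<exists>M. \<forall>t\<in>{0..T}. \<forall>x. norm (GK (B t x) :: 'v \<times> 'u) \<le> M"
    using B_le unfolding norm_GK by blast
qed

text \<open>Borel measurability is known for \<open>nablaK\<close>, hence the derivative is written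
  as \<open>nablaK\<close> applied to \<open>GK (B s y)\<close>.\<close>

lemma duB_borel: "bounded_borel T (\<lambda>s y. dir_deriv emb (u s) (GK (B s y)) y)"
  unfolding bounded_borel_def
proof
  have N: "(\<lambda>z. nablaK emb (u (fst z)) (snd z)) \<in> borel_measurable (restrict_space borel ({0..T} \<times> UNIV))"
    using nablaK_borel by (simp add: bounded_borel_def case_prod_beta')
  have g: "(\<lambda>z. GK (B (fst z) (snd z)) :: 'v \<times> 'u) \<in> borel_measurable (restrict_space borel ({0..T} \<times> UNIV))"
    using GKB_borel by (simp add: bounded_borel_def case_prod_beta')
  have "(\<lambda>z. blinfun_apply (nablaK emb (u (fst z)) (snd z)) (GK (B (fst z) (snd z)))) \<in> borel_measurable (restrict_space borel ({0..T} \<times> UNIV))"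
    by (rule borel_measurable_blinfun_apply2[OF N g])
  moreover have "blinfun_apply (nablaK emb (u (fst z)) (snd z)) (GK (B (fst z) (snd z))) = (case z of (t, x) \<Rightarrow> dir_deriv emb (u t) (GK (B t x)) x)"
    if "z \<in> space (restrict_space borel ({0..T} \<times> UNIV))" for z :: "real \<times> 'u \<times> 'w"
    using that by (auto simp: space_restrict_space nablaK_apply[OF u_K_differentiable])
  ultimately show "(\<lambda>(t, x). dir_deriv emb (u t) (GK (B t x)) x) \<in> borel_measurable (restrict_space borel ({0..T} \<times> UNIV))"
    by (simp cong: measurable_cong)
  obtain M where M: "\<And>t x. t \<in> {0..T} \<Longrightarrow> norm (nablaG emb (u t) x) \<le> M" using nablaG_bounded0 by blast
  have "norm (dir_deriv emb (u t) (GK (B t x)) x) \<le> M * \<beta>" if t: "t \<in> {0..T}" for t x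
  proof -
    have "norm (blinfun_apply (nablaG emb (u t) x) (B t x)) \<le> norm (nablaG emb (u t) x) * norm (B t x)" by (rule norm_blinfun)
    also have "\<dots> \<le> M * \<beta>"
      using order_trans[OF norm_ge_zero M[OF t]] by (intro mult_mono M B_le t) auto
    finally show ?thesis using nablaG_apply[OF t] by simp
  qed
  then show "\<exists>M. \<forall>t\<in>{0..T}. \<forall>x. norm (dir_deriv emb (u t) (GK (B t x)) x) \<le> M" by blast
qed

lemma FF_borel: "bounded_borel T FF"
  unfolding bounded_borel_def
proof
  have "(\<lambda>z. (case z of (t, x) \<Rightarrow> GK (B t x)) + (case z of (t, x) \<Rightarrow> dir_deriv emb (u t) (GK (B t x)) x)) \<in> borel_measurable (restrict_space borel ({0..T} \<times> UNIV))"
    using GKB_borel duB_borel unfolding bounded_borel_def by (intro borel_measurable_add) blast+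
  then show "(\<lambda>(t, x). FF t x) \<in> borel_measurable (restrict_space borel ({0..T} \<times> UNIV))"
    by (simp add: FF_def case_prod_beta')
  obtain M1 M2 where M: "\<And>s y. s \<in> {0..T} \<Longrightarrow> norm (GK (B s y) :: 'v \<times> 'u) \<le> M1"
     "\<And>s y. s \<in> {0..T} \<Longrightarrow> norm (dir_deriv emb (u s) (GK (B s y)) y) \<le> M2"
    using GKB_borel duB_borel unfolding bounded_borel_def by blast
  have "norm (FF s y) \<le> M1 + M2" if "s \<in> {0..T}" for s y
    unfolding FF_def by (intro norm_triangle_mono M that)
  then show "\<exists>M. \<forall>t\<in>{0..T}. \<forall>x. norm (FF t x) \<le> M" by blast
qed

lemma u_eq:
  assumes t: "t \<in> {0..T}"
  shows "u t x = (LINT s:{t..T}|lborel. Gop t FF x s)"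
proof -
  have "u t x = (LINT s:{t..T}|lborel. Gop t (\<lambda>s y. GK (B s y)) x s)
     + (LINT s:{t..T}|lborel. Gop t (\<lambda>s y. dir_deriv emb (u s) (GK (B s y)) y) x s)"
    using u_solves t unfolding solves_integral_equation_def Let_def Gop_def Rt_def by blast
  also have "\<dots> = (LINT s:{t..T}|lborel. Gop t (\<lambda>s y. GK (B s y)) x s + Gop t (\<lambda>s y. dir_deriv emb (u s) (GK (B s y)) y) x s)"
    by (rule set_integral_add(2)[symmetric]) (intro Gop_integrable GKB_borel duB_borel t)+
  also have "\<dots> = (LINT s:{t..T}|lborel. Gop t FF x s)"
  proof (rule set_lebesgue_integral_cong)
    show "\<forall>s. s \<in> {t..T} \<longrightarrow> Gop t (\<lambda>s y. GK (B s y)) x s + Gop t (\<lambda>s y. dir_deriv emb (u s) (GK (B s y)) y) x s = Gop t FF x s"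
      using Gop_add[OF GKB_borel duB_borel t] unfolding FF_def[abs_def] by simp
  qed simp
  finally show ?thesis .
qed

lemma FF_bound: "\<exists>M. \<forall>s\<in>{0..T}. \<forall>y. norm (FF s y) \<le> M"
  using FF_borel unfolding bounded_borel_def by blast

text \<open>The singularity (s - t)^(-1/4) allowed in the source leaves room for
  \<open>growth_rate_weight\<close>; times the factor (s - t)^(-1/2) of the semigroup it is still
  integrable.\<close>

lemma u_first_difference:
  assumes t: "t \<in> {0..T}" and M: "M1 \<ge> 0" "M2 \<ge> 0" and \<delta>: "\<delta> \<ge> 0"
    and le: "\<And>s y. t < s \<Longrightarrow> s \<le> T \<Longrightarrow> norm (FF s y) \<le> M1 + M2 * (s - t) powr (-1/4)"
  shows "norm (u t (x + \<delta> *\<^sub>R GH j a) - u t x) \<le> 60 * norm a * (M1 * (2 * sqrt T) + M2 * (4 * T powr (1/4))) * \<delta>"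
proof -
  have "u t (x + \<delta> *\<^sub>R GH j a) - u t x = (LINT s:{t..T}|lborel. Gop t FF (x + \<delta> *\<^sub>R GH j a) s - Gop t FF x s)"
    unfolding u_eq[OF t] by (rule set_integral_diff(2)[symmetric]) (intro Gop_integrable FF_borel t)+
  also have "norm \<dots> \<le> (60 * norm a * \<delta> * M1) * (2 * sqrt T) + (60 * norm a * \<delta> * M2) * (4 * T powr (1/4))"
  proof (rule singular_integral_bound)
    show "set_integrable lborel {t..T} (\<lambda>s. Gop t FF (x + \<delta> *\<^sub>R GH j a) s - Gop t FF x s)"
      by (intro set_integral_diff(1) Gop_integrable FF_borel t)
    fix s assume s: "t < s" "s \<le> T"
    then have s0: "s \<in> {0..T}" using t by auto
    have "norm (Gop t FF (x + \<delta> *\<^sub>R GH j a) s - Gop t FF x s) \<le> 60 * (M1 + M2 * (s - t) powr (-1/4)) * norm a * \<delta> / sqrt (s - t)"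
      unfolding Gop_def
      by (rule Rsg_first_difference[OF _ Rt_section_measurable[OF FF_borel s0] _ \<delta>]) (use s le in \<open>simp_all only: Rt_isometry diff_gt_0_iff_gt\<close>)
    also have "\<dots> = (60 * norm a * \<delta>) * ((M1 + M2 * (s - t) powr (-1/4)) / sqrt (s - t))" by simp
    also have "\<dots> = (60 * norm a * \<delta>) * (M1 * (s - t) powr (-1/2) + M2 * (s - t) powr (-3/4))"
      using s by (subst powr_quarter_div_sqrt) auto
    finally show "norm (Gop t FF (x + \<delta> *\<^sub>R GH j a) s - Gop t FF x s) \<le> 60 * norm a * \<delta> * M1 * (s - t) powr (-1/2) + 60 * norm a * \<delta> * M2 * (s - t) powr (-3/4)"
      by (simp add: distrib_left mult.assoc)
  qed (use t M \<delta> in auto)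
  finally show ?thesis by (simp add: distrib_left distrib_right mult_ac)
qed

lemma u_first_difference_holder:
  assumes t: "t \<in> {0..T}" and N: "N1 \<ge> 0" "N2 \<ge> 0" and \<delta>: "\<delta> \<ge> 0"
    and le: "\<And>s y y'. t < s \<Longrightarrow> s \<le> T \<Longrightarrow> norm (FF s y - FF s y') \<le> (N1 + N2 * (s - t) powr (-1/4)) * norm (y - y') powr \<alpha>"
  shows "norm ((u t (x' + \<delta> *\<^sub>R GH j a) - u t x') - (u t (x + \<delta> *\<^sub>R GH j a) - u t x))
     \<le> 60 * norm a * norm (x' - x) powr \<alpha> * (N1 * (2 * sqrt T) + N2 * (4 * T powr (1/4))) * \<delta>"
proof -
  obtain M where M: "\<And>s y. s \<in> {0..T} \<Longrightarrow> norm (FF s y) \<le> M" using FF_bound by blast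
  let ?p = "norm (x' - x) powr \<alpha>"
  have "(u t (x' + \<delta> *\<^sub>R GH j a) - u t x') - (u t (x + \<delta> *\<^sub>R GH j a) - u t x) =
     (LINT s:{t..T}|lborel. (Gop t FF (x' + \<delta> *\<^sub>R GH j a) s - Gop t FF x' s) - (Gop t FF (x + \<delta> *\<^sub>R GH j a) s - Gop t FF x s))"
    unfolding u_eq[OF t] by (simp add: set_integral_diff Gop_integrable[OF FF_borel t])
  also have "norm \<dots> \<le> (60 * norm a * ?p * \<delta> * N1) * (2 * sqrt T) + (60 * norm a * ?p * \<delta> * N2) * (4 * T powr (1/4))"
  proof (rule singular_integral_bound)
    show "set_integrable lborel {t..T} (\<lambda>s. (Gop t FF (x' + \<delta> *\<^sub>R GH j a) s - Gop t FF x' s) - (Gop t FF (x + \<delta> *\<^sub>R GH j a) s - Gop t FF x s))"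
      by (intro set_integral_diff(1) Gop_integrable FF_borel t)
    fix s assume s: "t < s" "s \<le> T"
    then have s0: "s \<in> {0..T}" using t by auto
    have rt: "norm (Rt (-(s - t)) (FF s y) - Rt (-(s - t)) (FF s y')) \<le> (N1 + N2 * (s - t) powr (-1/4)) * norm (y - y') powr \<alpha>" for y y'
      using le[OF s, of y y'] by (simp add: linear_diff[OF bounded_linear.linear[OF Rt_linear], symmetric] Rt_isometry)
    have rm: "norm (Rt (-(s - t)) (FF s y)) \<le> M" for y using M[OF s0] by (simp add: Rt_isometry)
    have r: "0 < s - t" using s by simp
    have "norm ((Gop t FF (x' + \<delta> *\<^sub>R GH j a) s - Gop t FF x' s) - (Gop t FF (x + \<delta> *\<^sub>R GH j a) s - Gop t FF x s))
       \<le> 60 * ((N1 + N2 * (s - t) powr (-1/4)) * ?p) * norm a * \<delta> / sqrt (s - t)"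
      unfolding Gop_def
      by (rule Rsg_first_difference_holder[OF r Rt_section_measurable[OF FF_borel s0] rm \<delta> rt])
    also have "\<dots> = (60 * norm a * ?p * \<delta>) * ((N1 + N2 * (s - t) powr (-1/4)) / sqrt (s - t))" by simp
    also have "\<dots> = (60 * norm a * ?p * \<delta>) * (N1 * (s - t) powr (-1/2) + N2 * (s - t) powr (-3/4))"
      using s by (subst powr_quarter_div_sqrt) auto
    finally show "norm ((Gop t FF (x' + \<delta> *\<^sub>R GH j a) s - Gop t FF x' s) - (Gop t FF (x + \<delta> *\<^sub>R GH j a) s - Gop t FF x s))
       \<le> 60 * norm a * ?p * \<delta> * N1 * (s - t) powr (-1/2) + 60 * norm a * ?p * \<delta> * N2 * (s - t) powr (-3/4)"
      by (simp add: distrib_left mult.assoc)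
  qed (use t N \<delta> in auto)
  finally show ?thesis by (simp add: distrib_left distrib_right mult_ac)
qed

end

section \<open>A priori bounds and the second derivative\<close>

text \<open>The fourth power of l = 480 \<beta> T^(1/4) + 1. The contraction factor is 60 times 4
  \<beta> T^(1/4) / l, at most 1/2 for this l; the summand 1 keeps l positive when \<beta> =
  0.\<close>

definition growth_rate :: "real \<Rightarrow> real \<Rightarrow> real" where
  "growth_rate \<beta> T = (480 * \<beta> * T powr (1/4) + 1) ^ 4"

text \<open>240 is 60 times 2 times 2: the integral of (s - t)^(-1/2) is at most 2 sqrt T, and
  absorption doubles. The exponential undoes the weight.\<close>

definition grad_bound :: "real \<Rightarrow> real \<Rightarrow> real" where
  "grad_bound \<beta> T = exp (growth_rate \<beta> T * T) * (240 * \<beta> * sqrt T)"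

text \<open>The same formula with \<beta> replaced by \<beta> (1 +
  \<open>grad_bound \<beta> T\<close>), the part of the Hoelder seminorm of the source that is
  already under control.\<close>

definition grad_holder_bound :: "real \<Rightarrow> real \<Rightarrow> real" where
  "grad_holder_bound \<beta> T = exp (growth_rate \<beta> T * T) * (240 * \<beta> * sqrt T * (1 + grad_bound \<beta> T))"

lemma grad_bounds_nonneg:
  assumes "\<beta> \<ge> 0" "T > 0"
  shows "grad_bound \<beta> T \<ge> 0" "grad_holder_bound \<beta> T \<ge> 0"
  using assms by (auto simp: grad_bound_def grad_holder_bound_def)

text \<open>Moving the weight from time s to time t leaves the factor exp (- growth_rate (s - t)),
  which \<open>exp_minus_le_powr\<close> turns into the small factor 1 / l.\<close>

lemma growth_rate_weight:
  fixes \<beta> T t s :: real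
  assumes \<beta>: "\<beta> \<ge> 0" and T: "T > 0" and t: "t < s"
  shows "exp (growth_rate \<beta> T * (T - s)) \<le> exp (growth_rate \<beta> T * (T - t)) / (480 * \<beta> * T powr (1/4) + 1) * (s - t) powr (-1/4)"
proof -
  let ?l = "480 * \<beta> * T powr (1/4) + 1"
  have l: "?l > 0" using \<beta> by (simp add: add_nonneg_pos)
  have "exp (growth_rate \<beta> T * (T - s)) = exp (growth_rate \<beta> T * (T - t)) * exp (- (?l ^ 4 * (s - t)))"
    by (simp add: growth_rate_def algebra_simps flip: exp_add)
  also have "\<dots> \<le> exp (growth_rate \<beta> T * (T - t)) * ((s - t) powr (-1/4) / ?l)"
    using l t by (intro mult_left_mono exp_minus_le_powr) auto
  finally show ?thesis by simp
qed

lemma growth_rate_absorb: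
  fixes \<beta> T H :: real
  assumes \<beta>: "\<beta> \<ge> 0" and T: "T > 0" and H: "H \<ge> 0"
  shows "60 * (H * \<beta> / (480 * \<beta> * T powr (1/4) + 1) * (4 * T powr (1/4))) \<le> H / 2"
proof -
  let ?l = "480 * \<beta> * T powr (1/4) + 1"
  have l: "?l > 0" using \<beta> by (simp add: add_nonneg_pos)
  have "60 * (H * \<beta> / ?l * (4 * T powr (1/4))) = H / 2 * ((480 * \<beta> * T powr (1/4)) / ?l)" by simp
  also have "\<dots> \<le> H / 2 * 1"
    using l H by (intro mult_left_mono) auto
  finally show ?thesis by simp
qed

lemma exp_weight_iff: "exp (- a) * y \<le> H \<longleftrightarrow> y \<le> H * exp a" for a y H :: real
  by (simp add: exp_minus field_simps)

context wave_solution
begin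

abbreviation (input) ng where "ng t x \<equiv> nablaG emb (u t) x"

lemma FF_norm_le: "s \<in> {0..T} \<Longrightarrow> norm (FF s y) \<le> \<beta> + norm (ng s y) * \<beta>"
proof -
  assume s: "s \<in> {0..T}"
  have "norm (FF s y) \<le> norm (GK (B s y) :: 'v \<times> 'u) + norm (blinfun_apply (ng s y) (B s y))"
    unfolding FF_eq[OF s] by (rule norm_triangle_ineq)
  also have "\<dots> \<le> \<beta> + norm (ng s y) * \<beta>"
    unfolding norm_GK
    by (intro add_mono B_le s order_trans[OF norm_blinfun] mult_left_mono) auto
  finally show "norm (FF s y) \<le> \<beta> + norm (ng s y) * \<beta>" .
qed

text \<open>Gronwall's argument for a singular kernel, by absorption: in the sup norm weighted by
  exp (- growth_rate (T - t)) the integral equation contracts by 1/2. Membership in E_0 makes the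
  weighted norm finite, so absorption is legitimate, and the resulting bound forgets u.\<close>

lemma nablaG_bound:
  assumes t: "t \<in> {0..T}"
  shows "norm (ng t x) \<le> grad_bound \<beta> T"
proof -
  define g where "g = growth_rate \<beta> T"
  have g0: "g \<ge> 0" using \<beta>0 by (simp add: g_def growth_rate_def)
  define X where "X = {y. \<exists>t\<in>{0..T}. \<exists>x. y = exp (- (g * (T - t))) * norm (ng t x)}"
  obtain M where M: "\<And>t x. t \<in> {0..T} \<Longrightarrow> norm (ng t x) \<le> M" using nablaG_bounded0 by blast
  have e1: "exp (- (g * (T - t))) \<le> 1" if "t \<in> {0..T}" for t using that g0 by simp
  have "bdd_above X"
  proof (rule bdd_aboveI[of _ M])
    fix y assume "y \<in> X"
    then obtain t x where tx: "t \<in> {0..T}" "y = exp (- (g * (T - t))) * norm (ng t x)" by (auto simp: X_def)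
    have "y \<le> 1 * M" unfolding tx(2) using tx(1) order_trans[OF norm_ge_zero M]
      by (intro mult_mono e1 M) auto
    then show "y \<le> M" by simp
  qed
  moreover have "\<And>y. y \<in> X \<Longrightarrow> 0 \<le> y" by (auto simp: X_def)
  moreover have "y \<le> 120 * \<beta> * sqrt T + H / 2" if H: "0 \<le> H" "\<And>y. y \<in> X \<Longrightarrow> y \<le> H" and y: "y \<in> X" for H y
  proof -
    from y obtain t x where t: "t \<in> {0..T}" and yt: "y = exp (- (g * (T - t))) * norm (ng t x)" by (auto simp: X_def)
    let ?e = "exp (g * (T - t))" and ?l = "480 * \<beta> * T powr (1/4) + 1"
    have l: "?l > 0" using \<beta>0 by (simp add: add_nonneg_pos)
    have ngs: "norm (ng s z) \<le> H * exp (g * (T - s))" if s: "s \<in> {0..T}" for s z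
    proof -
      have "exp (- (g * (T - s))) * norm (ng s z) \<le> H" unfolding X_def using s by (intro H(2)[unfolded X_def]) blast
      then show ?thesis unfolding exp_weight_iff .
    qed
    define M2 where "M2 = H * \<beta> / ?l * ?e"
    have M20: "M2 \<ge> 0" using H \<beta>0 l by (simp add: M2_def)
    have Fb: "norm (FF s z) \<le> \<beta> + M2 * (s - t) powr (-1/4)" if s: "t < s" "s \<le> T" for s z
    proof -
      have s0: "s \<in> {0..T}" using s t by auto
      have "norm (FF s z) \<le> \<beta> + (H * exp (g * (T - s))) * \<beta>"
        using FF_norm_le[OF s0, of z] mult_right_mono[OF ngs[OF s0, of z] \<beta>0] by linarith
      also have "\<dots> \<le> \<beta> + (H * (?e / ?l * (s - t) powr (-1/4))) * \<beta>"
        using growth_rate_weight[OF \<beta>0 T s(1)] H \<beta>0 unfolding g_def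
        by (intro add_left_mono mult_right_mono mult_left_mono) auto
      finally show ?thesis by (simp add: M2_def mult_ac)
    qed
    have "norm (ng t x) \<le> 60 * (\<beta> * (2 * sqrt T) + M2 * (4 * T powr (1/4)))"
    proof (rule norm_blinfun_bound)
      show "0 \<le> 60 * (\<beta> * (2 * sqrt T) + M2 * (4 * T powr (1/4)))" using \<beta>0 M20 T by simp
      fix a
      have "norm (blinfun_apply (ng t x) a) \<le> 60 * norm a * (\<beta> * (2 * sqrt T) + M2 * (4 * T powr (1/4)))"
        by (rule has_dir_deriv_norm_le1[OF u_has_dir_deriv[OF t]])
          (use u_first_difference[OF t \<beta>0 M20 _ Fb] in \<open>simp add: emb_GK\<close>)
      then show "norm (blinfun_apply (ng t x) a) \<le> 60 * (\<beta> * (2 * sqrt T) + M2 * (4 * T powr (1/4))) * norm a"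
        by (simp add: mult_ac)
    qed
    then have "y \<le> exp (- (g * (T - t))) * (60 * (\<beta> * (2 * sqrt T) + M2 * (4 * T powr (1/4))))"
      unfolding yt by (intro mult_left_mono) auto
    also have "\<dots> = exp (- (g * (T - t))) * (120 * \<beta> * sqrt T) + (exp (- (g * (T - t))) * ?e) * (60 * (H * \<beta> / ?l * (4 * T powr (1/4))))"
      by (simp add: M2_def distrib_left mult_ac)
    also have "exp (- (g * (T - t))) * ?e = 1" by (simp flip: exp_add)
    also have "exp (- (g * (T - t))) * (120 * \<beta> * sqrt T) + 1 * (60 * (H * \<beta> / ?l * (4 * T powr (1/4)))) \<le> 1 * (120 * \<beta> * sqrt T) + 1 * (H / 2)"
      using growth_rate_absorb[OF \<beta>0 T H(1)] e1[OF t] \<beta>0 T by (intro add_mono mult_right_mono mult_left_mono) auto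
    finally show ?thesis by simp
  qed
  moreover have "exp (- (g * (T - t))) * norm (ng t x) \<in> X" unfolding X_def using t by blast
  ultimately have "exp (- (g * (T - t))) * norm (ng t x) \<le> 2 * (120 * \<beta> * sqrt T)"
    by (rule contraction_bound)
  then have "norm (ng t x) \<le> exp (g * (T - t)) * (240 * \<beta> * sqrt T)" unfolding exp_weight_iff by (simp add: mult_ac)
  also have "\<dots> \<le> exp (g * T) * (240 * \<beta> * sqrt T)"
    using g0 t \<beta>0 T by (intro mult_right_mono) (auto intro: mult_left_mono)
  finally show ?thesis by (simp add: grad_bound_def g_def)
qed

lemma FF_le_grad_bound: "s \<in> {0..T} \<Longrightarrow> norm (FF s y) \<le> \<beta> * (1 + grad_bound \<beta> T)"
  using FF_norm_le[of s y] mult_right_mono[OF nablaG_bound[of s y] \<beta>0] by (simp add: algebra_simps)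

text \<open>The increment of the product is split so that the unknown seminorm h meets the sup norm
  of B, while the increment of B meets the gradient already bounded.\<close>

lemma FF_diff_le:
  assumes s: "s \<in> {0..T}" and h: "norm (ng s y - ng s y') \<le> h * norm (y - y') powr \<alpha>"
  shows "norm (FF s y - FF s y') \<le> (\<beta> * (1 + grad_bound \<beta> T) + h * \<beta>) * norm (y - y') powr \<alpha>"
proof -
  let ?p = "norm (y - y') powr \<alpha>"
  have "FF s y - FF s y' = GK (B s y - B s y') + (blinfun_apply (ng s y) (B s y - B s y') + blinfun_apply (ng s y - ng s y') (B s y'))"
    unfolding FF_eq[OF s]
    by (simp add: blinfun.diff_left blinfun.diff_right linear_diff[OF bounded_linear.linear[OF GK_bounded_linear]])
  also have "norm \<dots> \<le> norm (GK (B s y - B s y') :: 'v \<times> 'u) + (norm (blinfun_apply (ng s y) (B s y - B s y')) + norm (blinfun_apply (ng s y - ng s y') (B s y')))"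
    by (intro order_trans[OF norm_triangle_ineq] add_left_mono norm_triangle_ineq)
  also have "\<dots> \<le> \<beta> * ?p + (grad_bound \<beta> T * (\<beta> * ?p) + (h * ?p) * \<beta>)"
  proof (intro add_mono)
    show "norm (GK (B s y - B s y') :: 'v \<times> 'u) \<le> \<beta> * ?p" unfolding norm_GK by (rule B_holder[OF s])
    show "norm (blinfun_apply (ng s y) (B s y - B s y')) \<le> grad_bound \<beta> T * (\<beta> * ?p)"
      using grad_bounds_nonneg[OF \<beta>0 T]
      by (intro order_trans[OF norm_blinfun] mult_mono nablaG_bound s B_holder) auto
    show "norm (blinfun_apply (ng s y - ng s y') (B s y')) \<le> (h * ?p) * \<beta>"
      using order_trans[OF norm_ge_zero h]
      by (intro order_trans[OF norm_blinfun] mult_mono h B_le s) auto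
  qed
  finally show ?thesis by (simp add: algebra_simps)
qed

text \<open>The absorption of \<open>nablaG_bound\<close>, repeated for Hoelder quotients, which are
  bounded by the definition of E_0. At x = x' the quotient q is 0 by the convention for
  division.\<close>

lemma nablaG_holder:
  assumes t: "t \<in> {0..T}"
  shows "norm (ng t x' - ng t x) \<le> grad_holder_bound \<beta> T * norm (x' - x) powr \<alpha>"
proof -
  define g where "g = growth_rate \<beta> T"
  have g0: "g \<ge> 0" using \<beta>0 by (simp add: g_def growth_rate_def)
  define N1 where "N1 = \<beta> * (1 + grad_bound \<beta> T)"
  have N10: "N1 \<ge> 0" using \<beta>0 grad_bounds_nonneg[OF \<beta>0 T] by (simp add: N1_def)
  define q where "q t x x' = norm (ng t x' - ng t x) / norm (x' - x) powr \<alpha>" for t x x'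
  have q_le: "q t x x' \<le> h \<longleftrightarrow> norm (ng t x' - ng t x) \<le> h * norm (x' - x) powr \<alpha>" if "h \<ge> 0" for t x x' h
    using that by (cases "x = x'") (auto simp: q_def divide_le_eq)
  define X where "X = {y. \<exists>t\<in>{0..T}. \<exists>x x'. y = exp (- (g * (T - t))) * q t x x'}"
  obtain M where M: "M > 0" "\<And>t x x'. t \<in> {0..T} \<Longrightarrow> norm (ng t x' - ng t x) \<le> M * norm (x' - x) powr \<alpha>"
    using nablaG_holder0 by blast
  have e1: "exp (- (g * (T - t))) \<le> 1" if "t \<in> {0..T}" for t using that g0 by simp
  have q0: "0 \<le> q t x x'" for t x x' by (simp add: q_def)
  have "bdd_above X"
  proof (rule bdd_aboveI[of _ M])
    fix y assume "y \<in> X"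
    then obtain t x x' where tx: "t \<in> {0..T}" "y = exp (- (g * (T - t))) * q t x x'" by (auto simp: X_def)
    have "y \<le> 1 * M" unfolding tx(2) using tx(1) M q_le[of M t x x'] q0
      by (intro mult_mono e1) auto
    then show "y \<le> M" by simp
  qed
  moreover have "\<And>y. y \<in> X \<Longrightarrow> 0 \<le> y" using q0 by (auto simp: X_def)
  moreover have "y \<le> 120 * N1 * sqrt T + H / 2" if H: "0 \<le> H" "\<And>y. y \<in> X \<Longrightarrow> y \<le> H" and y: "y \<in> X" for H y
  proof -
    from y obtain t x x' where t: "t \<in> {0..T}" and yt: "y = exp (- (g * (T - t))) * q t x x'" by (auto simp: X_def)
    let ?e = "exp (g * (T - t))" and ?l = "480 * \<beta> * T powr (1/4) + 1"
    have l: "?l > 0" using \<beta>0 by (simp add: add_nonneg_pos)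
    have ngs: "norm (ng s z' - ng s z) \<le> (H * exp (g * (T - s))) * norm (z' - z) powr \<alpha>" if s: "s \<in> {0..T}" for s z z'
    proof -
      have "exp (- (g * (T - s))) * q s z z' \<le> H" unfolding X_def using s by (intro H(2)[unfolded X_def]) blast
      then have "q s z z' \<le> H * exp (g * (T - s))" unfolding exp_weight_iff .
      then show ?thesis using q_le[of "H * exp (g * (T - s))" s z z'] H by simp
    qed
    define M2 where "M2 = H * \<beta> / ?l * ?e"
    have M20: "M2 \<ge> 0" using H \<beta>0 l by (simp add: M2_def)
    have Fb: "norm (FF s z - FF s z') \<le> (N1 + M2 * (s - t) powr (-1/4)) * norm (z - z') powr \<alpha>" if s: "t < s" "s \<le> T" for s z z'
    proof -
      have s0: "s \<in> {0..T}" using s t by auto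
      have "norm (FF s z - FF s z') \<le> (N1 + (H * exp (g * (T - s))) * \<beta>) * norm (z - z') powr \<alpha>"
        unfolding N1_def by (rule FF_diff_le[OF s0 ngs[OF s0]])
      also have "\<dots> \<le> (N1 + (H * (?e / ?l * (s - t) powr (-1/4))) * \<beta>) * norm (z - z') powr \<alpha>"
        using growth_rate_weight[OF \<beta>0 T s(1)] H \<beta>0 unfolding g_def
        by (intro mult_right_mono add_left_mono mult_left_mono) auto
      finally show ?thesis by (simp add: M2_def mult_ac)
    qed
    let ?p = "norm (x' - x) powr \<alpha>" and ?C = "60 * (N1 * (2 * sqrt T) + M2 * (4 * T powr (1/4)))"
    have C0: "0 \<le> ?C" using N10 M20 T by simp
    have "norm (ng t x' - ng t x) \<le> ?C * ?p"
    proof (rule norm_blinfun_bound)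
      show "0 \<le> ?C * ?p" using C0 by (intro mult_nonneg_nonneg) auto
      fix a
      have "norm (blinfun_apply (ng t x') a - blinfun_apply (ng t x) a) \<le> 60 * norm a * ?p * (N1 * (2 * sqrt T) + M2 * (4 * T powr (1/4)))"
        by (rule has_dir_deriv_norm_le[OF u_has_dir_deriv[OF t] u_has_dir_deriv[OF t]])
          (use u_first_difference_holder[OF t N10 M20 _ Fb] in \<open>simp add: emb_GK\<close>)
      then show "norm (blinfun_apply (ng t x' - ng t x) a) \<le> ?C * ?p * norm a"
        by (simp add: blinfun.diff_left mult_ac)
    qed
    then have "q t x x' \<le> ?C" using q_le[OF C0] by simp
    then have "y \<le> exp (- (g * (T - t))) * ?C"
      unfolding yt by (intro mult_left_mono) auto
    also have "\<dots> = exp (- (g * (T - t))) * (120 * N1 * sqrt T) + (exp (- (g * (T - t))) * ?e) * (60 * (H * \<beta> / ?l * (4 * T powr (1/4))))"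
      by (simp add: M2_def distrib_left mult_ac)
    also have "exp (- (g * (T - t))) * ?e = 1" by (simp flip: exp_add)
    also have "exp (- (g * (T - t))) * (120 * N1 * sqrt T) + 1 * (60 * (H * \<beta> / ?l * (4 * T powr (1/4)))) \<le> 1 * (120 * N1 * sqrt T) + 1 * (H / 2)"
      using growth_rate_absorb[OF \<beta>0 T H(1)] e1[OF t] N10 T by (intro add_mono mult_right_mono mult_left_mono) auto
    finally show ?thesis by simp
  qed
  moreover have "exp (- (g * (T - t))) * q t x x' \<in> X" unfolding X_def using t by blast
  ultimately have "exp (- (g * (T - t))) * q t x x' \<le> 2 * (120 * N1 * sqrt T)"
    by (rule contraction_bound)
  then have "q t x x' \<le> exp (g * (T - t)) * (240 * N1 * sqrt T)" unfolding exp_weight_iff by (simp add: mult_ac)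
  also have "\<dots> \<le> exp (g * T) * (240 * N1 * sqrt T)"
    using g0 t N10 T by (intro mult_right_mono) (auto intro: mult_left_mono)
  also have "\<dots> = grad_holder_bound \<beta> T" by (simp add: grad_holder_bound_def g_def N1_def mult_ac)
  finally show ?thesis using q_le[OF grad_bounds_nonneg(2)[OF \<beta>0 T]] by blast
qed

lemma FF_holder:
  assumes s: "s \<in> {0..T}"
  shows "norm (FF s y - FF s y') \<le> \<beta> * (1 + grad_bound \<beta> T + grad_holder_bound \<beta> T) * norm (y - y') powr \<alpha>"
  using FF_diff_le[OF s nablaG_holder[OF s, of y y']] by (simp add: algebra_simps)

text \<open>
  For \<open>s - t < 900 \<delta>\<^sup>2\<close> the Cameron-Martin density is not small and only the trivial bound is available.
  Its contribution is of order \<open>\<delta>\<^sup>3\<^sup>/\<^sup>2\<close>, so it disappears in the limit \<open>\<delta> \<rightarrow> 0\<close> although it depends on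
  the cardinality of \<open>F\<close>.
\<close>

lemma second_difference_L2:
  fixes f :: "nat \<Rightarrow> 'v \<times> 'u"
  assumes c: "control_const T c" and ce: "\<And>k. norm (emb k) \<le> ce * norm k" "ce > 0" and t: "t \<in> {0..T}"
    and F: "finite F" "\<And>m. m \<in> F \<Longrightarrow> norm (f m) = 1" "\<And>m n. m \<in> F \<Longrightarrow> n \<in> F \<Longrightarrow> m \<noteq> n \<Longrightarrow> f m \<bullet> f n = 0"
    and a: "\<And>m. norm (a m) = 1"
  defines "N \<equiv> \<beta> * (1 + grad_bound \<beta> T + grad_holder_bound \<beta> T)"
    and "M \<equiv> \<beta> * (1 + grad_bound \<beta> T)"
  assumes \<delta>: "\<delta> > 0" and \<epsilon>: "\<epsilon> > 0"
  shows "L2_set (\<lambda>m. ((u t (x + \<epsilon> *\<^sub>R emb k + \<delta> *\<^sub>R emb (GK (a m))) - u t (x + \<epsilon> *\<^sub>R emb k))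
       - (u t (x + \<delta> *\<^sub>R emb (GK (a m))) - u t x)) \<bullet> f m) F
    \<le> 360 * ce powr \<alpha> * c powr (1 - \<alpha>) * N * norm k * (T powr (3 * \<alpha> / 2 - 1) / (3 * \<alpha> / 2 - 1)) * \<delta> * \<epsilon>
       + 4 * M * real (card F) * (4 * T powr (1/4)) * (30 * \<delta>) powr (3/2)"
proof -
  have N0: "N \<ge> 0" and M0: "M \<ge> 0"
    using \<beta>0 grad_bounds_nonneg[OF \<beta>0 T] by (simp_all add: N_def M_def)
  define K1 where "K1 = 360 * ce powr \<alpha> * c powr (1 - \<alpha>) * N * norm k * \<delta> * \<epsilon>"
  define K2 where "K2 = 4 * M * real (card F) * (30 * \<delta>) powr (3/2)"
  have K0: "K1 \<ge> 0" "K2 \<ge> 0" using N0 M0 \<delta> \<epsilon> by (simp_all add: K1_def K2_def)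
  define \<Phi> where "\<Phi> s y = Rt (-(s - t)) (FF s y)" for s y
  define g where "g m s = sdiff (s - t) (\<Phi> s) x \<delta> (a m) \<epsilon> k \<bullet> f m" for m s
  have gG: "g m s = (Gop t FF (x + \<delta> *\<^sub>R GH j (a m) + \<epsilon> *\<^sub>R emb k) s - Gop t FF (x + \<delta> *\<^sub>R GH j (a m)) s
     - Gop t FF (x + \<epsilon> *\<^sub>R emb k) s + Gop t FF x s) \<bullet> f m" for m s
    unfolding g_def sdiff_def Gop_def \<Phi>_def[abs_def] ..
  have gi0: "set_integrable lborel {t..T} (\<lambda>s. Gop t FF (x + \<delta> *\<^sub>R GH j (a m) + \<epsilon> *\<^sub>R emb k) s - Gop t FF (x + \<delta> *\<^sub>R GH j (a m)) s
     - Gop t FF (x + \<epsilon> *\<^sub>R emb k) s + Gop t FF x s)" for m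
    by (intro set_integral_add(1) set_integral_diff(1) Gop_integrable FF_borel t)
  have gi: "set_integrable lborel {t..T} (g m)" for m
    using integrable_inner_left[of "f m" lborel] gi0[of m] unfolding set_integrable_def gG[abs_def]
    by (simp flip: inner_scaleR_left)
  have ue: "((u t (x + \<epsilon> *\<^sub>R emb k + \<delta> *\<^sub>R emb (GK (a m))) - u t (x + \<epsilon> *\<^sub>R emb k))
       - (u t (x + \<delta> *\<^sub>R emb (GK (a m))) - u t x)) \<bullet> f m = (LINT s:{t..T}|lborel. g m s)" for m
  proof -
    have A: "(LINT s:{t..T}|lborel. Gop t FF (x + \<delta> *\<^sub>R GH j (a m) + \<epsilon> *\<^sub>R emb k) s - Gop t FF (x + \<delta> *\<^sub>R GH j (a m)) s
     - Gop t FF (x + \<epsilon> *\<^sub>R emb k) s + Gop t FF x s) = 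
      u t (x + \<delta> *\<^sub>R GH j (a m) + \<epsilon> *\<^sub>R emb k) - u t (x + \<delta> *\<^sub>R GH j (a m)) - u t (x + \<epsilon> *\<^sub>R emb k) + u t x"
      unfolding u_eq[OF t]
      by (simp add: set_integral_add(2) set_integral_diff Gop_integrable[OF FF_borel t])
    have B: "(LINT s:{t..T}|lborel. g m s) = (LINT s:{t..T}|lborel. Gop t FF (x + \<delta> *\<^sub>R GH j (a m) + \<epsilon> *\<^sub>R emb k) s - Gop t FF (x + \<delta> *\<^sub>R GH j (a m)) s
     - Gop t FF (x + \<epsilon> *\<^sub>R emb k) s + Gop t FF x s) \<bullet> f m"
      unfolding set_lebesgue_integral_def gG[abs_def] real_scaleR_def inner_scaleR_left[symmetric]
      by (rule integral_inner_left) (use gi0[of m] in \<open>simp add: set_integrable_def\<close>)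
    show ?thesis unfolding B A emb_GK by (simp add: algebra_simps)
  qed
  \<comment> \<open>The total exponent of the singularity; q < 1 is exactly \<alpha> > 2/3.\<close>
  define q where "q = 2 - 3 * \<alpha> / 2"
  have q: "0 \<le> q" "q < 1" "1 - q = 3 * \<alpha> / 2 - 1" "- q = 3 * \<alpha> / 2 - 2" using \<alpha> by (auto simp: q_def)
  have t': "0 \<le> t" "t \<le> T" using t by auto
  note sq = set_integral_powr_singularity[OF q(1,2) t']
  have s34: "set_integrable lborel {t..T} (\<lambda>s. (s - t) powr (-(3/4)))"
    "(LINT s:{t..T}|lborel. (s - t) powr (-(3/4))) \<le> 4 * T powr (1/4)"
    using set_integral_powr_singularity[OF _ _ t', of "3/4"] by (auto simp: mult.commute)
  have "L2_set (\<lambda>m. LINT s:{t..T}|lborel. g m s) F \<le> (LINT s:{t..T}|lborel. K1 * (s - t) powr (-q) + K2 * (s - t) powr (-(3/4)))"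
  proof (rule L2_set_integral_le[OF F(1) gi])
    show "set_integrable lborel {t..T} (\<lambda>s. K1 * (s - t) powr (-q) + K2 * (s - t) powr (-(3/4)))"
      by (intro set_integral_add(1) set_integrable_mult_right sq s34)
    fix s assume s: "t < s" "s \<le> T"
    then have s0: "s \<in> {0..T}" and r: "0 < s - t" "s - t \<le> T" using t by auto
    have \<Phi>m: "\<Phi> s \<in> borel_measurable borel" unfolding \<Phi>_def by (rule Rt_section_measurable[OF FF_borel s0])
    have \<Phi>M: "norm (\<Phi> s y) \<le> M" for y unfolding \<Phi>_def Rt_isometry M_def by (rule FF_le_grad_bound[OF s0])
    have \<Phi>N: "norm (\<Phi> s y - \<Phi> s y') \<le> N * norm (y - y') powr \<alpha>" for y y'
      unfolding \<Phi>_def linear_diff[OF bounded_linear.linear[OF Rt_linear], symmetric] Rt_isometry N_def by (rule FF_holder[OF s0])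
    have nn: "0 \<le> K1 * (s - t) powr (-q)" "0 \<le> K2 * (s - t) powr (-(3/4))" using K0 by simp_all
    show "L2_set (\<lambda>m. g m s) F \<le> K1 * (s - t) powr (-q) + K2 * (s - t) powr (-(3/4))"
    proof (cases "\<delta> * (30 / sqrt (s - t)) \<le> 1")
      case True
      have \<alpha>': "1/2 \<le> \<alpha>" using \<alpha> by simp
      have "L2_set (\<lambda>m. g m s) F \<le> 360 * ce powr \<alpha> * c powr (1 - \<alpha>) * N * norm k * (s - t) powr (3 * \<alpha> / 2 - 2) * \<delta> * \<epsilon>"
        unfolding g_def
        by (rule sdiff_L2_holder[OF c r \<alpha>' \<alpha>(2) \<Phi>m \<Phi>M \<Phi>N N0 F a less_imp_le[OF \<delta>] True \<epsilon> ce])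
      also have "\<dots> = K1 * (s - t) powr (-q)" by (simp add: K1_def q(4))
      finally show ?thesis using nn by linarith
    next
      case False
      have gb: "\<bar>g m s\<bar> \<le> 4 * M" if m: "m \<in> F" for m
      proof -
        have R: "norm (Rsg j E (s - t) (\<Phi> s) z) \<le> M" for z using r by (intro Rsg_norm_le \<Phi>M) auto
        have "norm (sdiff (s - t) (\<Phi> s) x \<delta> (a m) \<epsilon> k) \<le> M + M + M + M"
          unfolding sdiff_def
          by (intro order_trans[OF norm_triangle_ineq] order_trans[OF norm_triangle_ineq4] add_mono R)
        then show ?thesis
          unfolding g_def using Cauchy_Schwarz_ineq2[of "sdiff (s - t) (\<Phi> s) x \<delta> (a m) \<epsilon> k" "f m"] F(2)[OF m] by simp
      qed
      have "L2_set (\<lambda>m. g m s) F \<le> (\<Sum>m\<in>F. \<bar>g m s\<bar>)" by (rule L2_set_le_sum_abs)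
      also have "\<dots> \<le> real (card F) * (4 * M)" using sum_bounded_above[of F "\<lambda>m. \<bar>g m s\<bar>" "4 * M"] gb by simp
      also have "\<dots> \<le> K2 * (s - t) powr (-(3/4))"
      proof -
        \<comment> \<open>The exponent 3/2 lies between 1 and 2: above 1, so that the term vanishes
          after division by \<delta>; below 2, so that the power (s - t)^(-3/4) is
          integrable.\<close>
        have "1 \<le> (30 * \<delta> / sqrt (s - t)) powr (3/2)"
          using False by (intro ge_one_powr_ge_zero) (auto simp: mult.commute)
        also have "\<dots> = (30 * \<delta>) powr (3/2) * (s - t) powr (-(3/4))"
        proof -
          have "sqrt (s - t) powr (3/2) = (s - t) powr (3/4)"
            using r by (simp add: powr_half_sqrt[symmetric] powr_powr)
          then show ?thesis using \<delta> r by (simp add: powr_divide powr_minus_divide)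
        qed
        finally have "real (card F) * (4 * M) * 1 \<le> real (card F) * (4 * M) * ((30 * \<delta>) powr (3/2) * (s - t) powr (-(3/4)))"
          using M0 by (intro mult_left_mono) auto
        then show ?thesis by (simp add: K2_def mult_ac)
      qed
      finally show ?thesis using nn by linarith
    qed
  qed
  also have "\<dots> = K1 * (LINT s:{t..T}|lborel. (s - t) powr (-q)) + K2 * (LINT s:{t..T}|lborel. (s - t) powr (-(3/4)))"
    using sq(1) s34(1) by (subst set_integral_add(2)) auto
  also have "\<dots> \<le> K1 * (T powr (1 - q) / (1 - q)) + K2 * (4 * T powr (1/4))"
    by (intro add_mono mult_left_mono sq s34 K0)
  finally show ?thesis unfolding ue K1_def K2_def q(3) by (simp add: mult_ac)
qed

text \<open>The limits are taken one after the other. For fixed \<epsilon>, division by \<delta> and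
  \<delta> -> 0 remove the term with \<open>card F\<close>, which carries no factor \<epsilon>; only
  then does \<epsilon> tend to 0.\<close>

lemma second_derivative_L2:
  fixes f :: "nat \<Rightarrow> 'v \<times> 'u" and k :: "'v \<times> 'u"
  assumes c: "control_const T c" and ce: "\<And>k. norm (emb k) \<le> ce * norm k" "ce > 0" and t: "t \<in> {0..T}"
    and F: "finite F" "\<And>m. m \<in> F \<Longrightarrow> norm (f m) = 1" "\<And>m n. m \<in> F \<Longrightarrow> n \<in> F \<Longrightarrow> m \<noteq> n \<Longrightarrow> f m \<bullet> f n = 0"
    and a: "\<And>m. norm (a m) = 1"
  defines "C \<equiv> 360 * ce powr \<alpha> * c powr (1 - \<alpha>) * (\<beta> * (1 + grad_bound \<beta> T + grad_holder_bound \<beta> T)) * norm k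
     * (T powr (3 * \<alpha> / 2 - 1) / (3 * \<alpha> / 2 - 1))"
  shows "L2_set (\<lambda>m. dir_deriv emb (dir_deriv emb (u t) (GK (a m))) k x \<bullet> f m) F \<le> C"
proof -
  define v where "v m = dir_deriv emb (u t) (GK (a m))" for m
  define K2 where "K2 = 4 * (\<beta> * (1 + grad_bound \<beta> T)) * real (card F) * (4 * T powr (1/4))"
  have v: "has_dir_deriv emb (u t) (GK (a m)) z (v m z)" for m z
    unfolding v_def by (rule K_differentiable_has_dir_deriv[OF u_K_differentiable[OF t]])
  have dv: "has_dir_deriv emb (v m) k x (dir_deriv emb (v m) k x)" for m
    unfolding v_def by (rule K_differentiable_has_dir_deriv[OF du_K_differentiable[OF t]])
  have L2_scale: "L2_set (\<lambda>m. (w m /\<^sub>R s) \<bullet> f m) F = L2_set (\<lambda>m. w m \<bullet> f m) F / s" if "s > 0" for w :: "nat \<Rightarrow> 'v \<times> 'u" and s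
    using L2_set_right_distrib[of "inverse s" "\<lambda>m. w m \<bullet> f m" F] that by (simp add: divide_inverse mult.commute)
  have step: "L2_set (\<lambda>m. (v m (x + \<epsilon> *\<^sub>R emb k) - v m x) \<bullet> f m) F \<le> C * \<epsilon>" if \<epsilon>: "\<epsilon> > 0" for \<epsilon>
  proof (rule tendsto_le)
    let ?w = "\<lambda>\<delta> m. (u t (x + \<epsilon> *\<^sub>R emb k + \<delta> *\<^sub>R emb (GK (a m))) - u t (x + \<epsilon> *\<^sub>R emb k)) - (u t (x + \<delta> *\<^sub>R emb (GK (a m))) - u t x)"
    show "((\<lambda>\<delta>. L2_set (\<lambda>m. (?w \<delta> m /\<^sub>R \<delta>) \<bullet> f m) F) \<longlongrightarrow> L2_set (\<lambda>m. (v m (x + \<epsilon> *\<^sub>R emb k) - v m x) \<bullet> f m) F) (at_right 0)"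
      unfolding L2_set_def scaleR_diff_right[of _ "u t (x + \<epsilon> *\<^sub>R emb k + _) - _"]
      by (intro tendsto_intros has_dir_deriv_right v)
    have "((\<lambda>\<delta>. C * \<epsilon> + K2 * 30 powr (3/2) * \<delta> powr (1/2)) \<longlongrightarrow> C * \<epsilon> + K2 * 30 powr (3/2) * 0 powr (1/2)) (at_right 0)"
    proof (intro tendsto_intros tendsto_powr')
      have "\<forall>\<^sub>F \<delta> in at_right 0. 0 \<le> (\<delta>::real)"
        using eventually_at_right_less[of "0::real"] by eventually_elim simp
      then show "0 \<noteq> 0 \<or> 0 < (1/2::real) \<and> (\<forall>\<^sub>F \<delta> in at_right 0. 0 \<le> (\<delta>::real))" by simp
    qed
    then show "((\<lambda>\<delta>. C * \<epsilon> + K2 * 30 powr (3/2) * \<delta> powr (1/2)) \<longlongrightarrow> C * \<epsilon>) (at_right 0)" by simp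
    show "\<forall>\<^sub>F \<delta> in at_right 0. L2_set (\<lambda>m. (?w \<delta> m /\<^sub>R \<delta>) \<bullet> f m) F \<le> C * \<epsilon> + K2 * 30 powr (3/2) * \<delta> powr (1/2)"
      using eventually_at_right_less[of "0::real"]
    proof eventually_elim
      case (elim \<delta>)
      have "L2_set (\<lambda>m. (?w \<delta> m /\<^sub>R \<delta>) \<bullet> f m) F = L2_set (\<lambda>m. ?w \<delta> m \<bullet> f m) F / \<delta>" by (rule L2_scale[OF elim])
      also have "\<dots> \<le> (C * \<delta> * \<epsilon> + K2 * (30 * \<delta>) powr (3/2)) / \<delta>"
        using second_difference_L2[OF c ce t F a elim \<epsilon>, where x = x and k = k] elim
        by (intro divide_right_mono) (auto simp: C_def K2_def)
      also have "\<dots> = C * \<epsilon> + K2 * ((30 * \<delta>) powr (3/2) / \<delta>)" using elim by (simp add: add_divide_distrib)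
      also have "(30 * \<delta>) powr (3/2) / \<delta> = 30 powr (3/2) * \<delta> powr (1/2)"
      proof -
        have "\<delta> powr (3/2) = \<delta> powr (1/2) * \<delta>" using powr_add[of \<delta> "1/2" 1] elim by simp
        then show ?thesis using elim by (simp add: powr_mult)
      qed
      finally show ?case by (simp add: mult_ac)
    qed
  qed simp
  have "L2_set (\<lambda>m. dir_deriv emb (v m) k x \<bullet> f m) F \<le> C"
  proof (rule tendsto_upperbound)
    show "((\<lambda>\<epsilon>. L2_set (\<lambda>m. ((v m (x + \<epsilon> *\<^sub>R emb k) - v m x) /\<^sub>R \<epsilon>) \<bullet> f m) F) \<longlongrightarrow> L2_set (\<lambda>m. dir_deriv emb (v m) k x \<bullet> f m) F) (at_right 0)"
      unfolding L2_set_def by (intro tendsto_intros has_dir_deriv_right dv)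
    show "\<forall>\<^sub>F \<epsilon> in at_right 0. L2_set (\<lambda>m. ((v m (x + \<epsilon> *\<^sub>R emb k) - v m x) /\<^sub>R \<epsilon>) \<bullet> f m) F \<le> C"
      using eventually_at_right_less[of "0::real"]
    proof eventually_elim
      case (elim \<epsilon>)
      have "L2_set (\<lambda>m. ((v m (x + \<epsilon> *\<^sub>R emb k) - v m x) /\<^sub>R \<epsilon>) \<bullet> f m) F = L2_set (\<lambda>m. (v m (x + \<epsilon> *\<^sub>R emb k) - v m x) \<bullet> f m) F / \<epsilon>"
        by (rule L2_scale[OF elim])
      also have "\<dots> \<le> (C * \<epsilon>) / \<epsilon>" using step[OF elim] elim by (intro divide_right_mono) auto
      finally show ?case using elim by simp
    qed
  qed simp
  then show ?thesis by (simp add: v_def)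
qed

end

section \<open>The main theorem\<close>

text \<open>The suprema in \<open>holder_norm\<close> carry information only over bounded sets of
  reals; M and C provide the bounds.\<close>

lemma holder_norm_bounds:
  fixes f :: "'h::real_normed_vector \<Rightarrow> 'f::real_normed_vector"
  assumes M: "\<And>x. norm (f x) \<le> M" and C: "C \<ge> 0" "\<And>x y. norm (f x - f y) \<le> C * norm (x - y) powr \<alpha>"
  shows "norm (f x) \<le> holder_norm \<alpha> f"
    and "norm (f x - f y) \<le> holder_norm \<alpha> f * norm (x - y) powr \<alpha>"
    and "holder_norm \<alpha> f \<le> M + C"
proof -
  define q where "q = (\<lambda>(x, x'). norm (f x - f x') / norm (x - x') powr \<alpha>)"
  have qC: "q p \<le> C" for p
    using C by (cases p, cases "fst p = snd p") (auto simp: q_def divide_le_eq)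
  have b1: "bdd_above (range (\<lambda>x. norm (f x)))" by (rule bdd_aboveI[of _ M]) (auto simp: M)
  have b2: "bdd_above (range q)" by (rule bdd_aboveI[of _ C]) (auto simp: qC)
  have hn: "holder_norm \<alpha> f = (SUP x. norm (f x)) + (SUP p. q p)" by (simp add: holder_norm_def q_def)
  have s1: "norm (f x) \<le> (SUP x. norm (f x))" for x by (rule cSUP_upper[OF UNIV_I b1])
  have s2: "q p \<le> (SUP p. q p)" for p by (rule cSUP_upper[OF UNIV_I b2])
  have n1: "0 \<le> (SUP x. norm (f x))" using order_trans[OF norm_ge_zero s1] .
  have n2: "0 \<le> (SUP p. q p)" using s2[of "(x, x)"] by (simp add: q_def)
  show "norm (f x) \<le> holder_norm \<alpha> f" using s1[of x] n2 hn by simp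
  have "q (x, y) \<le> holder_norm \<alpha> f" using s2[of "(x, y)"] n1 hn by simp
  then show "norm (f x - f y) \<le> holder_norm \<alpha> f * norm (x - y) powr \<alpha>"
    by (cases "x = y") (auto simp: q_def divide_le_eq)
  show "holder_norm \<alpha> f \<le> M + C"
    unfolding hn by (intro add_mono cSUP_least M qC) auto
qed

lemma has_dir_deriv_inner:
  fixes F :: "'h::real_normed_vector \<Rightarrow> 'f::real_inner"
  assumes "has_dir_deriv \<iota> F k x d"
  shows "has_dir_deriv \<iota> (\<lambda>y. F y \<bullet> v) k x (d \<bullet> v)"
proof -
  have "((\<lambda>s. ((F (x + s *\<^sub>R \<iota> k) - F x) /\<^sub>R s) \<bullet> v) \<longlongrightarrow> d \<bullet> v) (at 0)"
    using assms unfolding has_dir_deriv_def by (intro tendsto_intros)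
  then show ?thesis unfolding has_dir_deriv_def by (simp add: inner_diff_left)
qed

text \<open>Each supremum is attained up to d by its own choice \<open>a m\<close>, and the
  hypothesis covers all selections. The total error, card F times d, stays below e.\<close>

lemma sum_SUP_le:
  fixes g :: "'m \<Rightarrow> 'a \<Rightarrow> real"
  assumes F: "finite F" and A: "A \<noteq> {}" and bdd: "\<And>m. m \<in> F \<Longrightarrow> bdd_above (g m ` A)"
    and le: "\<And>a. (\<And>m. a m \<in> A) \<Longrightarrow> (\<Sum>m\<in>F. g m (a m)) \<le> K"
  shows "(\<Sum>m\<in>F. SUP a\<in>A. g m a) \<le> K"
proof (rule field_le_epsilon)
  fix e :: real assume e: "e > 0"
  define d where "d = e / (real (card F) + 1)"
  have d: "d > 0" using e by (simp add: d_def)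
  have "\<exists>a\<in>A. m \<in> F \<longrightarrow> (SUP a\<in>A. g m a) - d < g m a" for m
  proof (cases "m \<in> F")
    case True
    have "(SUP a\<in>A. g m a) - d < (SUP a\<in>A. g m a)" using d by simp
    then show ?thesis using less_cSUP_iff[OF A bdd[OF True]] by blast
  next
    case False
    then show ?thesis using A by blast
  qed
  then obtain a where a: "\<And>m. a m \<in> A" "\<And>m. m \<in> F \<Longrightarrow> (SUP a\<in>A. g m a) - d < g m (a m)" by metis
  have "(\<Sum>m\<in>F. SUP a\<in>A. g m a) \<le> (\<Sum>m\<in>F. g m (a m) + d)"
    using a(2) by (intro sum_mono) (simp add: less_imp_le algebra_simps)
  also have "\<dots> = (\<Sum>m\<in>F. g m (a m)) + real (card F) * d" by (simp add: sum.distrib)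
  also have "\<dots> \<le> K + e"
  proof (rule add_mono[OF le[OF a(1)]])
    have "real (card F) * d \<le> (real (card F) + 1) * d" using d by (simp add: distrib_right)
    also have "\<dots> = e" by (simp add: d_def add_nonneg_eq_0_iff)
    finally show "real (card F) * d \<le> e" .
  qed
  finally show "(\<Sum>m\<in>F. SUP a\<in>A. g m a) \<le> K + e" .
qed

context wave_setting
begin

text \<open>Keeps the suprema over the unit sphere of U from being taken over the empty set: a
  nonzero element of K yields a nonzero one of U.\<close>

lemma exists_unit_vector:
  assumes "(p :: 'v \<times> 'u) \<noteq> 0"
  shows "\<exists>a :: 'u. norm a = 1"
proof -
  have "\<exists>b :: 'u. b \<noteq> 0"
  proof (cases "snd p = 0")
    case True
    then have "fst p \<noteq> 0" using assms by (metis prod.collapse zero_prod_def)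
    moreover have "norm (S (i (fst p))) = norm (fst p)" by (simp add: norm_eq_sqrt_inner i_inner)
    ultimately have "S (i (fst p)) \<noteq> 0" by auto
    then show ?thesis by blast
  qed blast
  then obtain b :: 'u where "b \<noteq> 0" by blast
  then have "norm (b /\<^sub>R norm b) = 1" by simp
  then show ?thesis by blast
qed

end

context wave_solution
begin

text \<open>The finite partial sums are bounded uniformly in F and the terms are nonnegative, which
  gives summability and the bound at once. The bound on second derivatives in E_0 makes each
  supremum one of a bounded set.\<close>

lemma basis_estimate:
  fixes k :: "'v \<times> 'u" and x :: "'u \<times> 'w"
  assumes c: "control_const T c" and ce: "\<And>k. norm (emb k) \<le> ce * norm k" "ce > 0" and t: "t \<in> {0..T}"
    and f: "orthonormal_basis I f"
  defines "C \<equiv> 360 * ce powr \<alpha> * c powr (1 - \<alpha>) * (1 + grad_bound \<beta> T + grad_holder_bound \<beta> T)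
     * (T powr (3 * \<alpha> / 2 - 1) / (3 * \<alpha> / 2 - 1))"
    and "d \<equiv> \<lambda>m a. dir_deriv emb (dir_deriv emb (\<lambda>y. u t y \<bullet> f m) (GK a)) k x"
  defines "s \<equiv> \<lambda>m. SUP a\<in>{a. norm a = 1}. \<bar>d m a\<bar>\<^sup>2"
  shows "m \<in> I \<Longrightarrow> bdd_above ((\<lambda>a. \<bar>d m a\<bar>\<^sup>2) ` {a. norm a = 1})"
    and "s summable_on I" and "sqrt (\<Sum>\<^sub>\<infinity>m\<in>I. s m) \<le> C * norm k * \<beta>"
proof -
  have f1: "\<And>m. m \<in> I \<Longrightarrow> norm (f m) = 1" and f2: "\<And>m n. m \<in> I \<Longrightarrow> n \<in> I \<Longrightarrow> m \<noteq> n \<Longrightarrow> f m \<bullet> f n = 0"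
    using f by (auto simp: orthonormal_basis_def)
  have C0: "C \<ge> 0"
    unfolding C_def using \<alpha> T grad_bounds_nonneg[OF \<beta>0 T] by (intro mult_nonneg_nonneg divide_nonneg_nonneg) auto
  \<comment> \<open>Directional derivatives commute with the inner product against f m, so the
    components of u are handled through u itself.\<close>
  have "dir_deriv emb (\<lambda>y. u t y \<bullet> f m) (GK a) = (\<lambda>z. dir_deriv emb (u t) (GK a) z \<bullet> f m)" for m a
    by (intro ext dir_deriv_eqI has_dir_deriv_inner K_differentiable_has_dir_deriv[OF u_K_differentiable[OF t]])
  then have d_eq: "d m a = dir_deriv emb (dir_deriv emb (u t) (GK a)) k x \<bullet> f m" for m a
    unfolding d_def
    by (simp add: dir_deriv_eqI[OF has_dir_deriv_inner[OF K_differentiable_has_dir_deriv[OF du_K_differentiable[OF t]]]])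
  obtain M where M: "\<And>t x \<xi>. t \<in> {0..T} \<Longrightarrow> norm \<xi> = 1 \<Longrightarrow> norm (nablaK emb (dir_deriv emb (u t) (GK \<xi>)) x) \<le> M"
    using nablaK2_bounded by blast
  have bdd: "bdd_above ((\<lambda>a. \<bar>d m a\<bar>\<^sup>2) ` {a. norm a = 1})" if m: "m \<in> I" for m
  proof (rule bdd_aboveI2)
    fix a :: 'u assume "a \<in> {a. norm a = 1}"
    then have a: "norm a = 1" by simp
    have "\<bar>d m a\<bar> \<le> norm (dir_deriv emb (dir_deriv emb (u t) (GK a)) k x)"
      unfolding d_eq using Cauchy_Schwarz_ineq2[of "dir_deriv emb (dir_deriv emb (u t) (GK a)) k x" "f m"] f1[OF m] by simp
    also have "\<dots> = norm (blinfun_apply (nablaK emb (dir_deriv emb (u t) (GK a)) x) k)"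
      by (simp add: nablaK_apply[OF du_K_differentiable[OF t]])
    also have "\<dots> \<le> M * norm k"
      by (intro order_trans[OF norm_blinfun] mult_right_mono M t a) auto
    finally show "\<bar>d m a\<bar>\<^sup>2 \<le> (M * norm k)\<^sup>2" by (rule power_mono) simp
  qed
  then show "m \<in> I \<Longrightarrow> bdd_above ((\<lambda>a. \<bar>d m a\<bar>\<^sup>2) ` {a. norm a = 1})" .
  have ne: "{a :: 'u. norm a = 1} \<noteq> {}" if "m \<in> I" for m
  proof -
    have "f m \<noteq> 0" using f1[OF that] by auto
    then show ?thesis using exists_unit_vector by blast
  qed
  have s0: "0 \<le> s m" if m: "m \<in> I" for m
  proof -
    obtain a :: 'u where "norm a = 1" using ne[OF m] by blast
    then have "\<bar>d m a\<bar>\<^sup>2 \<le> s m" unfolding s_def by (intro cSUP_upper bdd m) simp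
    then show ?thesis by (rule order_trans[OF zero_le_power2])
  qed
  have sum_le: "sum s F \<le> (C * norm k * \<beta>)\<^sup>2" if F: "finite F" "F \<subseteq> I" for F
  proof (cases "F = {}")
    case False
    then have neF: "{a :: 'u. norm a = 1} \<noteq> {}" using ne F by blast
    show ?thesis
      unfolding s_def
    proof (rule sum_SUP_le[OF F(1) neF bdd])
      fix a assume "\<And>m :: nat. a m \<in> {a :: 'u. norm a = 1}"
      then have a: "norm (a m) = 1" for m by simp
      have "L2_set (\<lambda>m. dir_deriv emb (dir_deriv emb (u t) (GK (a m))) k x \<bullet> f m) F \<le> C * norm k * \<beta>"
        using second_derivative_L2[OF c ce t F(1) _ _ a, where f = f and k = k and x = x] f1 f2 F(2)
        by (auto simp: C_def mult_ac subset_iff)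
      then have "(L2_set (\<lambda>m. d m (a m)) F)\<^sup>2 \<le> (C * norm k * \<beta>)\<^sup>2"
        unfolding d_eq by (rule power_mono) simp
      then show "(\<Sum>m\<in>F. \<bar>d m (a m)\<bar>\<^sup>2) \<le> (C * norm k * \<beta>)\<^sup>2"
        by (simp add: L2_set_def sum_nonneg)
    qed (use F in auto)
  qed simp
  show "s summable_on I"
    by (rule nonneg_bdd_above_summable_on) (auto intro: s0 bdd_aboveI2 sum_le)
  then have "(\<Sum>\<^sub>\<infinity>m\<in>I. s m) \<le> (C * norm k * \<beta>)\<^sup>2"
    by (rule infsum_le_finite_sums) (rule sum_le)
  then show "sqrt (\<Sum>\<^sub>\<infinity>m\<in>I. s m) \<le> C * norm k * \<beta>"
    using C0 \<beta>0 by (intro real_le_lsqrt) (auto intro!: infsum_nonneg s0)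
qed

end

theorem theorem4p13:
  fixes T \<alpha> C0 :: real
    and D DS :: "'u::{real_inner,banach,second_countable_topology} set"
    and L S :: "'u \<Rightarrow> 'u"
    and i :: "'v::{real_inner,banach,second_countable_topology} \<Rightarrow> 'u"
    and j :: "'u \<Rightarrow> 'w::{real_inner,banach,second_countable_topology}"
    and Lext :: "'v \<Rightarrow> 'w"
    and E :: "real \<Rightarrow> 'u \<times> 'w \<Rightarrow> 'u \<times> 'w"
    and B :: "real \<Rightarrow> 'u \<times> 'w \<Rightarrow> 'u"
  defines "\<iota> \<equiv> map_prod i j"
  assumes "T > 0"
    and "wave_setting D L DS S i j Lext E"
    and "bounded_borel T B"
    and "C0 > 0" and "2/3 < \<alpha>" and "\<alpha> < 1"
    and "\<And>t x h. t \<in> {0..T} \<Longrightarrow> norm (B t (x + h) - B t x) \<le> C0 * norm h powr \<alpha>"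
  shows "\<exists>C>0. \<forall>u \<in> E0 T \<alpha> \<iota>. solves_integral_equation T i j E B u \<longrightarrow>
    (\<forall>I f. orthonormal_basis I f \<longrightarrow>
      (\<forall>t\<in>{0..T}. \<forall>x k.
        let d = (\<lambda>m a. dir_deriv \<iota> (dir_deriv \<iota> (\<lambda>y. u t y \<bullet> f m) (GK a)) k x);
            s = (\<lambda>m. SUP a\<in>{a. norm a = 1}. \<bar>d m a\<bar>\<^sup>2)
        in (\<forall>m\<in>I. bdd_above ((\<lambda>a. \<bar>d m a\<bar>\<^sup>2) ` {a. norm a = 1})) \<and>
           s summable_on I \<and>
           sqrt (\<Sum>\<^sub>\<infinity>m\<in>I. s m) \<le> C * norm k * (SUP t\<in>{0..T}. holder_norm \<alpha> (B t))))"
proof -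
  interpret wave_setting D L DS S i j Lext E by fact
  obtain M where M: "\<And>t x. t \<in> {0..T} \<Longrightarrow> norm (B t x) \<le> M"
    using \<open>bounded_borel T B\<close> unfolding bounded_borel_def by blast
  have H: "norm (B t x - B t y) \<le> C0 * norm (x - y) powr \<alpha>" if "t \<in> {0..T}" for t x y
    using assms(8)[OF that, of y "x - y"] by simp
  have C00: "C0 \<ge> 0" using \<open>C0 > 0\<close> by simp
  \<comment> \<open>One number for the sup norm and the seminorm at all times; the supremum is over
    a bounded set because M and C0 bound \<open>holder_norm\<close> uniformly in t.\<close>
  define \<beta> where "\<beta> = (SUP t\<in>{0..T}. holder_norm \<alpha> (B t))"
  have "bdd_above ((\<lambda>t. holder_norm \<alpha> (B t)) ` {0..T})"
    by (rule bdd_aboveI2) (rule holder_norm_bounds(3)[OF M C00 H])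
  then have le\<beta>: "holder_norm \<alpha> (B t) \<le> \<beta>" if "t \<in> {0..T}" for t
    unfolding \<beta>_def using that by (intro cSUP_upper)
  have B1: "norm (B t x) \<le> \<beta>" if t: "t \<in> {0..T}" for t x
    using holder_norm_bounds(1)[OF M[OF t] C00 H[OF t], of x] le\<beta>[OF t] by linarith
  have B2: "norm (B t x - B t y) \<le> \<beta> * norm (x - y) powr \<alpha>" if t: "t \<in> {0..T}" for t x y
    using holder_norm_bounds(2)[OF M[OF t] C00 H[OF t], of x y] mult_right_mono[OF le\<beta>[OF t], of "norm (x - y) powr \<alpha>"]
    by (meson order_trans powr_ge_zero)
  have \<beta>0: "\<beta> \<ge> 0" using order_trans[OF norm_ge_zero B1[of 0 0]] \<open>T > 0\<close> by simp
  obtain c where c: "control_const T c" using control_K[of T] unfolding control_const_def by blast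
  obtain ce where ce: "ce > 0" "\<And>k. norm (emb k) \<le> norm k * ce"
    using bounded_linear.pos_bounded[OF emb_bounded_linear] by blast
  have ce': "norm (emb k) \<le> ce * norm k" for k using ce(2)[of k] by (simp add: mult.commute)
  \<comment> \<open>Fixed before u, the basis, t, x and k. It depends on B through \<beta> in the a
    priori bounds, while the linear factor \<beta> of the estimate is kept outside.\<close>
  define C where "C = 360 * ce powr \<alpha> * c powr (1 - \<alpha>) * (1 + grad_bound \<beta> T + grad_holder_bound \<beta> T)
     * (T powr (3 * \<alpha> / 2 - 1) / (3 * \<alpha> / 2 - 1))"
  have "C > 0"
  proof -
    have "0 < ce powr \<alpha>" "0 < c powr (1 - \<alpha>)" "0 < T powr (3 * \<alpha> / 2 - 1)" "0 < 3 * \<alpha> / 2 - 1"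
      using ce(1) c \<open>T > 0\<close> \<open>2/3 < \<alpha>\<close> by (auto simp: control_const_def)
    moreover have "0 < 1 + grad_bound \<beta> T + grad_holder_bound \<beta> T"
      using grad_bounds_nonneg[OF \<beta>0 \<open>T > 0\<close>] by simp
    ultimately show ?thesis unfolding C_def by (intro mult_pos_pos divide_pos_pos) auto
  qed
  show ?thesis
    unfolding Let_def
  proof (intro exI[of _ C] conjI ballI impI allI)
    show "C > 0" by fact
    fix u assume u: "u \<in> E0 T \<alpha> \<iota>" "solves_integral_equation T i j E B u"
    interpret wave_solution D L DS S i j Lext E T \<alpha> \<beta> B u
      by unfold_locales (use u assms(2,4,6,7) \<beta>0 B1 B2 in \<open>auto simp: \<iota>_def\<close>)
    fix I and f :: "nat \<Rightarrow> 'v \<times> 'u" and t x k assume f: "orthonormal_basis I f" and t: "t \<in> {0..T}"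
    note est = basis_estimate[OF c ce' ce(1) t f]
    show "bdd_above ((\<lambda>a. \<bar>dir_deriv \<iota> (dir_deriv \<iota> (\<lambda>y. u t y \<bullet> f m) (GK a)) k x\<bar>\<^sup>2) ` {a. norm a = 1})" if "m \<in> I" for m
      unfolding \<iota>_def by (rule est(1)[OF that])
    show "(\<lambda>m. SUP a\<in>{a. norm a = 1}. \<bar>dir_deriv \<iota> (dir_deriv \<iota> (\<lambda>y. u t y \<bullet> f m) (GK a)) k x\<bar>\<^sup>2) summable_on I"
      unfolding \<iota>_def by (rule est(2))
    show "sqrt (\<Sum>\<^sub>\<infinity>m\<in>I. SUP a\<in>{a. norm a = 1}. \<bar>dir_deriv \<iota> (dir_deriv \<iota> (\<lambda>y. u t y \<bullet> f m) (GK a)) k x\<bar>\<^sup>2)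
       \<le> C * norm k * (SUP t\<in>{0..T}. holder_norm \<alpha> (B t))"
      unfolding \<iota>_def C_def \<beta>_def[symmetric] by (rule est(3))
  qed
qed

end
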